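(* Let $F$ be a non-commutative random variable in the second Wigner chaos with symmetric distribution such that $\varphi(F^2)\le1$, and let $F_\infty=(S_1^2-S_2^2)/\sqrt2$ have the normalized tetilla law ($S_1,S_2$ freely independent centered semicircular of unit variance). Then: 1. for every integer $r\ge1$, $\widehat\kappa_{2r}(F)\le\widehat\kappa_{2r}(F_\infty)$; 2. for every integer $r\ge1$, $\varphi(F^{2r})\le\varphi(F_\infty^{2r})$; 3. if one of the free cumulant or moment inequalities in items 1 or 2 is an equality for some $r\ge2$, then $F\overset{law}{=}F_\infty$.
   Context: Let $(\mathcal A,\varphi)$ be a free probability space (von Neumann algebra with faithful, positive, weakly continuous, unital trace) carrying a free Brownian motion $S$. The second Wigner chaos is the set of Wigner double integrals $I_2^S(f)$, $f\in L^2(\mathbb R_+^2)$ real and symmetric; equivalently, its elements are the $F=\sum_{z\in\mathbb Z}\lambda_z(S_z^2-1)$ with $(S_z)$ freely independent centered semicircular variables of unit variance, $\lambda_z$ real, $\sum_z\lambda_z^2=\varphi(F^2)<\infty$ (convergence in $L^2(\mathcal A,\varphi)$). The law of a self-adjoint $F$ is the probability measure $Q$ on $\mathbb R$ with $\varphi(F^n)=\int x^nQ(dx)$ for all $n$; $F$ has symmetric distribution if $F$ and $-F$ have the same law. Free cumulants $\widehat\kappa_\ell(F)$ are defined by $\varphi(F^n)=\sum_{\rho\in NC_n}\prod_{A\in\rho}\widehat\kappa_{|A|}(F)$, sum over non-crossing partitions of $\{1,\dots,n\}$; for $F=\sum_{z\in\mathbb Z}\lambda_z(S_z^2-1)$ in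 the second Wigner chaos, $\widehat\kappa_1(F)=0$ and $\widehat\kappa_n(F)=\sum_z\lambda_z^n$ for $n\ge2$. *)

theory Defs
  imports "HOL-Probability.Probability"
begin

section \<open>Complex Hilbert spaces and their bounded operators\<close>

class complex_vector = real_vector +
  fixes scaleC :: "complex \<Rightarrow> 'a \<Rightarrow> 'a"  (infixr \<open>*\<^sub>C\<close> 75)
  assumes scaleC_add_right: "c *\<^sub>C (x + y) = c *\<^sub>C x + c *\<^sub>C y"
    and scaleC_add_left: "(c + d) *\<^sub>C x = c *\<^sub>C x + d *\<^sub>C x"
    and scaleC_scaleC: "c *\<^sub>C d *\<^sub>C x = (c * d) *\<^sub>C x"
    and scaleC_of_real: "complex_of_real r *\<^sub>C x = r *\<^sub>R x"

text \<open>The inner product is linear in its first argument; completeness comes from \<open>banach\<close>.\<close>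

class complex_hilbert_space = complex_vector + banach +
  fixes cinner :: "'a \<Rightarrow> 'a \<Rightarrow> complex"
  assumes cinner_commute: "cinner x y = cnj (cinner y x)"
    and cinner_add_left: "cinner (x + y) z = cinner x z + cinner y z"
    and cinner_scaleC_left: "cinner (c *\<^sub>C x) y = c * cinner x y"
    and cinner_self: "cinner x x = complex_of_real ((norm x)\<^sup>2)"

lemma norm_scaleC: "norm (c *\<^sub>C x) = cmod c * norm (x :: 'a::complex_hilbert_space)"
proof -
  have "cinner (c *\<^sub>C x) (c *\<^sub>C x) = c * cnj c * cinner x x"
    by (metis cinner_commute cinner_scaleC_left complex_cnj_cnj complex_cnj_mult mult.assoc)
  hence "complex_of_real ((norm (c *\<^sub>C x))\<^sup>2) = complex_of_real ((cmod c * norm x)\<^sup>2)"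
    by (simp add: cinner_self complex_norm_square[symmetric] power_mult_distrib)
  hence "(norm (c *\<^sub>C x))\<^sup>2 = (cmod c * norm x)\<^sup>2"
    using of_real_eq_iff by blast
  thus ?thesis by simp
qed

lemma bounded_linear_scaleC: "bounded_linear (\<lambda>x :: 'a::complex_hilbert_space. c *\<^sub>C x)"
proof (rule bounded_linear_intro[where K = "cmod c"])
  fix r :: real and x y :: 'a
  show "c *\<^sub>C (x + y) = c *\<^sub>C x + c *\<^sub>C y" by (rule scaleC_add_right)
  show "c *\<^sub>C r *\<^sub>R x = r *\<^sub>R c *\<^sub>C x"
    by (simp add: scaleC_of_real[symmetric] scaleC_scaleC mult.commute)
  show "norm (c *\<^sub>C x) \<le> norm x * cmod c" by (simp add: norm_scaleC mult.commute)
qed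

lemma scaleC_zero_minus_diff [simp]:
  fixes x y :: "'a::complex_hilbert_space"
  shows "c *\<^sub>C (0 :: 'a) = 0" "c *\<^sub>C (- x) = - (c *\<^sub>C x)"
    "c *\<^sub>C (x - y) = c *\<^sub>C x - c *\<^sub>C y"
  using bounded_linear.linear[OF bounded_linear_scaleC[of c, where 'a = 'a]]
  by (simp_all only: linear_0 linear_neg linear_diff)

typedef (overloaded) ('h::complex_hilbert_space) operator =
  "{T :: 'h \<Rightarrow>\<^sub>L 'h. \<forall>c x. blinfun_apply T (c *\<^sub>C x) = c *\<^sub>C blinfun_apply T x}"
  morphisms blinfun_of_operator operator_of_blinfun
  by (rule exI[of _ id_blinfun]) simp

setup_lifting type_definition_operator

lift_definition op_apply :: "'h::complex_hilbert_space operator \<Rightarrow> 'h \<Rightarrow> 'h" is blinfun_apply .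

lemma operator_eqI: "(\<And>x. op_apply S x = op_apply T x) \<Longrightarrow> S = T"
  by transfer (auto intro: blinfun_eqI)

instantiation operator :: (complex_hilbert_space) "{ring, monoid_mult, real_algebra, complex_vector}"
begin

lift_definition zero_operator :: "'a operator" is 0 by simp
lift_definition plus_operator :: "'a operator \<Rightarrow> 'a operator \<Rightarrow> 'a operator" is "(+)"
  by (simp add: blinfun.add_left scaleC_add_right)
lift_definition uminus_operator :: "'a operator \<Rightarrow> 'a operator" is uminus
  by (simp add: blinfun.minus_left)
lift_definition minus_operator :: "'a operator \<Rightarrow> 'a operator \<Rightarrow> 'a operator" is "(-)"
  by (simp add: blinfun.diff_left)
lift_definition one_operator :: "'a operator" is id_blinfun by simp
lift_definition times_operator :: "'a operator \<Rightarrow> 'a operator \<Rightarrow> 'a operator" is "(o\<^sub>L)" by simp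
lift_definition scaleR_operator :: "real \<Rightarrow> 'a operator \<Rightarrow> 'a operator" is "(*\<^sub>R)"
  by (simp add: blinfun.scaleR_left scaleC_of_real[symmetric] scaleC_scaleC mult.commute)
lift_definition scaleC_operator :: "complex \<Rightarrow> 'a operator \<Rightarrow> 'a operator"
  is "\<lambda>c T. Blinfun (\<lambda>x. c *\<^sub>C x) o\<^sub>L T"
  by (simp add: bounded_linear_Blinfun_apply bounded_linear_scaleC scaleC_scaleC mult.commute)

instance
proof
  fix S T U :: "'a operator" and r s :: real and c d :: complex
  show "S + T + U = S + (T + U)" "S + T = T + S" "0 + S = S" "- S + S = 0" "S - T = S + - T"
    by (transfer, simp)+
  show "S * T * U = S * (T * U)" by transfer (auto intro: blinfun_eqI)
  show "(S + T) * U = S * U + T * U" by transfer (auto intro: blinfun_eqI simp: blinfun.add_left)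
  show "S * (T + U) = S * T + S * U"
    by transfer (auto intro: blinfun_eqI simp: blinfun.add_left blinfun.add_right)
  show "1 * S = S" "S * 1 = S" by (transfer, auto intro: blinfun_eqI)+
  show "r *\<^sub>R (S + T) = r *\<^sub>R S + r *\<^sub>R T" by transfer (simp add: scaleR_add_right)
  show "(r + s) *\<^sub>R S = r *\<^sub>R S + s *\<^sub>R S" by transfer (simp add: scaleR_add_left)
  show "r *\<^sub>R s *\<^sub>R S = (r * s) *\<^sub>R S" "1 *\<^sub>R S = S" by (transfer, simp)+
  show "r *\<^sub>R S * T = r *\<^sub>R (S * T)"
    by transfer (auto intro: blinfun_eqI simp: blinfun.scaleR_left)
  show "S * r *\<^sub>R T = r *\<^sub>R (S * T)"
    by transfer (auto intro: blinfun_eqI simp: blinfun.scaleR_left blinfun.scaleR_right)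
  show "c *\<^sub>C (S + T) = c *\<^sub>C S + c *\<^sub>C T"
    by transfer (auto intro: blinfun_eqI simp: blinfun.add_left blinfun.add_right)
  show "(c + d) *\<^sub>C S = c *\<^sub>C S + d *\<^sub>C S"
    by transfer (auto intro!: blinfun_eqI
        simp: blinfun.add_left bounded_linear_Blinfun_apply bounded_linear_scaleC scaleC_add_left)
  show "c *\<^sub>C d *\<^sub>C S = (c * d) *\<^sub>C S"
    by transfer (auto intro!: blinfun_eqI
        simp: bounded_linear_Blinfun_apply bounded_linear_scaleC scaleC_scaleC)
  show "complex_of_real r *\<^sub>C S = r *\<^sub>R S"
    by transfer (auto intro!: blinfun_eqI
        simp: blinfun.scaleR_left bounded_linear_Blinfun_apply bounded_linear_scaleC scaleC_of_real)
qed

end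

lemma op_apply_simps [simp]:
  "op_apply 0 x = 0" "op_apply 1 x = x" "op_apply (S + T) x = op_apply S x + op_apply T x"
  "op_apply (S - T) x = op_apply S x - op_apply T x" "op_apply (- S) x = - op_apply S x"
  "op_apply (S * T) x = op_apply S (op_apply T x)" "op_apply (r *\<^sub>R S) x = r *\<^sub>R op_apply S x"
  "op_apply (c *\<^sub>C S) x = c *\<^sub>C op_apply S x"
  by (transfer, simp add: blinfun.add_left blinfun.diff_left blinfun.minus_left
      blinfun.scaleR_left bounded_linear_Blinfun_apply bounded_linear_scaleC)+

definition is_adjoint :: "'h::complex_hilbert_space operator \<Rightarrow> 'h operator \<Rightarrow> bool" where
  "is_adjoint T T' \<longleftrightarrow> (\<forall>x y. cinner (op_apply T x) y = cinner x (op_apply T' y))"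

definition adj :: "'h::complex_hilbert_space operator \<Rightarrow> 'h operator" where
  "adj T = (THE T'. is_adjoint T T')"

lemma is_adjoint_unique:
  assumes "is_adjoint T S" "is_adjoint T S'"
  shows "S = S'"
proof (rule operator_eqI)
  fix y
  let ?d = "op_apply S y - op_apply S' y"
  have *: "cinner x (u + v) = cinner x u + cinner x v" for x u v :: 'a
    by (metis cinner_add_left cinner_commute complex_cnj_add)
  have "cinner ?d (op_apply S y) = cinner ?d (op_apply S' y)"
    using assms by (metis is_adjoint_def)
  moreover have "cinner ?d (op_apply S y) = cinner ?d ?d + cinner ?d (op_apply S' y)"
    by (simp flip: *)
  ultimately show "op_apply S y = op_apply S' y"
    by (simp add: cinner_self)
qed

lemma adj_eq: "is_adjoint T S \<Longrightarrow> adj T = S"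
  unfolding adj_def using is_adjoint_unique by blast

definition selfadjoint :: "'h::complex_hilbert_space operator \<Rightarrow> bool" where
  "selfadjoint T \<longleftrightarrow> is_adjoint T T"


section \<open>Free probability spaces\<close>

definition weak_operator_topology :: "'h::complex_hilbert_space operator topology" where
  "weak_operator_topology =
     topology_generated_by {{T. cinner (op_apply T x) y \<in> U} |x y U. open U}"

definition ultraweak_topology :: "'h::complex_hilbert_space operator topology" where
  "ultraweak_topology =
     topology_generated_by {{T. (\<Sum>i. cinner (op_apply T (x i)) (y i)) \<in> U} |x y U.
       summable (\<lambda>i. (norm (x i))\<^sup>2) \<and> summable (\<lambda>i. (norm (y i))\<^sup>2) \<and> open U}"

definition von_neumann_algebra :: "'h::complex_hilbert_space operator set \<Rightarrow> bool" where
  "von_neumann_algebra A \<longleftrightarrow>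
     1 \<in> A \<and> (\<forall>S\<in>A. \<forall>T\<in>A. S + T \<in> A \<and> S * T \<in> A) \<and> (\<forall>c. \<forall>T\<in>A. c *\<^sub>C T \<in> A) \<and>
     (\<forall>T\<in>A. \<exists>T'\<in>A. is_adjoint T T') \<and> closedin weak_operator_topology A"

text \<open>
  The values of \<open>\<phi>\<close> outside \<open>A\<close> are irrelevant. Weak continuity of the trace is normality, i.e.
  ultraweak continuity; every functional that is continuous for the weak operator topology has it.
\<close>

definition free_probability_space ::
    "'h::complex_hilbert_space operator set \<Rightarrow> ('h operator \<Rightarrow> complex) \<Rightarrow> bool" where
  "free_probability_space A \<phi> \<longleftrightarrow>
     von_neumann_algebra A \<and>
     (\<forall>S\<in>A. \<forall>T\<in>A. \<phi> (S + T) = \<phi> S + \<phi> T) \<and> (\<forall>c. \<forall>T\<in>A. \<phi> (c *\<^sub>C T) = c * \<phi> T) \<and>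
     \<phi> 1 = 1 \<and>
     (\<forall>T\<in>A. \<phi> (adj T * T) \<in> \<real>\<^sub>\<ge>\<^sub>0) \<and>
     (\<forall>T\<in>A. \<phi> (adj T * T) = 0 \<longrightarrow> T = 0) \<and>
     (\<forall>S\<in>A. \<forall>T\<in>A. \<phi> (S * T) = \<phi> (T * S)) \<and>
     continuous_map (subtopology ultraweak_topology A) euclidean \<phi>"

definition has_law ::
    "('h::complex_hilbert_space operator \<Rightarrow> complex) \<Rightarrow> 'h operator \<Rightarrow> real measure \<Rightarrow> bool" where
  "has_law \<phi> F Q \<longleftrightarrow> selfadjoint F \<and> real_distribution Q \<and>
     (\<forall>n. integrable Q (\<lambda>x. x ^ n) \<and> \<phi> (F ^ n) = complex_of_real (\<integral>x. x ^ n \<partial>Q))"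

definition same_law ::
    "('h::complex_hilbert_space operator \<Rightarrow> complex) \<Rightarrow> 'h operator \<Rightarrow> 'h operator \<Rightarrow> bool" where
  "same_law \<phi> F G \<longleftrightarrow> (\<exists>Q. has_law \<phi> F Q \<and> has_law \<phi> G Q)"

definition symmetric_distribution ::
    "('h::complex_hilbert_space operator \<Rightarrow> complex) \<Rightarrow> 'h operator \<Rightarrow> bool" where
  "symmetric_distribution \<phi> F \<longleftrightarrow> same_law \<phi> F (- F)"

text \<open>The centered semicircular law of variance \<open>t > 0\<close>.\<close>

definition semicircle :: "real \<Rightarrow> real measure" where
  "semicircle t = density lborel
     (\<lambda>x. ennreal (indicator {- 2 * sqrt t..2 * sqrt t} x * sqrt (4 * t - x\<^sup>2) / (2 * pi * t)))"

definition poly_op :: "complex poly \<Rightarrow> 'h::complex_hilbert_space operator \<Rightarrow> 'h operator" where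
  "poly_op p T = (\<Sum>k\<le>degree p. coeff p k *\<^sub>C T ^ k)"

text \<open>
  Freeness of the unital algebras \<open>{poly_op p (X i) | p}\<close>, \<open>i \<in> I\<close>: a product of centered elements
  of these algebras in which neighbouring factors have different indices is centered.
\<close>

definition freely_independent ::
    "('h::complex_hilbert_space operator \<Rightarrow> complex) \<Rightarrow> 'i set \<Rightarrow> ('i \<Rightarrow> 'h operator) \<Rightarrow> bool" where
  "freely_independent \<phi> I X \<longleftrightarrow>
     (\<forall>w :: ('i \<times> complex poly) list.
        w \<noteq> [] \<longrightarrow> successively (\<noteq>) (map fst w) \<longrightarrow>
        (\<forall>(i, p) \<in> set w. i \<in> I \<and> \<phi> (poly_op p (X i)) = 0) \<longrightarrow>
        \<phi> (prod_list (map (\<lambda>(i, p). poly_op p (X i)) w)) = 0)"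


section \<open>Free cumulants\<close>

definition noncrossing :: "nat set set \<Rightarrow> bool" where
  "noncrossing P \<longleftrightarrow>
     (\<forall>B\<in>P. \<forall>C\<in>P. \<forall>a\<in>B. \<forall>b\<in>C. \<forall>c\<in>B. \<forall>d\<in>C. a < b \<longrightarrow> b < c \<longrightarrow> c < d \<longrightarrow> B = C)"

definition NC :: "nat \<Rightarrow> nat set set set" where
  "NC n = {P. partition_on {1..n} P \<and> noncrossing P}"

text \<open>The value at \<open>0\<close> is a convention that makes the sequence unique.\<close>

definition free_cumulant ::
    "('h::complex_hilbert_space operator \<Rightarrow> complex) \<Rightarrow> 'h operator \<Rightarrow> nat \<Rightarrow> complex" where
  "free_cumulant \<phi> F = (THE \<kappa>. \<kappa> 0 = 0 \<and>
     (\<forall>n\<ge>1. \<phi> (F ^ n) = (\<Sum>P\<in>NC n. \<Prod>B\<in>P. \<kappa> (card B))))"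

lemma finite_NC: "finite (NC n)"
proof (rule finite_subset)
  show "NC n \<subseteq> Pow (Pow {1..n})" by (auto simp: NC_def partition_on_def)
qed simp

lemma whole_in_NC: "1 \<le> n \<Longrightarrow> {{1..n}} \<in> NC n"
  by (auto simp: NC_def noncrossing_def partition_on_def disjoint_def)

lemma NC_card_less:
  assumes "P \<in> NC n - {{{1..n}}}" "B \<in> P"
  shows "card B < n"
proof -
  have P: "partition_on {1..n} P" using assms by (simp add: NC_def)
  have sub: "B \<subseteq> {1..n}" using P assms(2) by (auto simp: partition_on_def)
  have "B \<noteq> {1..n}"
  proof
    assume "B = {1..n}"
    have "C = B" if "C \<in> P" for C
      using P that assms(2) \<open>B = {1..n}\<close> unfolding partition_on_def disjoint_def
      by (metis Int_absorb2 Sup_upper Int_commute)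
    hence "P = {{1..n}}" using assms(2) \<open>B = {1..n}\<close> by blast
    thus False using assms(1) by simp
  qed
  thus ?thesis using sub psubset_card_mono[of "{1..n}" B] by auto
qed

lemma moment_cumulant_split:
  assumes "1 \<le> n"
  shows "(\<Sum>P\<in>NC n. \<Prod>B\<in>P. \<kappa> (card B)) =
    \<kappa> n + (\<Sum>P\<in>NC n - {{{1..n}}}. \<Prod>B\<in>P. (\<kappa> (card B) :: complex))"
  using sum.remove[OF finite_NC whole_in_NC[OF assms], of "\<lambda>P. \<Prod>B\<in>P. \<kappa> (card B)"] by simp

context
  fixes m :: "nat \<Rightarrow> complex"
begin

private function cumulant_of :: "nat \<Rightarrow> complex" where
  "cumulant_of n = (if n = 0 then 0 else
     m n - (\<Sum>P\<in>NC n - {{{1..n}}}. \<Prod>B\<in>P. if card B < n then cumulant_of (card B) else 0))"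
  by pat_completeness auto
termination by (relation "Wellfounded.measure id") auto

lemma ex1_free_cumulants:
  "\<exists>!\<kappa>. \<kappa> 0 = 0 \<and> (\<forall>n\<ge>1. m n = (\<Sum>P\<in>NC n. \<Prod>B\<in>P. (\<kappa> (card B) :: complex)))"
proof (rule ex1I[of _ cumulant_of])
  show "cumulant_of 0 = 0 \<and> (\<forall>n\<ge>1. m n = (\<Sum>P\<in>NC n. \<Prod>B\<in>P. cumulant_of (card B)))"
  proof (intro conjI allI impI)
    show "cumulant_of 0 = 0" by simp
    fix n :: nat assume n: "1 \<le> n"
    have "(\<Sum>P\<in>NC n - {{{1..n}}}. \<Prod>B\<in>P. if card B < n then cumulant_of (card B) else 0)
        = (\<Sum>P\<in>NC n - {{{1..n}}}. \<Prod>B\<in>P. cumulant_of (card B))"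
      using NC_card_less by (intro sum.cong prod.cong refl) (simp del: cumulant_of.simps)
    thus "m n = (\<Sum>P\<in>NC n. \<Prod>B\<in>P. cumulant_of (card B))"
      using n by (subst moment_cumulant_split[OF n], subst cumulant_of.simps)
        (simp del: cumulant_of.simps)
  qed
next
  fix \<kappa> :: "nat \<Rightarrow> complex"
  assume \<kappa>: "\<kappa> 0 = 0 \<and> (\<forall>n\<ge>1. m n = (\<Sum>P\<in>NC n. \<Prod>B\<in>P. \<kappa> (card B)))"
  have "\<kappa> n = cumulant_of n" for n
  proof (induction n rule: less_induct)
    case (less n)
    show ?case
    proof (cases "n = 0")
      case True thus ?thesis using \<kappa> by simp
    next
      case False
      hence n: "1 \<le> n" by simp
      have "(\<Sum>P\<in>NC n - {{{1..n}}}. \<Prod>B\<in>P. if card B < n then cumulant_of (card B) else 0)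
        = (\<Sum>P\<in>NC n - {{{1..n}}}. \<Prod>B\<in>P. \<kappa> (card B))"
        using NC_card_less less
        by (intro sum.cong prod.cong refl) (simp del: cumulant_of.simps)
      moreover have "m n = \<kappa> n + (\<Sum>P\<in>NC n - {{{1..n}}}. \<Prod>B\<in>P. \<kappa> (card B))"
        using \<kappa> n moment_cumulant_split[OF n, of \<kappa>] by simp
      ultimately show ?thesis
        using n by (subst cumulant_of.simps) (simp del: cumulant_of.simps)
    qed
  qed
  thus "\<kappa> = cumulant_of" by blast
qed

end

lemma free_cumulant_0: "free_cumulant \<phi> F 0 = 0"
  and moment_cumulant: "1 \<le> n \<Longrightarrow> \<phi> (F ^ n) = (\<Sum>P\<in>NC n. \<Prod>B\<in>P. free_cumulant \<phi> F (card B))"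
  using theI'[OF ex1_free_cumulants[of "\<lambda>n. \<phi> (F ^ n)"]] unfolding free_cumulant_def by blast+


section \<open>Free Brownian motion and the second Wigner chaos\<close>

definition free_brownian_motion ::
    "'h::complex_hilbert_space operator set \<Rightarrow> ('h operator \<Rightarrow> complex) \<Rightarrow>
      (real \<Rightarrow> 'h operator) \<Rightarrow> bool" where
  "free_brownian_motion A \<phi> S \<longleftrightarrow>
     (\<forall>t\<ge>0. S t \<in> A \<and> selfadjoint (S t)) \<and> S 0 = 0 \<and>
     (\<forall>s t. 0 \<le> s \<and> s < t \<longrightarrow> has_law \<phi> (S t - S s) (semicircle (t - s))) \<and>
     (\<forall>(n::nat) t. 0 \<le> t 0 \<and> (\<forall>k<n. t k < t (Suc k)) \<longrightarrow>
        freely_independent \<phi> {..<n} (\<lambda>k. S (t (Suc k)) - S (t k)))"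

text \<open>
  A list of entries \<open>(c, (a, b), (u, v))\<close> encodes the function
  \<open>\<Sum> c \<cdot> indicator ({a<..b} \<times> {u<..v})\<close>; it is admissible if every \<open>{a<..b}\<close> is disjoint from
  the corresponding \<open>{u<..v}\<close>, so that the function vanishes on the diagonal.
\<close>

type_synonym step = "(real \<times> (real \<times> real) \<times> (real \<times> real)) list"

definition off_diagonal :: "step \<Rightarrow> bool" where
  "off_diagonal L \<longleftrightarrow>
     (\<forall>(c, (a, b), (u, v)) \<in> set L. 0 \<le> a \<and> a < b \<and> 0 \<le> u \<and> u < v \<and> {a<..b} \<inter> {u<..v} = {})"

definition step_fun :: "step \<Rightarrow> real \<times> real \<Rightarrow> real" where
  "step_fun L z = (\<Sum>(c, (a, b), (u, v))\<leftarrow>L. c * indicator ({a<..b} \<times> {u<..v}) z)"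

definition step_integral ::
    "(real \<Rightarrow> 'h::complex_hilbert_space operator) \<Rightarrow> step \<Rightarrow> 'h operator" where
  "step_integral S L = (\<Sum>(c, (a, b), (u, v))\<leftarrow>L. c *\<^sub>R ((S b - S a) * (S v - S u)))"

abbreviation quadrant :: "(real \<times> real) set" where
  "quadrant \<equiv> {0..} \<times> {0..}"

definition symmetric_L2 :: "(real \<times> real \<Rightarrow> real) \<Rightarrow> bool" where
  "symmetric_L2 f \<longleftrightarrow>
     set_borel_measurable lborel quadrant f \<and> set_integrable lborel quadrant (\<lambda>z. (f z)\<^sup>2) \<and>
     (AE z in lborel. z \<in> quadrant \<longrightarrow> f (prod.swap z) = f z)"

text \<open>
  The \<open>L\<^sup>2\<close>-extension of the integral of step functions: \<open>F = I\<^sub>2(f)\<close> if the integrals of some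
  off-diagonal step functions converging to \<open>f\<close> in \<open>L\<^sup>2(\<real>\<^sub>+\<^sup>2)\<close> converge to \<open>F\<close> in \<open>L\<^sup>2(A, \<phi>)\<close>.
  By the isometry property the choice of the sequence does not matter. Requiring \<open>F \<in> A\<close> is no
  restriction, since Wigner integrals are bounded operators.
\<close>

definition is_wigner_double_integral ::
    "'h::complex_hilbert_space operator set \<Rightarrow> ('h operator \<Rightarrow> complex) \<Rightarrow> (real \<Rightarrow> 'h operator) \<Rightarrow>
      (real \<times> real \<Rightarrow> real) \<Rightarrow> 'h operator \<Rightarrow> bool" where
  "is_wigner_double_integral A \<phi> S f F \<longleftrightarrow> F \<in> A \<and>
     (\<exists>L :: nat \<Rightarrow> step. (\<forall>n. off_diagonal (L n)) \<and>
        (\<lambda>n. LINT z:quadrant|lborel. (step_fun (L n) z - f z)\<^sup>2) \<longlonglongrightarrow> 0 \<and>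
        (\<lambda>n. \<phi> (adj (step_integral S (L n) - F) * (step_integral S (L n) - F))) \<longlonglongrightarrow> 0)"

definition second_wigner_chaos ::
    "'h::complex_hilbert_space operator set \<Rightarrow> ('h operator \<Rightarrow> complex) \<Rightarrow> (real \<Rightarrow> 'h operator) \<Rightarrow>
      'h operator set" where
  "second_wigner_chaos A \<phi> S = {F. \<exists>f. symmetric_L2 f \<and> is_wigner_double_integral A \<phi> S f F}"

end

theory Submission
  imports Defs "Jordan_Normal_Form.Schur_Decomposition"
begin

text \<open>
  The element \<open>F\<close> is an \<open>L\<^sup>2\<close>-limit of self-adjoint quadratic forms \<open>Y = \<Sum> M\<^sub>i\<^sub>j s\<^sub>i s\<^sub>j\<close> in free
  semicircular elements. Reading the moments of \<open>Y\<close> as paths in the full Fock space gives the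
  recursion satisfied by sums over non-crossing partitions, so the \<open>k\<close>-th free cumulant of \<open>Y\<close> is
  the trace of \<open>M\<^sup>k\<close>, that is, the power sum \<open>\<Sum> x\<^sub>i\<^sup>k\<close> of the eigenvalues of \<open>M\<close>. Since these
  power sums are controlled by the second one, all moments and cumulants pass to the limit, where
  symmetry makes the odd cumulants vanish. If \<open>\<Sum> x\<^sub>i\<^sup>3 = 0\<close>, no \<open>x\<^sub>i\<^sup>2\<close> exceeds half of \<open>\<Sum> x\<^sub>j\<^sup>2 \<le> 1\<close>,
  hence each even power sum is at most half of the preceding one; this is the bound \<open>2 / 2\<^sup>r\<close>
  given by the tetilla law. In the case of equality, \<open>\<Sum> x\<^sub>i\<^sup>2\<^sup>k (x\<^sub>i\<^sup>2 - 1 / 2)\<^sup>2 \<ge> 0\<close> forces equality of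
  all cumulants.
\<close>

section \<open>Operators and tracial states\<close>

text \<open>The constant 1 / 2 is the common square of the two eigenvalues 1 / sqrt 2 and - 1 / sqrt
  2 behind the tetilla law. If the cubes of the \<open>x i\<close> cancel, each absolute cube is at
  most the sum of the other absolute cubes, hence at most the power 3 / 2 of the sum of the other
  squares. So no square exceeds the sum of all the others, which is half of the total. Two obstacles
  shape the argument. \<open>F\<close> itself is never diagonalized: eigenvalues exist only for the
  approximating matrices, whose cubes cancel only in the limit, so the inequality holds eventually
  and up to an error. Moreover, the approximation is known only in the trace norm of order two,
  without a uniform bound on operator norms. Convergence of the second moment bounds the second
  power sum, this bounds all cumulants and hence all moments, and only then do the higher moments
  converge. Finally, the step functions are not assumed to be symmetric; self-adjoint approximants
  are the real parts of their integrals.\<close>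

lemma cinner_add_right: "cinner x (y + z) = cinner x y + cinner x (z :: 'a::complex_hilbert_space)"
  by (metis cinner_add_left cinner_commute complex_cnj_add)

lemma cinner_scaleC_right: "cinner x (c *\<^sub>C y) = cnj c * cinner x (y :: 'a::complex_hilbert_space)"
  by (metis cinner_scaleC_left cinner_commute complex_cnj_mult)

lemma is_adjoint_sym: "is_adjoint S T \<Longrightarrow> is_adjoint T S"
  unfolding is_adjoint_def by (metis cinner_commute)

lemma is_adjoint_add: "is_adjoint S S' \<Longrightarrow> is_adjoint T T' \<Longrightarrow> is_adjoint (S + T) (S' + T')"
  by (simp add: is_adjoint_def cinner_add_left cinner_add_right)

lemma is_adjoint_scaleC: "is_adjoint S S' \<Longrightarrow> is_adjoint (c *\<^sub>C S) (cnj c *\<^sub>C S')"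
  by (simp add: is_adjoint_def cinner_scaleC_left cinner_scaleC_right)

lemma is_adjoint_mult: "is_adjoint S S' \<Longrightarrow> is_adjoint T T' \<Longrightarrow> is_adjoint (S * T) (T' * S')"
  by (simp add: is_adjoint_def)

lemma is_adjoint_0: "is_adjoint 0 0"
  using is_adjoint_scaleC[of _ _ 0]
  by (metis add.right_neutral cinner_add_left cinner_add_right cancel_comm_monoid_add_class.add_cancel_right_right is_adjoint_def op_apply_simps(1))

lemma is_adjoint_1: "is_adjoint 1 1"
  by (simp add: is_adjoint_def)

lemma scaleR_conv_scaleC: "r *\<^sub>R T = complex_of_real r *\<^sub>C T"
  by (simp add: scaleC_of_real)

lemma uminus_conv_scaleC: "- T = (- 1 :: complex) *\<^sub>C (T :: 'a::complex_vector)"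
  by (metis of_real_1 of_real_minus scaleC_of_real scaleR_minus1_left)

lemma scaleC_1 [simp]: "(1 :: complex) *\<^sub>C (T :: 'a::complex_vector) = T"
  by (metis of_real_1 scaleC_of_real scaleR_one)

lemma scaleC_0 [simp]: "(0 :: complex) *\<^sub>C (T :: 'a::complex_vector) = 0"
  by (metis of_real_0 scaleC_of_real scaleR_zero_left)

lemma scaleC_mult_left [simp]: "(c *\<^sub>C S) * T = c *\<^sub>C (S * (T :: 'h::complex_hilbert_space operator))"
  by (rule operator_eqI) simp

lemma op_apply_scaleC: "op_apply T (c *\<^sub>C x) = c *\<^sub>C op_apply T x"
  by transfer simp

lemma scaleC_mult_right [simp]: "S * (c *\<^sub>C T) = c *\<^sub>C (S * (T :: 'h::complex_hilbert_space operator))"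
  by (rule operator_eqI) (simp add: op_apply_scaleC)

lemma scaleC_zero_right [simp]: "c *\<^sub>C (0 :: 'a::complex_vector) = 0"
  by (metis add_cancel_right_right scaleC_add_right)

lemma scaleC_power: "(c *\<^sub>C T) ^ n = c ^ n *\<^sub>C ((T :: 'h::complex_hilbert_space operator) ^ n)"
  by (induction n) (simp_all add: scaleC_scaleC mult.commute)

lemma is_adjoint_uminus: "is_adjoint S S' \<Longrightarrow> is_adjoint (- S) (- S')"
  using is_adjoint_scaleC[of S S' "- 1"] by (simp add: uminus_conv_scaleC)

lemma is_adjoint_diff: "is_adjoint S S' \<Longrightarrow> is_adjoint T T' \<Longrightarrow> is_adjoint (S - T) (S' - T')"
  using is_adjoint_add[OF _ is_adjoint_uminus] by (metis diff_conv_add_uminus)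

lemma is_adjoint_sum: "(\<And>i. i \<in> I \<Longrightarrow> is_adjoint (f i) (g i)) \<Longrightarrow> is_adjoint (\<Sum>i\<in>I. f i) (\<Sum>i\<in>I. g i)"
  by (induction I rule: infinite_finite_induct) (simp_all add: is_adjoint_0 is_adjoint_add)

lemma is_adjoint_power: "is_adjoint S S' \<Longrightarrow> is_adjoint (S ^ n) (S' ^ n)"
proof (induction n)
  case (Suc n)
  thus ?case using is_adjoint_mult[of S S' "S ^ n" "S' ^ n"] by (simp add: power_Suc2 del: power_Suc)
      (simp add: power_commutes)
qed (simp add: is_adjoint_1)

locale tracial_state =
  fixes A :: "'h::complex_hilbert_space operator set" and \<phi> :: "'h operator \<Rightarrow> complex"
  assumes free_probability_space: "free_probability_space A \<phi>"
begin

lemma one_in [simp, intro]: "1 \<in> A"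
  and add_in [simp, intro]: "S \<in> A \<Longrightarrow> T \<in> A \<Longrightarrow> S + T \<in> A"
  and mult_in [simp, intro]: "S \<in> A \<Longrightarrow> T \<in> A \<Longrightarrow> S * T \<in> A"
  and scaleC_in [simp, intro]: "T \<in> A \<Longrightarrow> c *\<^sub>C T \<in> A"
  and ex_adjoint: "T \<in> A \<Longrightarrow> \<exists>T'\<in>A. is_adjoint T T'"
  and trace_add [simp]: "S \<in> A \<Longrightarrow> T \<in> A \<Longrightarrow> \<phi> (S + T) = \<phi> S + \<phi> T"
  and trace_scaleC [simp]: "T \<in> A \<Longrightarrow> \<phi> (c *\<^sub>C T) = c * \<phi> T"
  and trace_1 [simp]: "\<phi> 1 = 1"
  and trace_pos: "T \<in> A \<Longrightarrow> \<phi> (adj T * T) \<in> \<real>\<^sub>\<ge>\<^sub>0"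
  and trace_commute: "S \<in> A \<Longrightarrow> T \<in> A \<Longrightarrow> \<phi> (S * T) = \<phi> (T * S)"
  using free_probability_space
  unfolding free_probability_space_def von_neumann_algebra_def by simp_all

lemma adjoint_in: "T \<in> A \<Longrightarrow> is_adjoint T T' \<Longrightarrow> T' \<in> A"
  using ex_adjoint is_adjoint_unique by blast

lemma zero_in [simp, intro]: "0 \<in> A"
  using scaleC_in[OF one_in, of 0] by simp

lemma trace_0 [simp]: "\<phi> 0 = 0"
  using trace_scaleC[OF one_in, of 0] by simp

lemma uminus_in [simp, intro]: "T \<in> A \<Longrightarrow> - T \<in> A"
  by (subst uminus_conv_scaleC) auto

lemma diff_in [simp, intro]: "S \<in> A \<Longrightarrow> T \<in> A \<Longrightarrow> S - T \<in> A"
  using add_in[of S "- T"] by simp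

lemma scaleR_in [simp, intro]: "T \<in> A \<Longrightarrow> r *\<^sub>R T \<in> A"
  by (simp add: scaleR_conv_scaleC)

lemma power_in [simp, intro]: "T \<in> A \<Longrightarrow> T ^ n \<in> A"
  by (induction n) auto

lemma sum_in [simp, intro]: "(\<And>i. i \<in> I \<Longrightarrow> f i \<in> A) \<Longrightarrow> (\<Sum>i\<in>I. f i) \<in> A"
  by (induction I rule: infinite_finite_induct) auto

lemma trace_sum: "(\<And>i. i \<in> I \<Longrightarrow> f i \<in> A) \<Longrightarrow> \<phi> (\<Sum>i\<in>I. f i) = (\<Sum>i\<in>I. \<phi> (f i))"
  by (induction I rule: infinite_finite_induct) auto

lemma trace_uminus [simp]: "T \<in> A \<Longrightarrow> \<phi> (- T) = - \<phi> T"
  by (subst uminus_conv_scaleC) simp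

lemma trace_diff [simp]: "S \<in> A \<Longrightarrow> T \<in> A \<Longrightarrow> \<phi> (S - T) = \<phi> S - \<phi> T"
  using trace_add[of S "- T"] by simp

lemma trace_scaleR [simp]: "T \<in> A \<Longrightarrow> \<phi> (r *\<^sub>R T) = of_real r * \<phi> T"
  by (simp add: scaleR_conv_scaleC)

lemma trace_adjoint_nonneg: "T \<in> A \<Longrightarrow> is_adjoint T T' \<Longrightarrow> 0 \<le> Re (\<phi> (T' * T)) \<and> Im (\<phi> (T' * T)) = 0"
  using trace_pos[of T] adj_eq[of T T'] complex_nonneg_Reals_iff by auto

text \<open>Positivity of the trace at \<open>P + c *\<^sub>C Q\<close> for all scalars
  \<open>c\<close> makes a real quadratic polynomial nonnegative.\<close>

lemma Cauchy_Schwarz: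
  assumes P: "P \<in> A" "is_adjoint P P'" and Q: "Q \<in> A" "is_adjoint Q Q'"
  shows "(cmod (\<phi> (P' * Q)))\<^sup>2 \<le> Re (\<phi> (P' * P)) * Re (\<phi> (Q' * Q))"
proof -
  define p q z w where "p = Re (\<phi> (P' * P))" and "q = Re (\<phi> (Q' * Q))"
    and "z = \<phi> (P' * Q)" and "w = \<phi> (Q' * P)"
  have in': "P' \<in> A" "Q' \<in> A" using adjoint_in P Q by auto
  have pq: "\<phi> (P' * P) = p" "\<phi> (Q' * Q) = q"
    using trace_adjoint_nonneg[OF P] trace_adjoint_nonneg[OF Q]
    by (auto simp: p_def q_def complex_eq_iff)
  have q0: "0 \<le> q" "0 \<le> p"
    using trace_adjoint_nonneg[OF Q] trace_adjoint_nonneg[OF P] by (auto simp: q_def p_def)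
  have ex: "\<phi> ((P' + cnj c *\<^sub>C Q') * (P + c *\<^sub>C Q)) = p + c * z + cnj c * w + (cmod c)\<^sup>2 * q" for c
  proof -
    have "(P' + cnj c *\<^sub>C Q') * (P + c *\<^sub>C Q) =
      P' * P + c *\<^sub>C (P' * Q) + cnj c *\<^sub>C (Q' * P) + (c * cnj c) *\<^sub>C (Q' * Q)"
      by (simp add: algebra_simps scaleC_scaleC scaleC_add_right)
    moreover have "c * cnj c = of_real ((cmod c)\<^sup>2)"
      by (simp only: complex_norm_square)
    ultimately show ?thesis using in' P Q by (simp add: pq z_def w_def)
  qed
  have pos: "0 \<le> Re (p + c * z + cnj c * w + (cmod c)\<^sup>2 * q) \<and>
      Im (p + c * z + cnj c * w + (cmod c)\<^sup>2 * q) = 0" for c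
    using trace_adjoint_nonneg[OF _ is_adjoint_add[OF P(2) is_adjoint_scaleC[OF Q(2), of c]]] P Q ex[of c]
    by auto
  \<comment> \<open>The imaginary parts vanish for \<open>c = 1\<close> and \<open>c = \<i>\<close>,
    which gives the imaginary and the real part of this identity.\<close>
  have w: "w = cnj z" using pos[of 1] pos[of \<i>] by (simp add: complex_eq_iff)
  have t: "0 \<le> p - 2 * t * (cmod z)\<^sup>2 + t\<^sup>2 * (cmod z)\<^sup>2 * q" for t
  proof -
    \<comment> \<open>This direction makes both cross terms real and equal.\<close>
    let ?c = "- of_real t * cnj z"
    have "?c * z + cnj ?c * w = of_real (- 2 * t * (cmod z)\<^sup>2)"
      unfolding w of_real_mult complex_norm_square by (simp add: algebra_simps)
    moreover have "(cmod ?c)\<^sup>2 = t\<^sup>2 * (cmod z)\<^sup>2"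
      by (simp add: norm_mult power_mult_distrib)
    ultimately have "complex_of_real p + ?c * z + cnj ?c * w + (cmod ?c)\<^sup>2 * q =
      of_real (p - 2 * t * (cmod z)\<^sup>2 + t\<^sup>2 * (cmod z)\<^sup>2 * q)"
      by (metis (no_types, lifting) add.assoc diff_conv_add_uminus mult_minus_left of_real_add of_real_mult)
    thus ?thesis using pos[of ?c] by (metis Re_complex_of_real)
  qed
  \<comment> \<open>For \<open>q = 0\<close> the polynomial is affine in \<open>t\<close>, and the
    chosen point would give the value - p - 2. Otherwise \<open>t = 1 / q\<close> is its
    minimum.\<close>
  have "(cmod z)\<^sup>2 \<le> p * q"
  proof (cases "q = 0")
    case True
    have "(cmod z)\<^sup>2 = 0"
    proof (rule ccontr)
      assume "(cmod z)\<^sup>2 \<noteq> 0"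
      thus False using t[of "(p + 1) / (cmod z)\<^sup>2"] True q0 by simp
    qed
    thus ?thesis using True by simp
  next
    case False
    hence "q > 0" using q0 by simp
    thus ?thesis using t[of "1 / q"] by (simp add: field_simps power2_eq_square)
  qed
  thus ?thesis by (simp add: z_def p_def q_def)
qed

end

section \<open>Sums over non-crossing partitions\<close>

definition nc_partitions :: "nat set \<Rightarrow> nat set set set" where
  "nc_partitions A = {P. partition_on A P \<and> noncrossing P}"

definition restrict_partition :: "nat set set \<Rightarrow> nat set \<Rightarrow> nat set set" where
  "restrict_partition P C = (\<lambda>B. B \<inter> C) ` P - {{}}"

text \<open>A union instead of a choice, so that the value is the empty set when no block contains
  \<open>p\<close>.\<close>

definition block_of :: "nat \<Rightarrow> nat set set \<Rightarrow> nat set" where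
  "block_of p P = \<Union>{B \<in> P. p \<in> B}"

text \<open>For \<open>p = 0\<close> the block \<open>block_of p P1\<close> is empty, so that \<open>{n}\<close> becomes a block of its own.\<close>

definition join_at :: "nat \<Rightarrow> nat \<Rightarrow> nat set set \<Rightarrow> nat set set \<Rightarrow> nat set set" where
  "join_at n p P1 P2 = insert (insert n (block_of p P1)) ((P1 - {block_of p P1}) \<union> P2)"

lemma NC_eq: "NC n = nc_partitions {1..n}"
  by (simp add: NC_def nc_partitions_def)

lemma noncrossingD:
  "noncrossing P \<Longrightarrow> B \<in> P \<Longrightarrow> C \<in> P \<Longrightarrow> a \<in> B \<Longrightarrow> c \<in> B \<Longrightarrow> b \<in> C \<Longrightarrow> d \<in> C \<Longrightarrow>
    a < b \<Longrightarrow> b < c \<Longrightarrow> c < d \<Longrightarrow> B = C"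
  unfolding noncrossing_def by blast

lemma partition_block_unique:
  "partition_on A P \<Longrightarrow> B \<in> P \<Longrightarrow> C \<in> P \<Longrightarrow> x \<in> B \<Longrightarrow> x \<in> C \<Longrightarrow> B = C"
  unfolding partition_on_def disjoint_def by blast

lemma block_of_eq: "partition_on A P \<Longrightarrow> B \<in> P \<Longrightarrow> p \<in> B \<Longrightarrow> block_of p P = B"
proof -
  assume "partition_on A P" "B \<in> P" "p \<in> B"
  hence "{B \<in> P. p \<in> B} = {B}" using partition_block_unique[of A P] by auto
  thus ?thesis by (simp add: block_of_def)
qed

lemma block_of_notin: "partition_on A P \<Longrightarrow> p \<notin> A \<Longrightarrow> block_of p P = {}"
  unfolding block_of_def partition_on_def by blast

lemma block_of_in: "partition_on A P \<Longrightarrow> p \<in> A \<Longrightarrow> block_of p P \<in> P \<and> p \<in> block_of p P"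
proof -
  assume *: "partition_on A P" "p \<in> A"
  then obtain B where "B \<in> P" "p \<in> B" unfolding partition_on_def by auto
  thus ?thesis using block_of_eq[OF *(1)] by simp
qed

lemma restrict_nc_partition:
  assumes "P \<in> nc_partitions A" "C \<subseteq> A"
  shows "restrict_partition P C \<in> nc_partitions C"
proof -
  have "partition_on C (restrict_partition P C)"
  proof -
    have "(\<lambda>B. B \<inter> C) ` P = (\<inter>) C ` P" by (intro image_cong) auto
    thus ?thesis
      using partition_on_restrict[of A P C] assms
      by (simp add: nc_partitions_def restrict_partition_def Int_absorb2)
  qed
  moreover have "noncrossing (restrict_partition P C)"
    unfolding noncrossing_def
  proof (intro ballI impI)
    fix X Y a b c d
    assume "X \<in> restrict_partition P C" "Y \<in> restrict_partition P C"
      and el: "a \<in> X" "b \<in> Y" "c \<in> X" "d \<in> Y" "a < b" "b < c" "c < d"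
    then obtain B B' where B: "B \<in> P" "B' \<in> P" "X = B \<inter> C" "Y = B' \<inter> C"
      unfolding restrict_partition_def by blast
    have "noncrossing P" using assms(1) by (simp add: nc_partitions_def)
    from noncrossingD[OF this B(1,2), of a c b d] have "B = B'" using el B by blast
    thus "X = Y" using B by simp
  qed
  ultimately show ?thesis by (simp add: nc_partitions_def)
qed

text \<open>The point \<open>p\<close> is the last one of the left part. A crossing that involves
  the new point \<open>n\<close> is therefore already a crossing with \<open>p\<close> in place of
  \<open>n\<close>, and the blocks of \<open>P2\<close> lie in the gap between \<open>p\<close> and
  \<open>n\<close>.\<close>

lemma join_at_nc:
  assumes p: "p < n" and P1: "P1 \<in> nc_partitions {1..p}" and P2: "P2 \<in> nc_partitions {p<..<n}"
  shows "join_at n p P1 P2 \<in> nc_partitions {1..n}"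
proof -
  let ?C = "block_of p P1"
  have pa1: "partition_on {1..p} P1" and pa2: "partition_on {p<..<n} P2"
    and nc1: "noncrossing P1" and nc2: "noncrossing P2"
    using P1 P2 by (auto simp: nc_partitions_def)
  have C: "?C = {} \<and> p = 0 \<or> ?C \<in> P1 \<and> p \<in> ?C \<and> ?C \<subseteq> {1..p}"
    using block_of_in[OF pa1, of p] block_of_notin[OF pa1, of p] pa1
    by (cases "p = 0") (auto simp: partition_on_def)
  have s1: "B \<subseteq> {1..p}" if "B \<in> P1" for B using that pa1 by (auto simp: partition_on_def)
  have s2: "B \<subseteq> {p<..<n}" if "B \<in> P2" for B using that pa2 by (auto simp: partition_on_def)
  have U: "\<Union>(join_at n p P1 P2) = insert n (\<Union>P1 \<union> \<Union>P2)"
    using C unfolding join_at_def by auto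
  have "partition_on {1..n} (join_at n p P1 P2)"
    unfolding partition_on_def U
  proof (intro conjI)
    show "insert n (\<Union>P1 \<union> \<Union>P2) = {1..n}"
      using pa1 pa2 p by (auto simp: partition_on_def)
    have X: "B \<inter> insert n ?C = {}" if "B \<in> P1 - {?C} \<union> P2" for B
    proof -
      have "B \<subseteq> {1..p} \<or> B \<subseteq> {p<..<n}" using that s1 s2 by blast
      hence "n \<notin> B" using p by auto
      moreover have "B \<inter> ?C = {}"
        using that C s2[of B] partition_block_unique[OF pa1, of B ?C] by force
      ultimately show ?thesis by auto
    qed
    have Q: "B \<inter> B' = {}" if h: "B \<in> P1 - {?C} \<union> P2" "B' \<in> P1 - {?C} \<union> P2" "B \<noteq> B'" for B B'
    proof -
      consider "B \<in> P1" "B' \<in> P1" | "B \<in> P2" "B' \<in> P2" |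
        "B \<subseteq> {1..p}" "B' \<subseteq> {p<..<n}" | "B \<subseteq> {p<..<n}" "B' \<subseteq> {1..p}"
        using h s1 s2 by blast
      then show ?thesis
        by cases (use partition_block_unique[OF pa1] partition_block_unique[OF pa2] h(3) in
            \<open>fastforce+\<close>)
    qed
    show "disjoint (join_at n p P1 P2)"
      unfolding disjoint_def
    proof (intro ballI impI)
      fix B B' assume "B \<in> join_at n p P1 P2" "B' \<in> join_at n p P1 P2" and ne: "B \<noteq> B'"
      then consider "B = insert n ?C" "B' \<in> P1 - {?C} \<union> P2" | "B \<in> P1 - {?C} \<union> P2" "B' = insert n ?C"
        | "B \<in> P1 - {?C} \<union> P2" "B' \<in> P1 - {?C} \<union> P2"
        unfolding join_at_def by blast
      then show "B \<inter> B' = {}"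
      proof cases
        case 1 thus ?thesis using X[of B'] by (metis Int_commute)
      next
        case 2 thus ?thesis using X[of B] by metis
      next
        case 3 thus ?thesis using Q ne by metis
      qed
    qed
    show "{} \<notin> join_at n p P1 P2"
      using pa1 pa2 by (auto simp: join_at_def partition_on_def)
  qed
  moreover have "noncrossing (join_at n p P1 P2)"
    unfolding noncrossing_def
  proof (intro ballI impI)
    fix B B' a b c d
    assume B: "B \<in> join_at n p P1 P2" and B': "B' \<in> join_at n p P1 P2"
      and el: "a \<in> B" "b \<in> B'" "c \<in> B" "d \<in> B'" and lt: "a < b" "b < c" "c < d"
    have "B = insert n ?C \<or> B \<in> P1 \<and> B \<noteq> ?C \<or> B \<in> P2"
      "B' = insert n ?C \<or> B' \<in> P1 \<and> B' \<noteq> ?C \<or> B' \<in> P2"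
      using B B' by (simp_all add: join_at_def)
    then consider "B = insert n ?C" "B' = insert n ?C" | "B = insert n ?C" "B' \<in> P1" "B' \<noteq> ?C"
      | "B = insert n ?C" "B' \<in> P2" | "B' = insert n ?C" "B \<in> P1" "B \<noteq> ?C"
      | "B' = insert n ?C" "B \<in> P2" | "B \<in> P1" "B' \<in> P1" | "B \<in> P1" "B' \<in> P2"
      | "B \<in> P2" "B' \<in> P1" | "B \<in> P2" "B' \<in> P2"
      by satx
    then show "B = B'"
    proof cases
      case 1 then show ?thesis by simp
    next
      case 2
      hence "d \<le> p" using s1[of B'] el by auto
      hence "a \<in> ?C" "c \<in> ?C" using el lt p 2 by auto
      hence "?C = B'" using noncrossingD[OF nc1, of ?C B' a c b d] C 2 el lt by auto
      then show ?thesis using 2 by auto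
    next
      case 3
      hence "p < b" "d < n" using s2[of B'] el by auto
      hence "c \<in> ?C" "p < c" using 3 el lt by auto
      then show ?thesis using C by auto
    next
      \<comment> \<open>Here \<open>d\<close> may be \<open>n\<close>, a point unknown to
        \<open>P1\<close>; the point \<open>p\<close> of the same block takes its place.\<close>
      case 4
      hence c: "c \<le> p" using s1[of B] el by auto
      hence b: "b \<in> ?C" using el lt p 4 by auto
      hence C': "?C \<in> P1" "p \<in> ?C" using C by auto
      have "c \<noteq> p" using partition_block_unique[OF pa1 C'(1) 4(2), of p] C' 4 el by auto
      hence "c < p" using c by simp
      hence "B = ?C" using noncrossingD[OF nc1, of B ?C a c b p] C' b el lt 4 by auto
      then show ?thesis using 4 by simp
    next
      case 5
      hence "p < a" "c < n" using s2[of B] el by auto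
      hence "b \<in> ?C" "p < b" using 5 el lt by auto
      then show ?thesis using C by auto
    next
      case 6 then show ?thesis using noncrossingD[OF nc1] el lt by blast
    next
      case 7
      hence "c \<le> p" "p < b" using s1[of B] s2[of B'] el by auto
      then show ?thesis using lt by simp
    next
      case 8
      hence "b \<le> p" "p < a" using s1[of B'] s2[of B] el by auto
      then show ?thesis using lt by simp
    next
      case 9 then show ?thesis using noncrossingD[OF nc2] el lt by blast
    qed
  qed
  ultimately show ?thesis by (simp add: nc_partitions_def)
qed

lemma block_of_join_at:
  assumes p: "p < n" and P1: "P1 \<in> nc_partitions {1..p}" and P2: "P2 \<in> nc_partitions {p<..<n}"
  shows "block_of n (join_at n p P1 P2) = insert n (block_of p P1)"
  using join_at_nc[OF assms]
  by (intro block_of_eq[where A = "{1..n}"]) (auto simp: nc_partitions_def join_at_def)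

text \<open>Half of a bijection: \<open>p\<close>, \<open>P1\<close> and \<open>P2\<close> can be
  read off from the joined partition. The \<open>0\<close> inserted under \<open>Max\<close> is the
  value for a last block consisting of \<open>n\<close> alone.\<close>

lemma restrict_join_at:
  assumes p: "p < n" and P1: "P1 \<in> nc_partitions {1..p}" and P2: "P2 \<in> nc_partitions {p<..<n}"
  shows "restrict_partition (join_at n p P1 P2) {1..p} = P1"
    and "restrict_partition (join_at n p P1 P2) {p<..<n} = P2"
    and "Max (insert 0 (block_of n (join_at n p P1 P2) - {n})) = p"
proof -
  let ?C = "block_of p P1"
  have pa1: "partition_on {1..p} P1" and pa2: "partition_on {p<..<n} P2"
    using P1 P2 by (auto simp: nc_partitions_def)
  have C: "?C = {} \<and> p = 0 \<or> ?C \<in> P1 \<and> p \<in> ?C \<and> ?C \<subseteq> {1..p}"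
    using block_of_in[OF pa1, of p] block_of_notin[OF pa1, of p] pa1
    by (cases "p = 0") (auto simp: partition_on_def)
  have s1: "B \<subseteq> {1..p} \<and> B \<noteq> {}" if "B \<in> P1" for B using that pa1 by (auto simp: partition_on_def)
  have s2: "B \<subseteq> {p<..<n} \<and> B \<noteq> {}" if "B \<in> P2" for B using that pa2 by (auto simp: partition_on_def)
  have i1: "B \<inter> {1..p} = B" "B \<inter> {p<..<n} = {}" if "B \<in> P1" for B
    using s1[OF that] by auto
  have i2: "B \<inter> {p<..<n} = B" "B \<inter> {1..p} = {}" if "B \<in> P2" for B
    using s2[OF that] by force+
  have iC: "insert n ?C \<inter> {1..p} = ?C" "insert n ?C \<inter> {p<..<n} = {}"
    using C p by auto
  have 1: "(\<lambda>B. B \<inter> {1..p}) ` (P1 - {?C}) = P1 - {?C}" "(\<lambda>B. B \<inter> {p<..<n}) ` P2 = P2"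
    using i1 i2 by (auto simp: image_iff)
  have 2: "(\<lambda>B. B \<inter> {p<..<n}) ` (P1 - {?C}) \<subseteq> {{}}" "(\<lambda>B. B \<inter> {1..p}) ` P2 \<subseteq> {{}}"
    using i1(2) i2(2) by (auto simp: image_subset_iff)
  have n: "{} \<notin> P1" "{} \<notin> P2" using s1 s2 by blast+
  show "restrict_partition (join_at n p P1 P2) {1..p} = P1"
    unfolding restrict_partition_def join_at_def image_insert image_Un iC 1 using 2 n C by blast
  show "restrict_partition (join_at n p P1 P2) {p<..<n} = P2"
    unfolding restrict_partition_def join_at_def image_insert image_Un iC 1 using 2 n by blast
  have "block_of n (join_at n p P1 P2) - {n} = ?C"
    unfolding block_of_join_at[OF assms] using C p by auto
  moreover have "Max (insert 0 ?C) = p"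
    using C finite_subset[of ?C "{1..p}"] by (intro Max_eqI) auto
  ultimately show "Max (insert 0 (block_of n (join_at n p P1 P2) - {n})) = p" by simp
qed

text \<open>No block other than that of \<open>n\<close> has points on both sides of
  \<open>p\<close>: points \<open>x < p < y < n\<close> with \<open>p\<close> and \<open>n\<close>
  in one block would cross. Cutting at \<open>p\<close> therefore splits only the block of
  \<open>n\<close>, which \<open>join_at\<close> restores.\<close>

lemma join_at_restrict:
  assumes P: "P \<in> nc_partitions {1..n}" and n: "1 \<le> n"
    and p: "p = Max (insert 0 (block_of n P - {n}))"
  shows "p < n" "join_at n p (restrict_partition P {1..p}) (restrict_partition P {p<..<n}) = P"
proof -
  let ?B0 = "block_of n P"
  let ?P1 = "restrict_partition P {1..p}" and ?P2 = "restrict_partition P {p<..<n}"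
  have pa: "partition_on {1..n} P" and nc: "noncrossing P"
    using P by (auto simp: nc_partitions_def)
  have B0: "?B0 \<in> P" "n \<in> ?B0" using block_of_in[OF pa, of n] n by auto
  have s: "B \<subseteq> {1..n} \<and> B \<noteq> {}" if "B \<in> P" for B using that pa by (auto simp: partition_on_def)
  have fin: "finite (insert 0 (?B0 - {n}))" using s[OF B0(1)] finite_subset by auto
  have "p \<in> insert 0 (?B0 - {n})" unfolding p using fin by (rule Max_in) simp
  hence pB: "p = 0 \<or> p \<in> ?B0 \<and> p \<noteq> n" by auto
  show pn: "p < n" using pB s[OF B0(1)] n by force
  have le: "x \<le> p" if "x \<in> ?B0" "x \<noteq> n" for x unfolding p using that by (intro Max_ge[OF fin]) auto
  have b1: "?B0 \<inter> {1..p} = ?B0 - {n}" "?B0 \<inter> {p<..<n} = {}"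
    using le s[OF B0(1)] pn by force+
  have other: "B \<subseteq> {1..p} \<or> B \<subseteq> {p<..<n}" if B: "B \<in> P" "B \<noteq> ?B0" for B
  proof (rule ccontr)
    assume neg: "\<not> (B \<subseteq> {1..p} \<or> B \<subseteq> {p<..<n})"
    have nB: "n \<notin> B" using partition_block_unique[OF pa B(1) B0(1)] B B0 by auto
    have sub: "B \<subseteq> {1..<n}" using nB s[OF B(1)] by (force simp: le_less)
    obtain y where y: "y \<in> B" "p < y" "y < n" using neg sub by force
    obtain x where x: "x \<in> B" "x \<le> p" "1 \<le> x" using neg sub by force
    \<comment> \<open>The bounds \<open>1 \<le> x\<close> and \<open>x \<le> p\<close> exclude the
      default value \<open>p = 0\<close>.\<close>
    have "p \<in> ?B0" using pB x by auto
    moreover have "p \<notin> B" using partition_block_unique[OF pa B(1) B0(1), of p] B calculation by auto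
    ultimately have "x < p" using x by (metis le_neq_implies_less)
    hence "B = ?B0"
      using noncrossingD[OF nc B(1) B0(1) x(1) y(1) \<open>p \<in> ?B0\<close> B0(2)] y by auto
    thus False using B by simp
  qed
  have e: "{} \<notin> P" using s by blast
  have p1: "?P1 = ({?B0 - {n}} \<union> {B \<in> P. B \<noteq> ?B0 \<and> B \<subseteq> {1..p}}) - {{}}"
  proof -
    have ins: "(\<lambda>B. B \<inter> {1..p}) ` P = insert (?B0 - {n}) ((\<lambda>B. B \<inter> {1..p}) ` (P - {?B0}))"
      using B0 b1 by (metis image_insert insert_Diff)
    have eq: "(\<lambda>B. B \<inter> {1..p}) ` (P - {?B0}) - {{}} = {B \<in> P. B \<noteq> ?B0 \<and> B \<subseteq> {1..p}} - {{}}"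
    proof (intro Set.set_eqI iffI)
      fix X assume "X \<in> (\<lambda>B. B \<inter> {1..p}) ` (P - {?B0}) - {{}}"
      then obtain B where B: "B \<in> P" "B \<noteq> ?B0" "X = B \<inter> {1..p}" "X \<noteq> {}" by blast
      hence "\<not> B \<subseteq> {p<..<n}" by auto
      hence "B \<subseteq> {1..p}" using other B by blast
      thus "X \<in> {B \<in> P. B \<noteq> ?B0 \<and> B \<subseteq> {1..p}} - {{}}" using B by (simp add: Int_absorb2)
    next
      fix X assume "X \<in> {B \<in> P. B \<noteq> ?B0 \<and> B \<subseteq> {1..p}} - {{}}"
      thus "X \<in> (\<lambda>B. B \<inter> {1..p}) ` (P - {?B0}) - {{}}"
        by (auto simp: image_iff Int_absorb2 intro!: bexI[of _ X])
    qed
    have gen: "insert x Y - {{}} = ({x} \<union> Z) - {{}}" if "Y - {{}} = Z - {{}}"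
      for x and Y Z :: "nat set set" using that by blast
    show ?thesis unfolding restrict_partition_def ins by (rule gen[OF eq])
  qed
  have p2: "?P2 = {B \<in> P. B \<noteq> ?B0 \<and> B \<subseteq> {p<..<n}}"
  proof (intro Set.set_eqI iffI)
    fix X assume "X \<in> ?P2"
    then obtain B where B: "B \<in> P" "X = B \<inter> {p<..<n}" "X \<noteq> {}"
      by (auto simp: restrict_partition_def)
    hence "B \<noteq> ?B0" using b1 by auto
    moreover have "\<not> B \<subseteq> {1..p}" using B by auto
    ultimately have "B \<subseteq> {p<..<n}" using other B by blast
    thus "X \<in> {B \<in> P. B \<noteq> ?B0 \<and> B \<subseteq> {p<..<n}}" using B \<open>B \<noteq> ?B0\<close> by (simp add: Int_absorb2)
  next
    fix X assume "X \<in> {B \<in> P. B \<noteq> ?B0 \<and> B \<subseteq> {p<..<n}}"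
    thus "X \<in> ?P2"
      using e by (auto simp: restrict_partition_def image_iff Int_absorb2 intro!: bexI[of _ X])
  qed
  have blk: "block_of p ?P1 = ?B0 - {n}"
  proof (cases "p = 0")
    case True
    have "block_of p ?P1 = {}"
      using True unfolding block_of_def restrict_partition_def by auto
    moreover have "?B0 - {n} = {}" using le True s[OF B0(1)] by fastforce
    ultimately show ?thesis by simp
  next
    case False
    have "?P1 \<in> nc_partitions {1..p}" using restrict_nc_partition[OF P] pn by auto
    hence "partition_on {1..p} ?P1" by (simp add: nc_partitions_def)
    moreover have "?B0 - {n} \<in> ?P1" using False pB unfolding p1 by auto
    ultimately show ?thesis using False pB by (intro block_of_eq) auto
  qed
  have ins: "insert n (?B0 - {n}) = ?B0" using B0 by auto
  have nin: "?B0 - {n} \<notin> P" if "?B0 - {n} \<noteq> {}"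
    using partition_block_unique[OF pa _ B0(1)] that B0 by blast
  define R where "R = {B \<in> P. B \<noteq> ?B0 \<and> B \<subseteq> {1..p}}"
  have gen: "({X} \<union> Y) - {{}} - {X} = Y" if "{} \<notin> Y" "X \<notin> Y" for X :: "nat set" and Y
    using that by blast
  have "?B0 - {n} \<notin> P" using nin e by metis
  hence "?P1 - {?B0 - {n}} = R"
    unfolding p1 R_def[symmetric] by (intro gen) (use e in \<open>simp_all add: R_def\<close>)
  moreover have "insert ?B0 (R \<union> ?P2) = P"
    unfolding p2 R_def using other B0(1) by blast
  ultimately show "join_at n p ?P1 ?P2 = P"
    unfolding join_at_def blk ins by simp
qed

section \<open>Multiplicative weights on non-crossing partitions\<close>

definition nc_sum :: "(nat \<Rightarrow> 'a::comm_ring_1) \<Rightarrow> nat \<Rightarrow> 'a" where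
  "nc_sum \<kappa> n = (\<Sum>P\<in>NC n. \<Prod>B\<in>P. \<kappa> (card B))"

text \<open>The shift remembers points already removed from the last block; it makes the recursion close.\<close>

definition nc_sum_shift :: "(nat \<Rightarrow> 'a::comm_ring_1) \<Rightarrow> nat \<Rightarrow> nat \<Rightarrow> 'a" where
  "nc_sum_shift \<kappa> a n = (\<Sum>P\<in>NC n. \<Prod>B\<in>P. \<kappa> (card B + (if n \<in> B then a else 0)))"

lemma nc_sum_shift_0: "nc_sum_shift \<kappa> 0 n = nc_sum \<kappa> n"
  by (simp add: nc_sum_shift_def nc_sum_def)

lemma NC_0: "NC 0 = {{}}"
  by (auto simp: NC_def partition_on_def noncrossing_def disjoint_def)

lemma nc_sum_0: "nc_sum \<kappa> 0 = 1"
  by (simp add: nc_sum_def NC_0)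

lemma finite_nc_partitions: "finite A \<Longrightarrow> finite (nc_partitions A)"
  by (rule finite_subset[of _ "Pow (Pow A)"]) (auto simp: nc_partitions_def partition_on_def)

lemma noncrossing_image:
  assumes "noncrossing P" "strict_mono_on (\<Union>P) f"
  shows "noncrossing ((`) f ` P)"
  unfolding noncrossing_def
proof (intro ballI impI)
  fix X Y a b c d
  assume XY: "X \<in> (`) f ` P" "Y \<in> (`) f ` P" and el: "a \<in> X" "b \<in> Y" "c \<in> X" "d \<in> Y"
    and lt: "a < b" "b < c" "c < d"
  obtain B C where B: "B \<in> P" "C \<in> P" "X = f ` B" "Y = f ` C" using XY by auto
  obtain a' b' c' d' where el': "a' \<in> B" "b' \<in> C" "c' \<in> B" "d' \<in> C"
    "a = f a'" "b = f b'" "c = f c'" "d = f d'" using el B by auto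
  have *: "x < y" if "f x < f y" "x \<in> \<Union>P" "y \<in> \<Union>P" for x y
    using that assms(2) by (metis linorder_neqE_nat order_less_imp_not_less strict_mono_onD)
  have "a' < b'" "b' < c'" "c' < d'" using lt el' B by (auto intro!: *)
  hence "B = C" using noncrossingD[OF assms(1) B(1,2)] el' by blast
  thus "X = Y" using B by simp
qed

lemma nc_partitions_image:
  assumes "P \<in> nc_partitions A" "strict_mono_on A f"
  shows "(`) f ` P \<in> nc_partitions (f ` A)"
proof -
  have P: "partition_on A P" "noncrossing P" using assms(1) by (auto simp: nc_partitions_def)
  have "{} \<notin> (`) f ` P" using P(1) by (auto simp: partition_on_def)
  hence "partition_on (f ` A) ((`) f ` P)"
    using partition_on_inj_image[OF P(1) strict_mono_on_imp_inj_on[OF assms(2)]] by simp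
  moreover have "\<Union>P = A" using P(1) by (simp add: partition_on_def)
  ultimately show ?thesis
    using noncrossing_image[OF P(2), of f] assms(2) by (simp add: nc_partitions_def)
qed

lemma nc_sum_interval:
  assumes "p < n"
  shows "(\<Sum>P\<in>nc_partitions {p<..<n}. \<Prod>B\<in>P. \<kappa> (card B)) = nc_sum \<kappa> (n - 1 - p)"
  unfolding nc_sum_def NC_eq
proof (rule sum.reindex_bij_witness[where j = "(`) ((`) (\<lambda>x. x - p))" and i = "(`) ((`) ((+) p))"])
  have im: "(+) p ` {1..n - 1 - p} = {p<..<n}" "(\<lambda>x. x - p) ` {p<..<n} = {1..n - 1 - p}"
  proof -
    show *: "(+) p ` {1..n - 1 - p} = {p<..<n}"
      using assms by (auto simp: image_iff intro!: bexI[of _ "_ - p"])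
    show "(\<lambda>x. x - p) ` {p<..<n} = {1..n - 1 - p}"
      unfolding *[symmetric] image_image by simp
  qed
  fix P
  assume P: "P \<in> nc_partitions {p<..<n}"
  have bl: "(+) p ` (\<lambda>x. x - p) ` B = B" if "B \<in> P" for B
  proof -
    have "B \<subseteq> {p<..<n}" using that P by (auto simp: nc_partitions_def partition_on_def)
    hence "(\<lambda>x. p + (x - p)) ` B = (\<lambda>x. x) ` B" by (intro image_cong) auto
    thus ?thesis by (simp add: image_image)
  qed
  show "(`) ((+) p) ` (`) (\<lambda>x. x - p) ` P = P"
    using bl by (force simp: image_image)
  show "(`) (\<lambda>x. x - p) ` P \<in> nc_partitions {1..n - 1 - p}"
    using nc_partitions_image[OF P, of "\<lambda>x. x - p"] by (simp add: im strict_mono_on_def diff_less_mono)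
  have inj: "inj_on (\<lambda>x. x - p) B" if "B \<in> P" for B
  proof -
    have "B \<subseteq> {p<..<n}" using that P by (auto simp: nc_partitions_def partition_on_def)
    thus ?thesis by (intro inj_onI) (use eq_diff_iff in \<open>fastforce\<close>)
  qed
  have "inj_on ((`) (\<lambda>x. x - p)) P"
    by (rule inj_on_inverseI[where g = "(`) ((+) p)"]) (rule bl)
  thus "(\<Prod>B\<in>(`) (\<lambda>x. x - p) ` P. \<kappa> (card B)) = (\<Prod>B\<in>P. \<kappa> (card B))"
    by (simp add: prod.reindex card_image[OF inj])
next
  fix P assume P: "P \<in> nc_partitions {1..n - 1 - p}"
  show "(`) (\<lambda>x. x - p) ` (`) ((+) p) ` P = P" by (simp add: image_image)
  have "(+) p ` {1..n - 1 - p} = {p<..<n}"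
    using assms by (auto simp: image_iff intro!: bexI[of _ "_ - p"])
  thus "(`) ((+) p) ` P \<in> nc_partitions {p<..<n}"
    using nc_partitions_image[OF P, of "(+) p"] by (simp add: strict_mono_on_def)
qed

text \<open>The block of \<open>n\<close> has one point more than the block of \<open>p\<close> that
  it extends, so a shift \<open>a\<close> at \<open>n\<close> becomes the shift \<open>Suc a\<close>
  at \<open>p\<close>. For \<open>p = 0\<close> the block is \<open>{n}\<close> and contributes the
  isolated factor \<open>\<kappa> (Suc a)\<close>.\<close>

lemma prod_join_at:
  fixes \<kappa> :: "nat \<Rightarrow> 'a::comm_ring_1"
  assumes p: "p < n" and P1: "P1 \<in> nc_partitions {1..p}" and P2: "P2 \<in> nc_partitions {p<..<n}"
  shows "(\<Prod>B\<in>join_at n p P1 P2. \<kappa> (card B + (if n \<in> B then a else 0))) =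
    (if p = 0 then \<kappa> (Suc a) else \<Prod>B\<in>P1. \<kappa> (card B + (if p \<in> B then Suc a else 0))) *
    (\<Prod>B\<in>P2. \<kappa> (card B))"
proof -
  let ?C = "block_of p P1" and ?f = "\<lambda>B. \<kappa> (card B + (if n \<in> B then a else 0))"
  have pa1: "partition_on {1..p} P1" and pa2: "partition_on {p<..<n} P2"
    using P1 P2 by (auto simp: nc_partitions_def)
  have s1: "B \<subseteq> {1..p}" if "B \<in> P1" for B using that pa1 by (auto simp: partition_on_def)
  have s2: "B \<subseteq> {p<..<n}" if "B \<in> P2" for B using that pa2 by (auto simp: partition_on_def)
  have fin: "finite P1" "finite P2" using finite_elements[OF _ pa1] finite_elements[OF _ pa2] by auto
  have nin: "n \<notin> B" if "B \<in> P1 - {?C} \<union> P2" for B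
  proof -
    have "B \<subseteq> {1..p} \<or> B \<subseteq> {p<..<n}" using that s1 s2 by blast
    thus ?thesis using p by auto
  qed
  have disj: "(P1 - {?C}) \<inter> P2 = {}"
  proof -
    have "False" if "B \<in> P1" "B \<in> P2" for B
    proof -
      have "B = {}" using s1[OF that(1)] s2[OF that(2)] by fastforce
      thus False using that pa1 by (simp add: partition_on_def)
    qed
    thus ?thesis by blast
  qed
  have "(\<Prod>B\<in>join_at n p P1 P2. ?f B) = ?f (insert n ?C) * (\<Prod>B\<in>P1 - {?C} \<union> P2. ?f B)"
    unfolding join_at_def using nin fin by (subst prod.insert) auto
  also have "(\<Prod>B\<in>P1 - {?C} \<union> P2. ?f B) = (\<Prod>B\<in>P1 - {?C} \<union> P2. \<kappa> (card B))"
    using nin by (intro prod.cong) auto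
  also have "\<dots> = (\<Prod>B\<in>P1 - {?C}. \<kappa> (card B)) * (\<Prod>B\<in>P2. \<kappa> (card B))"
    using fin disj by (subst prod.union_disjoint) auto
  finally have 1: "(\<Prod>B\<in>join_at n p P1 P2. ?f B) =
    ?f (insert n ?C) * (\<Prod>B\<in>P1 - {?C}. \<kappa> (card B)) * (\<Prod>B\<in>P2. \<kappa> (card B))"
    by (simp add: mult.assoc)
  have "?f (insert n ?C) * (\<Prod>B\<in>P1 - {?C}. \<kappa> (card B)) =
    (if p = 0 then \<kappa> (Suc a) else \<Prod>B\<in>P1. \<kappa> (card B + (if p \<in> B then Suc a else 0)))"
  proof (cases "p = 0")
    case True
    hence "P1 = {}" using pa1 by (auto simp: partition_on_def)
    thus ?thesis using True by (simp add: block_of_def)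
  next
    case False
    have C: "?C \<in> P1" "p \<in> ?C" using block_of_in[OF pa1, of p] False by auto
    have "card (insert n ?C) = Suc (card ?C)"
      using s1[OF C(1)] p by (subst card_insert_disjoint) (auto intro: finite_subset)
    moreover have "(\<Prod>B\<in>P1 - {?C}. \<kappa> (card B)) =
      (\<Prod>B\<in>P1 - {?C}. \<kappa> (card B + (if p \<in> B then Suc a else 0)))"
      using partition_block_unique[OF pa1 _ C(1)] C by (intro prod.cong) auto
    ultimately show ?thesis
      using False C prod.remove[OF fin(1) C(1), of "\<lambda>B. \<kappa> (card B + (if p \<in> B then Suc a else 0))"]
      by simp
  qed
  thus ?thesis using 1 by simp
qed

text \<open>Condition on the predecessor \<open>p\<close> of \<open>n\<close> in its block; \<open>p = 0\<close> means that there is none.\<close>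

lemma nc_sum_shift_rec:
  fixes \<kappa> :: "nat \<Rightarrow> 'a::comm_ring_1"
  assumes n: "1 \<le> n"
  shows "nc_sum_shift \<kappa> a n = \<kappa> (Suc a) * nc_sum \<kappa> (n - 1) +
    (\<Sum>p\<in>{1..<n}. nc_sum_shift \<kappa> (Suc a) p * nc_sum \<kappa> (n - 1 - p))"
proof -
  let ?S = "SIGMA p:{..<n}. nc_partitions {1..p} \<times> nc_partitions {p<..<n}"
  let ?g = "\<lambda>p P1. (if p = 0 then \<kappa> (Suc a)
    else \<Prod>B\<in>P1. \<kappa> (card B + (if p \<in> B then Suc a else 0)))"
  let ?pr = "\<lambda>P. Max (insert 0 (block_of n P - {n}))"
  have "nc_sum_shift \<kappa> a n = (\<Sum>(p, P1, P2)\<in>?S. ?g p P1 * (\<Prod>B\<in>P2. \<kappa> (card B)))"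
    unfolding nc_sum_shift_def NC_eq
  proof (rule sum.reindex_bij_witness[where i = "\<lambda>(p, P1, P2). join_at n p P1 P2" and
        j = "\<lambda>P. (?pr P, restrict_partition P {1..?pr P}, restrict_partition P {?pr P<..<n})"])
    fix P assume P: "P \<in> nc_partitions {1..n}"
    note j = join_at_restrict[OF P n refl]
    show "(case (?pr P, restrict_partition P {1..?pr P}, restrict_partition P {?pr P<..<n}) of
        (p, P1, P2) \<Rightarrow> join_at n p P1 P2) = P"
      using j by simp
    show in_S: "(?pr P, restrict_partition P {1..?pr P}, restrict_partition P {?pr P<..<n}) \<in> ?S"
      using j(1) by (auto intro!: restrict_nc_partition[OF P])
    show "(case (?pr P, restrict_partition P {1..?pr P}, restrict_partition P {?pr P<..<n}) of
        (p, P1, P2) \<Rightarrow> ?g p P1 * (\<Prod>B\<in>P2. \<kappa> (card B))) =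
      (\<Prod>B\<in>P. \<kappa> (card B + (if n \<in> B then a else 0)))"
      using prod_join_at[OF j(1), of "restrict_partition P {1..?pr P}"
          "restrict_partition P {?pr P<..<n}" \<kappa> a] in_S j(2) by simp
  next
    fix x assume "x \<in> ?S"
    then obtain p P1 P2 where x: "x = (p, P1, P2)" "p < n" "P1 \<in> nc_partitions {1..p}"
      "P2 \<in> nc_partitions {p<..<n}" by auto
    note r = restrict_join_at[OF x(2-4)]
    show "(\<lambda>P. (?pr P, restrict_partition P {1..?pr P}, restrict_partition P {?pr P<..<n}))
       (case x of (p, P1, P2) \<Rightarrow> join_at n p P1 P2) = x"
      using r x(1) by simp
    show "(case x of (p, P1, P2) \<Rightarrow> join_at n p P1 P2) \<in> nc_partitions {1..n}"
      using join_at_nc[OF x(2-4)] x(1) by simp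
  qed
  also have "\<dots> = (\<Sum>p<n. \<Sum>(P1, P2)\<in>nc_partitions {1..p} \<times> nc_partitions {p<..<n}.
      ?g p P1 * (\<Prod>B\<in>P2. \<kappa> (card B)))"
    by (subst sum.Sigma) (auto simp: finite_nc_partitions)
  also have "\<dots> = (\<Sum>p<n. (\<Sum>P1\<in>nc_partitions {1..p}. ?g p P1) * nc_sum \<kappa> (n - 1 - p))"
    by (intro sum.cong refl, subst nc_sum_interval[symmetric]) (auto simp: sum_product sum.cartesian_product)
  \<comment> \<open>The index \<open>0\<close> is special: its left part has only the empty
    partition, and \<open>?g\<close> takes its first branch.\<close>
  also have "{..<n} = insert 0 {1..<n}" using n by auto
  also have "(\<Sum>p\<in>insert 0 {1..<n}. (\<Sum>P1\<in>nc_partitions {1..p}. ?g p P1) * nc_sum \<kappa> (n - 1 - p)) =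
    \<kappa> (Suc a) * nc_sum \<kappa> (n - 1) +
    (\<Sum>p\<in>{1..<n}. (\<Sum>P1\<in>nc_partitions {1..p}. ?g p P1) * nc_sum \<kappa> (n - 1 - p))"
    using NC_0 by (subst sum.insert) (auto simp: NC_eq)
  also have "(\<Sum>p\<in>{1..<n}. (\<Sum>P1\<in>nc_partitions {1..p}. ?g p P1) * nc_sum \<kappa> (n - 1 - p)) =
    (\<Sum>p\<in>{1..<n}. nc_sum_shift \<kappa> (Suc a) p * nc_sum \<kappa> (n - 1 - p))"
    by (intro sum.cong refl) (simp add: nc_sum_shift_def NC_eq)
  finally show ?thesis .
qed

section \<open>Wick products of free semicircular elements\<close>

text \<open>With \<open>s j\<close> as creation plus annihilation on the full Fock space,
  \<open>wick s w\<close> is the element that sends the vacuum to the basis vector of the word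
  \<open>w\<close>.\<close>

fun wick :: "('i \<Rightarrow> 'h::complex_hilbert_space operator) \<Rightarrow> 'i list \<Rightarrow> 'h operator" where
  "wick s [] = 1"
| "wick s [j] = s j"
| "wick s (j # k # w) = s j * wick s (k # w) - (if j = k then wick s w else 0)"

text \<open>These are the Chebyshev polynomials of the second kind at \<open>x / 2\<close>, the
  orthogonal polynomials of the semicircle law of variance one.\<close>

fun chebyshev_U :: "nat \<Rightarrow> 'a::comm_ring_1 poly" where
  "chebyshev_U 0 = 1"
| "chebyshev_U (Suc 0) = [:0, 1:]"
| "chebyshev_U (Suc (Suc n)) = pCons 0 (chebyshev_U (Suc n)) - chebyshev_U n"

lemma degree_chebyshev_U: "degree (chebyshev_U n) \<le> n"
proof (induction n rule: chebyshev_U.induct)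
  case (3 n)
  thus ?case by (auto intro!: degree_diff_le order_trans[OF degree_pCons_le])
qed simp_all

lemma poly_altdef_le:
  fixes p :: "'a::comm_ring_1 poly"
  shows "degree p \<le> n \<Longrightarrow> poly p x = (\<Sum>k\<le>n. coeff p k * x ^ k)"
  unfolding poly_altdef by (intro sum.mono_neutral_left) (auto simp: coeff_eq_0)

lemma coeff_chebyshev_U: "coeff (chebyshev_U n :: complex poly) k = of_real (coeff (chebyshev_U n) k)"
  by (induction n arbitrary: k rule: chebyshev_U.induct) (auto simp: coeff_pCons split: nat.splits)

lemma chebyshev_U_cos: "poly (chebyshev_U n) (2 * cos \<theta>) * sin \<theta> = sin (real (n + 1) * \<theta>)"
proof (induction n rule: chebyshev_U.induct)
  case 2
  show ?case using sin_double[of \<theta>] by (simp add: mult_ac)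
next
  case (3 n)
  have "sin (real (n + 3) * \<theta>) = 2 * cos \<theta> * sin (real (n + 2) * \<theta>) - sin (real (n + 1) * \<theta>)"
    using sin_add[of "real (n + 2) * \<theta>" \<theta>] sin_diff[of "real (n + 2) * \<theta>" \<theta>]
    by (simp add: algebra_simps)
  thus ?case using 3 by (simp add: algebra_simps)
qed simp

lemma has_integral_chebyshev_U:
  assumes v: "0 < v" and n: "1 \<le> n"
  shows "((\<lambda>x. sqrt (4 * v - x\<^sup>2) / (2 * pi * v) * poly (chebyshev_U n) (x / sqrt v)) has_integral 0)
    {- 2 * sqrt v..2 * sqrt v}"
proof -
  define w where "w = sqrt v"
  have w: "0 < w" "v = w\<^sup>2" using v by (auto simp: w_def)
  define th where "th = (\<lambda>x. arccos (x / (2 * w)))"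
  \<comment> \<open>With x = 2 w cos \<theta> the integrand becomes a multiple of sin ((n + 1)
    \<theta>) sin \<theta>, half a difference of cosines of n \<theta> and (n + 2) \<theta>; this is
    its primitive, written in \<open>x\<close>. The division by \<open>real n\<close> uses
    \<open>1 \<le> n\<close>.\<close>
  define H where "H = (\<lambda>x. (sin (real (n + 2) * th x) / real (n + 2) - sin (real n * th x) / real n) / pi)"
  let ?h = "\<lambda>x. sqrt (4 * v - x\<^sup>2) / (2 * pi * v) * poly (chebyshev_U n) (x / sqrt v)"
  have range: "- 1 \<le> x / (2 * w) \<and> x / (2 * w) \<le> 1" if "x \<in> {- 2 * w..2 * w}" for x
    using that w by (simp add: field_simps)
  have h: "?h x = sin (real (n + 1) * th x) / (pi * w)" if "x \<in> {- 2 * w..2 * w}" for x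
  proof -
    have c: "cos (th x) = x / (2 * w)" using range[OF that] by (simp add: th_def)
    have "sin (th x) = sqrt (1 - (x / (2 * w))\<^sup>2)" using range[OF that] by (simp add: th_def sin_arccos)
    moreover have "4 * v - x\<^sup>2 = (2 * w)\<^sup>2 * (1 - (x / (2 * w))\<^sup>2)" using w by (simp add: field_simps power2_eq_square)
    hence "sqrt (4 * v - x\<^sup>2) = 2 * w * sqrt (1 - (x / (2 * w))\<^sup>2)" using w by (simp add: real_sqrt_mult)
    ultimately have s: "sqrt (4 * v - x\<^sup>2) = 2 * w * sin (th x)" by simp
    have "x / sqrt v = 2 * cos (th x)" using c by (simp flip: w_def)
    hence "?h x = (poly (chebyshev_U n) (2 * cos (th x)) * sin (th x)) * (2 * w / (2 * pi * v))"
      unfolding s by simp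
    also have "\<dots> = sin (real (n + 1) * th x) / (pi * w)"
      unfolding chebyshev_U_cos using w by (simp add: power2_eq_square)
    finally show ?thesis .
  qed
  \<comment> \<open>Since \<open>arccos\<close> is differentiable only in the interior, continuity
    has to serve at the ends. There the angle is \<open>0\<close> or \<open>pi\<close>, so that both
    sines vanish.\<close>
  have "(?h has_integral H (2 * w) - H (- 2 * w)) {- 2 * w..2 * w}"
  proof (rule fundamental_theorem_of_calculus_interior)
    show "- 2 * w \<le> 2 * w" using w by simp
    show "continuous_on {- 2 * w..2 * w} H"
      unfolding H_def th_def using range w n by (auto intro!: continuous_intros)
    fix x assume x: "x \<in> {- 2 * w<..<2 * w}"
    hence x': "- 1 < x / (2 * w)" "x / (2 * w) < 1" using w by (simp_all add: field_simps)
    define S where "S = sqrt (1 - (x / (2 * w))\<^sup>2)"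
    have "(x / (2 * w))\<^sup>2 < 1" unfolding abs_square_less_1 using x' by linarith
    hence "0 < S" unfolding S_def real_sqrt_gt_0_iff by linarith
    hence S: "S \<noteq> 0" by simp
    have sin_th: "sin (th x) = S" using x' by (simp add: th_def S_def sin_arccos)
    have dth: "(th has_field_derivative - inverse (2 * w * S)) (at x)"
      unfolding th_def S_def using x' w
      by (auto intro!: derivative_eq_intros simp: field_simps)
    have dsin: "((\<lambda>x. sin (a * th x) / a) has_field_derivative cos (a * th x) * (- inverse (2 * w * S))) (at x)"
      if "a \<noteq> 0" for a
      using that by (auto intro!: derivative_eq_intros dth)
    have "(H has_field_derivative
        (cos (real (n + 2) * th x) - cos (real n * th x)) * (- inverse (2 * w * S)) / pi) (at x)"
      unfolding H_def left_diff_distrib using n by (intro DERIV_cdivide DERIV_diff dsin) simp_all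
    moreover have "cos (real n * th x) - cos (real (n + 2) * th x) = 2 * sin (real (n + 1) * th x) * S"
      using cos_diff[of "real (n + 1) * th x" "th x"] cos_add[of "real (n + 1) * th x" "th x"]
      by (simp add: algebra_simps sin_th)
    hence "(cos (real (n + 2) * th x) - cos (real n * th x)) * (- inverse (2 * w * S)) / pi = ?h x"
      using x S w by (subst h) (auto simp: field_simps)
    ultimately show "(H has_vector_derivative ?h x) (at x)"
      by (simp add: has_real_derivative_iff_has_vector_derivative)
  qed
  moreover have "H (2 * w) = 0" "H (- 2 * w) = 0"
    using w sin_npi[of "n + 2"] by (simp_all add: H_def th_def)
  ultimately show ?thesis by (simp add: w_def)
qed

lemma integral_chebyshev_U_semicircle:
  assumes v: "0 < v" and n: "1 \<le> n"
  shows "(\<integral>x. poly (chebyshev_U n) (x / sqrt v) \<partial>semicircle v) = 0"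
proof -
  let ?I = "{- 2 * sqrt v..2 * sqrt v}"
  let ?f = "\<lambda>x. indicator ?I x * sqrt (4 * v - x\<^sup>2) / (2 * pi * v)"
  let ?h = "\<lambda>x. sqrt (4 * v - x\<^sup>2) / (2 * pi * v) * poly (chebyshev_U n) (x / sqrt v)"
  \<comment> \<open>The function \<open>sqrt\<close> is odd, so the formula is negative outside the
    interval; the indicator removes that part.\<close>
  have nonneg: "0 \<le> ?f x" for x
  proof -
    have "0 \<le> 4 * v - x\<^sup>2" if "x \<in> ?I"
    proof -
      have "\<bar>x\<bar> \<le> 2 * sqrt v" using that by auto
      hence "\<bar>x\<bar>\<^sup>2 \<le> (2 * sqrt v)\<^sup>2" by (intro power_mono) auto
      thus ?thesis using v by (simp add: power_mult_distrib)
    qed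
    thus ?thesis using v by (auto simp: indicator_def)
  qed
  have "(\<integral>x. poly (chebyshev_U n) (x / sqrt v) \<partial>semicircle v) =
      (\<integral>x. ?f x *\<^sub>R poly (chebyshev_U n) (x / sqrt v) \<partial>lborel)"
    unfolding semicircle_def
  proof (rule integral_density)
    show "(\<lambda>x. poly (chebyshev_U n) (x / sqrt v)) \<in> borel_measurable lborel"
      using v by (auto intro!: borel_measurable_continuous_onI continuous_intros)
  qed (use nonneg in auto)
  also have "\<dots> = (LINT x:?I|lborel. ?h x)"
    unfolding set_lebesgue_integral_def by (intro Bochner_Integration.integral_cong refl) simp
  also have "\<dots> = integral ?I ?h"
    by (intro set_borel_integral_eq_integral borel_integrable_atLeastAtMost' continuous_intros)
      (use v in auto)
  also have "\<dots> = 0" using has_integral_chebyshev_U[OF v n] by (rule integral_unique)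
  finally show ?thesis .
qed

section \<open>Polynomials in one operator and freeness\<close>

lemma poly_op_altdef: "degree p \<le> n \<Longrightarrow> poly_op p T = (\<Sum>k\<le>n. coeff p k *\<^sub>C T ^ k)"
  unfolding poly_op_def by (intro sum.mono_neutral_left) (auto simp: coeff_eq_0)

lemma poly_op_0 [simp]: "poly_op 0 T = 0"
  by (simp add: poly_op_def)

lemma poly_op_1 [simp]: "poly_op 1 T = 1"
  by (simp add: poly_op_def)

lemma poly_op_pCons [simp]: "poly_op (pCons a p) T = a *\<^sub>C 1 + T * poly_op p T"
proof -
  have "poly_op (pCons a p) T = (\<Sum>k\<le>Suc (degree p). coeff (pCons a p) k *\<^sub>C T ^ k)"
    by (intro poly_op_altdef degree_pCons_le)
  also have "\<dots> = a *\<^sub>C 1 + T * poly_op p T"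
    by (subst sum.atMost_Suc_shift) (simp add: poly_op_def sum_distrib_left)
  finally show ?thesis .
qed

lemma poly_op_diff [simp]: "poly_op (p - q) T = poly_op p T - poly_op q T"
proof -
  let ?n = "max (degree p) (degree q)"
  have "poly_op (p - q) T = (\<Sum>k\<le>?n. coeff (p - q) k *\<^sub>C T ^ k)"
    by (intro poly_op_altdef degree_diff_le_max)
  also have "\<dots> = (\<Sum>k\<le>?n. coeff p k *\<^sub>C T ^ k) - (\<Sum>k\<le>?n. coeff q k *\<^sub>C T ^ k)"
    unfolding sum_subtractf[symmetric]
    by (intro sum.cong refl) (metis add_diff_cancel_right' coeff_diff diff_add_cancel scaleC_add_left)
  finally show ?thesis by (simp add: poly_op_altdef[of p ?n] poly_op_altdef[of q ?n])
qed

lemma poly_op_smult [simp]: "poly_op (Polynomial.smult c p) T = c *\<^sub>C poly_op p T"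
  by (induction p) (simp_all add: scaleC_add_right scaleC_scaleC)

lemma poly_op_add_const: "poly_op ([:a:] + p) T = a *\<^sub>C 1 + poly_op p T"
  by (cases p) (simp add: scaleC_add_left add.assoc)

lemma poly_op_scaleC: "poly_op p (c *\<^sub>C T) = poly_op (pcompose p [:0, c:]) T"
  by (induction p) (simp_all add: pcompose_pCons poly_op_add_const)

lemma freely_independentD:
  assumes "freely_independent \<phi> I X" "w \<noteq> []" "successively (\<noteq>) (map fst w)"
    and "\<And>i p. (i, p) \<in> set w \<Longrightarrow> i \<in> I \<and> \<phi> (poly_op p (X i)) = 0"
  shows "\<phi> (prod_list (map (\<lambda>(i, p). poly_op p (X i)) w)) = 0"
  using assms unfolding freely_independent_def by blast

text \<open>Composition with \<open>[:0, c i:]\<close> turns a polynomial in the rescaled variable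
  into one in \<open>X i\<close> with the same value, which preserves both the centering and the
  alternating product.\<close>

lemma freely_independent_scaleC:
  fixes X :: "'i \<Rightarrow> 'h::complex_hilbert_space operator"
  assumes "freely_independent \<phi> I X"
  shows "freely_independent \<phi> I (\<lambda>i. c i *\<^sub>C X i)"
  unfolding freely_independent_def
proof (intro allI impI)
  fix w :: "('i \<times> complex poly) list"
  assume w: "w \<noteq> []" "successively (\<noteq>) (map fst w)"
    "\<forall>(i, p)\<in>set w. i \<in> I \<and> \<phi> (poly_op p (c i *\<^sub>C X i)) = 0"
  let ?w = "map (\<lambda>(i, p). (i, pcompose p [:0, c i:])) w"
  have fst_w: "map fst ?w = map fst w" by auto
  have "\<phi> (prod_list (map (\<lambda>(i, p). poly_op p (X i)) ?w)) = 0"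
  proof (rule freely_independentD[OF assms])
    show "successively (\<noteq>) (map fst ?w)" unfolding fst_w by (rule w(2))
  qed (use w in \<open>auto simp: poly_op_scaleC\<close>)
  moreover have "map (\<lambda>(i, p). poly_op p (X i)) ?w = map (\<lambda>(i, p). poly_op p (c i *\<^sub>C X i)) w"
    by (auto simp: poly_op_scaleC)
  ultimately show "\<phi> (prod_list (map (\<lambda>(i, p). poly_op p (c i *\<^sub>C X i)) w)) = 0" by metis
qed

text \<open>Injectivity of \<open>f\<close> keeps neighbouring indices distinct.\<close>

lemma freely_independent_reindex:
  fixes f :: "'j \<Rightarrow> 'i"
  assumes "freely_independent \<phi> I X" "inj f" "f ` J \<subseteq> I"
  shows "freely_independent \<phi> J (X \<circ> f)"
  unfolding freely_independent_def
proof (intro allI impI)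
  fix w :: "('j \<times> complex poly) list"
  assume w: "w \<noteq> []" "successively (\<noteq>) (map fst w)"
    "\<forall>(i, p)\<in>set w. i \<in> J \<and> \<phi> (poly_op p ((X \<circ> f) i)) = 0"
  let ?w = "map (\<lambda>(i, p). (f i, p)) w"
  have "successively (\<noteq>) (map fst ?w)"
    using w(2) assms(2) by (simp add: successively_map case_prod_unfold inj_eq)
  hence "\<phi> (prod_list (map (\<lambda>(i, p). poly_op p (X i)) ?w)) = 0"
    using w subsetD[OF assms(3) imageI] by (intro freely_independentD[OF assms(1)]) auto
  moreover have "map (\<lambda>(i, p). poly_op p (X i)) ?w = map (\<lambda>(i, p). poly_op p ((X \<circ> f) i)) w"
    by auto
  ultimately show "\<phi> (prod_list (map (\<lambda>(i, p). poly_op p ((X \<circ> f) i)) w)) = 0" by metis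
qed

text \<open>Along a run of equal letters the recursion of \<open>wick\<close> is the three-term
  recursion of \<open>chebyshev_U\<close>. The condition on \<open>hd w\<close> keeps the last
  letter of the run from contracting with \<open>w\<close>.\<close>

lemma wick_replicate:
  assumes "w = [] \<or> hd w \<noteq> j"
  shows "wick s (replicate k j @ w) = poly_op (chebyshev_U k) (s j) * wick s w"
proof (induction k rule: chebyshev_U.induct)
  case 2
  show ?case using assms by (cases w) auto
next
  case (3 n)
  thus ?case by (simp add: algebra_simps)
qed simp

text \<open>Grouping a word into runs of equal letters writes its Wick product as an alternating product.\<close>

lemma wick_factor:
  "\<exists>ps. wick s w = prod_list (map (\<lambda>(i, p). poly_op p (s i)) ps) \<and> successively (\<noteq>) (map fst ps) \<and>
    (\<forall>(i, p)\<in>set ps. i \<in> set w \<and> (\<exists>k\<ge>1. p = chebyshev_U k)) \<and>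
    (w \<noteq> [] \<longrightarrow> ps \<noteq> [] \<and> fst (hd ps) = hd w)"
proof (induction w rule: length_induct)
  case (1 w)
  show ?case
  proof (cases w)
    case Nil
    thus ?thesis by (intro exI[of _ "[]"]) simp
  next
    case (Cons j w')
    define k where "k = length (takeWhile ((=) j) w)"
    define u where "u = dropWhile ((=) j) w"
    have rep: "takeWhile ((=) j) w = replicate k j"
      unfolding k_def by (intro replicate_eqI) (auto dest: set_takeWhileD)
    hence w: "w = replicate k j @ u" unfolding u_def by (metis takeWhile_dropWhile_id)
    have k: "1 \<le> k" using Cons by (simp add: k_def)
    have hd: "u = [] \<or> hd u \<noteq> j" unfolding u_def using hd_dropWhile[of "(=) j" w] by metis
    have "length u < length w" using w k by simp
    then obtain ps where ps: "wick s u = prod_list (map (\<lambda>(i, p). poly_op p (s i)) ps)"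
      "successively (\<noteq>) (map fst ps)" "\<forall>(i, p)\<in>set ps. i \<in> set u \<and> (\<exists>k\<ge>1. p = chebyshev_U k)"
      "u \<noteq> [] \<longrightarrow> ps \<noteq> [] \<and> fst (hd ps) = hd u"
      using "1.IH" by blast
    have "ps = []" if "u = []" using ps(3) that by (cases ps) auto
    hence "successively (\<noteq>) (map fst ((j, chebyshev_U k) # ps))"
      using ps(2,4) hd by (cases ps) (auto simp: successively_Cons)
    moreover have "wick s w = prod_list (map (\<lambda>(i, p). poly_op p (s i)) ((j, chebyshev_U k) # ps))"
      unfolding w using wick_replicate[OF hd, of s k] ps(1) by simp
    moreover have "set w = insert j (set u)" using w k by auto
    ultimately show ?thesis using ps(3) k Cons
      by (intro exI[of _ "(j, chebyshev_U k) # ps"]) auto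
  qed
qed

text \<open>The factors of the alternating product from \<open>wick_factor\<close> are centered by
  \<open>U\<close>, so the defining property of freeness applies.\<close>

lemma trace_wick_eq_0:
  assumes free: "freely_independent \<phi> I s"
    and U: "\<And>i k. i \<in> I \<Longrightarrow> 1 \<le> k \<Longrightarrow> \<phi> (poly_op (chebyshev_U k) (s i)) = 0"
    and w: "set w \<subseteq> I" "w \<noteq> []"
  shows "\<phi> (wick s w) = 0"
proof -
  obtain ps where ps: "wick s w = prod_list (map (\<lambda>(i, p). poly_op p (s i)) ps)"
    "successively (\<noteq>) (map fst ps)" "\<forall>(i, p)\<in>set ps. i \<in> set w \<and> (\<exists>k\<ge>1. p = chebyshev_U k)" "ps \<noteq> []"
    using wick_factor[of s w] w(2) by blast
  have "\<forall>(i, p)\<in>set ps. i \<in> I \<and> \<phi> (poly_op p (s i)) = 0" using ps(3) U w(1) by fastforce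
  thus ?thesis unfolding ps(1) using free ps(2,4) unfolding freely_independent_def by blast
qed

context tracial_state
begin

lemma trace_chebyshev_U:
  assumes T: "T \<in> A" "has_law \<phi> T (semicircle v)" and v: "0 < v" and n: "1 \<le> n"
  shows "\<phi> (poly_op (chebyshev_U n) (complex_of_real (1 / sqrt v) *\<^sub>C T)) = 0"
proof -
  let ?c = "complex_of_real (1 / sqrt v)"
  have int: "integrable (semicircle v) (\<lambda>x. x ^ k)"
    and mom: "\<phi> (T ^ k) = complex_of_real (\<integral>x. x ^ k \<partial>semicircle v)" for k
    using T(2) by (auto simp: has_law_def)
  have "\<phi> (poly_op (chebyshev_U n) (?c *\<^sub>C T)) =
      \<phi> (\<Sum>k\<le>n. (coeff (chebyshev_U n) k * ?c ^ k) *\<^sub>C T ^ k)"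
    by (simp add: poly_op_altdef[OF degree_chebyshev_U] scaleC_power scaleC_scaleC)
  also have "\<dots> = (\<Sum>k\<le>n. (coeff (chebyshev_U n) k * ?c ^ k) * \<phi> (T ^ k))"
    using T(1) by (subst trace_sum) auto
  also have "\<dots> = of_real (\<Sum>k\<le>n. \<integral>x. coeff (chebyshev_U n) k * (x / sqrt v) ^ k \<partial>semicircle v)"
    by (simp add: coeff_chebyshev_U mom power_divide)
  also have "(\<Sum>k\<le>n. \<integral>x. coeff (chebyshev_U n) k * (x / sqrt v) ^ k \<partial>semicircle v) =
      (\<integral>x. (\<Sum>k\<le>n. coeff (chebyshev_U n) k * (x / sqrt v) ^ k) \<partial>semicircle v)"
    using int by (intro Bochner_Integration.integral_sum[symmetric]) (simp add: power_divide)
  also have "\<dots> = 0"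
    using integral_chebyshev_U_semicircle[OF v n]
    by (simp add: poly_altdef_le[OF degree_chebyshev_U])
  finally show ?thesis by simp
qed

end

section \<open>Trace powers of Hermitian matrices\<close>

definition mat_trace :: "'a::comm_ring_1 Matrix.mat \<Rightarrow> 'a" where
  "mat_trace M = (\<Sum>i<dim_row M. M $$ (i, i))"

lemma mat_trace_mult_commute:
  assumes "C \<in> carrier_mat n n" "D \<in> carrier_mat n n"
  shows "mat_trace (C * D) = mat_trace (D * C)"
proof -
  have "mat_trace (C * D) = (\<Sum>i<n. \<Sum>j<n. C $$ (i, j) * D $$ (j, i))"
    using assms by (auto simp: mat_trace_def scalar_prod_def atLeast0LessThan intro!: sum.cong)
  also have "\<dots> = (\<Sum>j<n. \<Sum>i<n. C $$ (i, j) * D $$ (j, i))" by (rule sum.swap)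
  also have "\<dots> = mat_trace (D * C)"
    using assms by (auto simp: mat_trace_def scalar_prod_def atLeast0LessThan mult.commute intro!: sum.cong)
  finally show ?thesis .
qed

text \<open>In the sum for the entry \<open>(i, j)\<close>, indices \<open>l < i\<close> vanish by
  the induction hypothesis and indices \<open>l > i\<close> by triangularity of \<open>B\<close>,
  because \<open>j \<le> i < l\<close>. Only \<open>l = i\<close> survives.\<close>

lemma upper_triangular_power:
  fixes B :: "'a::comm_ring_1 Matrix.mat"
  assumes B: "B \<in> carrier_mat n n" "upper_triangular B"
  shows "i < n \<Longrightarrow> j < n \<Longrightarrow> j \<le> i \<Longrightarrow> (B ^\<^sub>m k) $$ (i, j) = (if i = j then (B $$ (i, i)) ^ k else 0)"
proof (induction k arbitrary: i j)
  case 0 thus ?case using B by auto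
next
  case (Suc k)
  have Bk: "B ^\<^sub>m k \<in> carrier_mat n n" using B by (intro pow_carrier_mat)
  have "(B ^\<^sub>m Suc k) $$ (i, j) = (\<Sum>l<n. (B ^\<^sub>m k) $$ (i, l) * B $$ (l, j))"
    using Suc.prems B Bk by (simp add: scalar_prod_def atLeast0LessThan)
  also have "\<dots> = (\<Sum>l<n. if l = i then (B $$ (i, i)) ^ k * B $$ (i, j) else 0)"
  proof (intro sum.cong refl)
    fix l assume l: "l \<in> {..<n}"
    show "(B ^\<^sub>m k) $$ (i, l) * B $$ (l, j) = (if l = i then (B $$ (i, i)) ^ k * B $$ (i, j) else 0)"
    proof (cases "l \<le> i")
      case True thus ?thesis using Suc.IH[of i l] Suc.prems l by auto
    next
      case False
      hence "B $$ (l, j) = 0" using B l Suc.prems by (intro upper_triangularD) auto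
      thus ?thesis using False by auto
    qed
  qed
  also have "\<dots> = (B $$ (i, i)) ^ k * B $$ (i, j)" using Suc.prems by simp
  also have "\<dots> = (if i = j then (B $$ (i, i)) ^ Suc k else 0)"
    using B Suc.prems upper_triangularD[of B j i] by (auto simp: mult.commute)
  finally show ?case .
qed

lemma hermitian_eigenvalue_real:
  assumes M: "M \<in> carrier_mat n n" and herm: "\<And>i j. i < n \<Longrightarrow> j < n \<Longrightarrow> M $$ (j, i) = cnj (M $$ (i, j))"
    and ev: "eigenvalue M k"
  shows "k \<in> \<real>"
proof -
  obtain v where v: "v \<in> carrier_vec n" "v \<noteq> 0\<^sub>v n" "M *\<^sub>v v = k \<cdot>\<^sub>v v"
    using ev M by (auto simp: eigenvalue_def eigenvector_def)
  let ?v = "\<lambda>i. vec_index v i"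
  \<comment> \<open>The Hermitian form at the eigenvector \<open>v\<close>: it is real by symmetry
    of \<open>M\<close>, and it equals \<open>k\<close> times the squared length \<open>m\<close> of
    \<open>v\<close>.\<close>
  define q where "q = (\<Sum>i<n. \<Sum>j<n. cnj (?v i) * M $$ (i, j) * ?v j)"
  define m where "m = (\<Sum>i<n. cnj (?v i) * ?v i)"
  have row: "(\<Sum>j<n. M $$ (i, j) * ?v j) = k * ?v i" if "i < n" for i
  proof -
    have "vec_index (M *\<^sub>v v) i = (\<Sum>j<n. M $$ (i, j) * ?v j)"
      using that M v(1) by (simp add: scalar_prod_def atLeast0LessThan)
    thus ?thesis using v that by simp
  qed
  have "q = (\<Sum>i<n. cnj (?v i) * (\<Sum>j<n. M $$ (i, j) * ?v j))"
    by (simp add: q_def sum_distrib_left mult.assoc)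
  also have "\<dots> = (\<Sum>i<n. cnj (?v i) * (k * ?v i))"
    using row by (intro sum.cong refl arg_cong2[where f = "(*)"]) simp_all
  also have "\<dots> = k * m"
    by (simp add: m_def sum_distrib_left mult_ac)
  finally have q: "q = k * m" .
  have "cnj q = (\<Sum>i<n. \<Sum>j<n. cnj (?v j) * M $$ (j, i) * ?v i)"
    unfolding q_def cnj_sum
  proof (intro sum.cong refl)
    fix i j assume "i \<in> {..<n}" "j \<in> {..<n}"
    thus "cnj (cnj (?v i) * M $$ (i, j) * ?v j) = cnj (?v j) * M $$ (j, i) * ?v i"
      using herm[of i j] by simp
  qed
  also have "\<dots> = q" unfolding q_def by (rule sum.swap)
  finally have "cnj q = q" .
  moreover have m: "m = of_real (\<Sum>i<n. (cmod (?v i))\<^sup>2)"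
    unfolding m_def of_real_sum by (intro sum.cong refl) (simp only: complex_norm_square mult.commute)
  ultimately have "cnj k * m = k * m" using q by (simp add: m_def mult.commute)
  moreover have "m \<noteq> 0"
  proof
    assume "m = 0"
    hence "(\<Sum>i<n. (cmod (?v i))\<^sup>2) = 0" unfolding m of_real_eq_0_iff .
    hence "\<forall>i<n. ?v i = 0" by (subst (asm) sum_nonneg_eq_0_iff) auto
    thus False using v by (auto intro!: eq_vecI)
  qed
  ultimately show ?thesis by (simp add: Reals_cnj_iff)
qed

text \<open>Triangularization suffices: the trace of a power of \<open>B\<close> sees only the
  diagonal of \<open>B\<close>, and the diagonal entries are eigenvalues of \<open>M\<close>, hence
  real.\<close>

lemma hermitian_trace_powers:
  assumes M: "M \<in> carrier_mat n n" and herm: "\<And>i j. i < n \<Longrightarrow> j < n \<Longrightarrow> M $$ (j, i) = cnj (M $$ (i, j))"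
  shows "\<exists>x :: nat \<Rightarrow> real. \<forall>k. mat_trace (M ^\<^sub>m k) = of_real (\<Sum>i<n. x i ^ k)"
proof -
  obtain as where "char_poly M = (\<Prod>a\<leftarrow>as. [:- a, 1:])" using char_poly_factorized[OF M] by blast
  from schur_decomposition_exists[OF M this] obtain B P Q where
    B: "B \<in> carrier_mat n n" "upper_triangular B" and wit: "similar_mat_wit M B P Q"
    unfolding similar_mat_def by blast
  note w = similar_mat_witD2[OF M wit]
  have sim: "similar_mat M B" using wit unfolding similar_mat_def by blast
  have real: "B $$ (i, i) \<in> \<real>" if "i < n" for i
  proof (rule hermitian_eigenvalue_real[OF M herm])
    have "B $$ (i, i) \<in> set (diag_mat B)" using B that by (auto simp: diag_mat_def)
    hence "poly (char_poly M) (B $$ (i, i)) = 0"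
      unfolding char_poly_similar[OF sim]
        char_poly_upper_triangular[OF B]
      by (auto simp: poly_prod_list prod_list_zero_iff image_iff)
    thus "eigenvalue M (B $$ (i, i))" by (simp add: eigenvalue_root_char_poly[OF M])
  qed
  have "mat_trace (M ^\<^sub>m k) = of_real (\<Sum>i<n. Re (B $$ (i, i)) ^ k)" for k
  proof -
    have Bk: "B ^\<^sub>m k \<in> carrier_mat n n" using B by (intro pow_carrier_mat)
    have "mat_trace (M ^\<^sub>m k) = mat_trace (P * (B ^\<^sub>m k) * Q)"
      by (simp add: similar_mat_wit_pow_id[OF wit])
    also have "\<dots> = mat_trace (Q * (P * (B ^\<^sub>m k)))"
      using w Bk by (intro mat_trace_mult_commute) auto
    also have "Q * (P * (B ^\<^sub>m k)) = B ^\<^sub>m k"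
      using w Bk by (simp add: assoc_mult_mat[of Q n n P n "B ^\<^sub>m k" n, symmetric])
    also have "mat_trace (B ^\<^sub>m k) = (\<Sum>i<n. (B $$ (i, i)) ^ k)"
      using Bk upper_triangular_power[OF B] by (auto simp: mat_trace_def intro!: sum.cong)
    also have "\<dots> = (\<Sum>i<n. of_real (Re (B $$ (i, i)) ^ k))"
      using real by (intro sum.cong refl) (metis lessThan_iff of_real_Re of_real_power)
    finally show ?thesis by simp
  qed
  thus ?thesis by (intro exI[of _ "\<lambda>i. Re (B $$ (i, i))"]) simp
qed

section \<open>Limits of power sums\<close>

text \<open>With \<open>r\<close> the sum of the other squares, every other absolute value is at
  most \<open>sqrt r\<close>. The other absolute cubes thus sum to at most
  \<open>sqrt r * r\<close>.\<close>

lemma abs_cube_le_power_sums: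
  fixes x :: "nat \<Rightarrow> real"
  assumes i: "i < N"
  shows "(x i)\<^sup>2 \<le> (\<Sum>j<N. (x j)\<^sup>2)"
    and "\<bar>x i\<bar> ^ 3 \<le> \<bar>\<Sum>j<N. x j ^ 3\<bar> + sqrt ((\<Sum>j<N. (x j)\<^sup>2) - (x i)\<^sup>2) ^ 3"
proof -
  define r where "r = (\<Sum>j\<in>{..<N} - {i}. (x j)\<^sup>2)"
  have r: "(\<Sum>j<N. (x j)\<^sup>2) = (x i)\<^sup>2 + r"
    unfolding r_def using i by (subst sum.remove[of _ i]) auto
  have r0: "0 \<le> r" unfolding r_def by (intro sum_nonneg) auto
  show "(x i)\<^sup>2 \<le> (\<Sum>j<N. (x j)\<^sup>2)" using r r0 by simp
  have "\<bar>\<Sum>j\<in>{..<N} - {i}. x j ^ 3\<bar> \<le> (\<Sum>j\<in>{..<N} - {i}. \<bar>x j ^ 3\<bar>)" by (rule sum_abs)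
  also have "\<dots> \<le> (\<Sum>j\<in>{..<N} - {i}. sqrt r * (x j)\<^sup>2)"
  proof (rule sum_mono)
    fix j assume j: "j \<in> {..<N} - {i}"
    have "(x j)\<^sup>2 \<le> r" unfolding r_def using j by (intro member_le_sum) auto
    hence "\<bar>x j\<bar> \<le> sqrt r" by (rule real_le_rsqrt[of "\<bar>x j\<bar>", simplified])
    hence "\<bar>x j\<bar> * (x j)\<^sup>2 \<le> sqrt r * (x j)\<^sup>2" by (intro mult_right_mono) auto
    thus "\<bar>x j ^ 3\<bar> \<le> sqrt r * (x j)\<^sup>2" by (simp add: power3_eq_cube power2_eq_square abs_mult mult.assoc)
  qed
  also have "\<dots> = sqrt r * (sqrt r)\<^sup>2" using r0 by (simp add: r_def sum_distrib_left)
  also have "\<dots> = sqrt r ^ 3" by (simp add: power3_eq_cube power2_eq_square)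
  finally have 1: "\<bar>\<Sum>j\<in>{..<N} - {i}. x j ^ 3\<bar> \<le> sqrt r ^ 3" .
  have "(\<Sum>j<N. x j ^ 3) = x i ^ 3 + (\<Sum>j\<in>{..<N} - {i}. x j ^ 3)"
    using i by (subst sum.remove[of _ i]) auto
  hence "\<bar>x i ^ 3\<bar> \<le> \<bar>\<Sum>j<N. x j ^ 3\<bar> + sqrt r ^ 3" using 1 by linarith
  thus "\<bar>x i\<bar> ^ 3 \<le> \<bar>\<Sum>j<N. x j ^ 3\<bar> + sqrt ((\<Sum>j<N. (x j)\<^sup>2) - (x i)\<^sup>2) ^ 3"
    unfolding r by (simp add: power_abs)
qed

text \<open>In the application \<open>x n\<close> lists the eigenvalues of the \<open>n\<close>-th
  approximating matrix and \<open>t k\<close> is the \<open>k\<close>-th free cumulant of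
  \<open>F\<close>. Only the power sums converge; nothing is claimed about the individual
  points.\<close>

locale power_sum_limits =
  fixes x :: "nat \<Rightarrow> nat \<Rightarrow> real" and N :: "nat \<Rightarrow> nat" and t :: "nat \<Rightarrow> real"
  assumes lim: "2 \<le> k \<Longrightarrow> (\<lambda>n. \<Sum>i<N n. x n i ^ k) \<longlonglongrightarrow> t k"
begin

lemma even_nonneg: "1 \<le> k \<Longrightarrow> 0 \<le> t (2 * k)"
  by (rule LIMSEQ_le_const[OF lim[of "2 * k"]]) (auto intro!: sum_nonneg simp: power_mult)

text \<open>
  If the cubes cancel, one square cannot exceed half of their sum: the cubes of the other points
  would be too small to compensate.
\<close>

lemma eventually_square_le:
  assumes t3: "t 3 = 0" and d: "0 < d"
  shows "\<forall>\<^sub>F n in sequentially. \<forall>i<N n. (x n i)\<^sup>2 \<le> t 2 / 2 + d"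
proof -
  \<comment> \<open>If some square exceeds \<open>b\<close> squared, the remaining squares sum to at
    most \<open>a\<close> squared. The gap between \<open>b ^ 3\<close> and \<open>a ^ 3\<close> is
    the tolerance for a sum of cubes that vanishes only in the limit.\<close>
  define a b where "a = sqrt (t 2 / 2)" and "b = sqrt (t 2 / 2 + d)"
  have t2: "0 \<le> t 2" using even_nonneg[of 1] by simp
  have ab: "0 \<le> a" "a < b" using t2 d by (auto simp: a_def b_def)
  hence "a ^ 3 < b ^ 3" by (intro power_strict_mono) auto
  hence "\<forall>\<^sub>F n in sequentially. dist (\<Sum>i<N n. x n i ^ 3) (t 3) < b ^ 3 - a ^ 3"
    using tendstoD[OF lim[of 3]] by simp
  moreover have "\<forall>\<^sub>F n in sequentially. dist (\<Sum>i<N n. x n i ^ 2) (t 2) < d"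
    using tendstoD[OF lim[of 2] d] by simp
  ultimately show ?thesis
  proof eventually_elim
    case (elim n)
    show ?case
    proof (intro allI impI, rule ccontr)
      fix i assume i: "i < N n" and neg: "\<not> (x n i)\<^sup>2 \<le> t 2 / 2 + d"
      have "(\<Sum>j<N n. (x n j)\<^sup>2) - (x n i)\<^sup>2 \<le> t 2 / 2"
        using elim(2) neg by (simp add: dist_real_def)
      hence "sqrt ((\<Sum>j<N n. (x n j)\<^sup>2) - (x n i)\<^sup>2) \<le> a" by (simp add: a_def)
      hence "sqrt ((\<Sum>j<N n. (x n j)\<^sup>2) - (x n i)\<^sup>2) ^ 3 \<le> a ^ 3"
        using abs_cube_le_power_sums(1)[OF i, of "x n"] by (intro power_mono) auto
      moreover have "b < \<bar>x n i\<bar>"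
        unfolding b_def using neg t2 d by (intro real_less_lsqrt) auto
      hence "b ^ 3 < \<bar>x n i\<bar> ^ 3" using ab by (intro power_strict_mono) auto
      moreover have "\<bar>\<Sum>j<N n. x n j ^ 3\<bar> < b ^ 3 - a ^ 3" using elim(1) t3 by simp
      ultimately show False using abs_cube_le_power_sums(2)[OF i, of "x n"] by linarith
    qed
  qed
qed

lemma even_step:
  assumes t3: "t 3 = 0" and k: "1 \<le> k"
  shows "t (2 * Suc k) \<le> t 2 / 2 * t (2 * k)"
proof (rule field_le_epsilon)
  fix e :: real assume e: "0 < e"
  define T where "T = t (2 * k)"
  have T: "0 \<le> T" using even_nonneg[OF k] by (simp add: T_def)
  \<comment> \<open>Chosen so that the error \<open>d * T\<close> stays below \<open>e\<close>; the
    summand \<open>1\<close> admits \<open>T = 0\<close>.\<close>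
  define d where "d = e / (T + 1)"
  have d: "0 < d" "d * T \<le> e" using e T by (auto simp: d_def field_simps)
  have "\<forall>\<^sub>F n in sequentially. (\<Sum>i<N n. x n i ^ (2 * Suc k)) \<le> (t 2 / 2 + d) * (\<Sum>i<N n. x n i ^ (2 * k))"
    using eventually_square_le[OF t3 d(1)]
  proof eventually_elim
    case (elim n)
    have "x n i ^ (2 * Suc k) \<le> (t 2 / 2 + d) * x n i ^ (2 * k)" if "i < N n" for i
    proof -
      have "(x n i)\<^sup>2 * x n i ^ (2 * k) \<le> (t 2 / 2 + d) * x n i ^ (2 * k)"
        using elim that by (intro mult_right_mono) (auto simp: power_mult)
      thus ?thesis by (simp add: power_add power2_eq_square mult.assoc)
    qed
    thus ?case unfolding sum_distrib_left by (intro sum_mono) auto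
  qed
  hence "t (2 * Suc k) \<le> (t 2 / 2 + d) * T"
    unfolding T_def using k
    by (intro tendsto_le[OF _ tendsto_mult[OF tendsto_const lim[of "2 * k"]] lim[of "2 * Suc k"]]) auto
  also have "\<dots> \<le> t 2 / 2 * T + e" using d by (simp add: distrib_right)
  finally show "t (2 * Suc k) \<le> t 2 / 2 * t (2 * k) + e" by (simp add: T_def)
qed

text \<open>Expanding the nonnegative square around 1 / 2 gives a lower bound by two preceding
  terms. It is attained by \<open>2 * (1 / 2) ^ k\<close>, so two consecutive tetilla values force
  the next one from below.\<close>

lemma even_convex:
  assumes k: "1 \<le> k"
  shows "t (2 * Suc k) - t (2 * k) / 4 \<le> t (2 * Suc (Suc k))"
proof -
  have "(\<Sum>i<N n. x n i ^ (2 * Suc k)) - (\<Sum>i<N n. x n i ^ (2 * k)) / 4 \<le> (\<Sum>i<N n. x n i ^ (2 * Suc (Suc k)))" for n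
  proof -
    have "y ^ (2 * Suc k) - y ^ (2 * k) / 4 \<le> y ^ (2 * Suc (Suc k))" for y :: real
    proof -
      have "0 \<le> y ^ (2 * k) * (y\<^sup>2 - 1 / 2)\<^sup>2" by (simp add: power_mult)
      also have "\<dots> = y ^ (2 * Suc (Suc k)) - (y ^ (2 * Suc k) - y ^ (2 * k) / 4)"
        by (simp add: power2_eq_square algebra_simps)
      finally show ?thesis by simp
    qed
    thus ?thesis unfolding sum_divide_distrib sum_subtractf[symmetric] by (intro sum_mono)
  qed
  thus ?thesis using k
    by (intro LIMSEQ_le[OF tendsto_diff[OF lim tendsto_divide[OF lim tendsto_const]] lim]) auto
qed

text \<open>The right-hand side is the sum of the \<open>2 * r\<close>-th powers of 1 / sqrt 2 and -
  1 / sqrt 2; each application of \<open>even_step\<close> costs a factor of at most 1 / 2.\<close>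

lemma even_le:
  assumes t3: "t 3 = 0" and t2: "t 2 \<le> 1" and r: "1 \<le> r"
  shows "t (2 * r) \<le> 2 * (1 / 2) ^ r"
  using r
proof (induction r rule: dec_induct)
  case (step r)
  have "t (2 * Suc r) \<le> t 2 / 2 * t (2 * r)" using step by (intro even_step t3) auto
  also have "\<dots> \<le> 1 / 2 * (2 * (1 / 2) ^ r)"
    using step t2 even_nonneg[of r] even_nonneg[of 1] by (intro mult_mono) auto
  finally show ?case by simp
qed (use t2 in simp)

text \<open>Equality spreads downwards from \<open>r\<close>, because by \<open>even_step\<close> a
  deficit at a smaller index would persist up to \<open>r\<close>. It spreads upwards by
  \<open>even_convex\<close>, which starts from two consecutive values; with
  \<open>2 \<le> r\<close> the downward part supplies the indices 1 and 2.\<close>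

lemma even_eq:
  assumes t3: "t 3 = 0" and t2: "t 2 \<le> 1" and r: "2 \<le> r" and eq: "t (2 * r) = 2 * (1 / 2) ^ r"
    and k: "1 \<le> k"
  shows "t (2 * k) = 2 * (1 / 2) ^ k"
proof -
  have below: "t (2 * k) = 2 * (1 / 2) ^ k" if "1 \<le> k" "k \<le> r" for k
    using that(2,1)
  proof (induction k rule: inc_induct)
    case (step k)
    have "2 * (1 / 2) ^ Suc k \<le> t 2 / 2 * t (2 * k)"
      using step even_step[OF t3, of k] by simp
    also have "\<dots> \<le> 1 / 2 * t (2 * k)"
      using step t2 even_nonneg[of k] by (intro mult_right_mono) auto
    finally show ?case using even_le[OF t3 t2, of k] step by simp
  qed (use eq in simp)
  have "t (2 * k) = 2 * (1 / 2) ^ k \<and> t (2 * Suc k) = 2 * (1 / 2) ^ Suc k"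
    using k
  proof (induction k rule: dec_induct)
    case base
    show ?case using below[of 1] below[of 2] r by (simp add: power2_eq_square)
  next
    case (step k)
    have "t (2 * Suc k) - t (2 * k) / 4 \<le> t (2 * Suc (Suc k))" using step by (intro even_convex) auto
    thus ?case using step even_le[OF t3 t2, of "Suc (Suc k)"] by simp
  qed
  thus ?thesis by simp
qed

end

section \<open>Quadratic forms in semicircular elements\<close>

text \<open>The recursion of \<open>wick\<close> solved for the product: \<open>s i\<close> creates
  the letter \<open>i\<close> or annihilates an equal leading letter.\<close>

lemma mult_wick: "s i * wick s (j # v) = wick s (i # j # v) + (if i = j then wick s v else 0)"
  by simp

text \<open>A Cauchy product with a delay of one: in terms of generating functions, z f(z) g(z). The
  delay is the factor that annihilates the letter.\<close>

definition delayed_conv :: "(nat \<Rightarrow> 'a::comm_ring_1) \<Rightarrow> (nat \<Rightarrow> 'a) \<Rightarrow> nat \<Rightarrow> 'a" where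
  "delayed_conv f g n = (\<Sum>a<n. f (n - 1 - a) * g a)"

lemma delayed_conv_fps:
  "delayed_conv f g = fps_nth (fps_X * (Abs_fps f * Abs_fps g))"
proof
  fix n
  show "delayed_conv f g n = fps_nth (fps_X * (Abs_fps f * Abs_fps g)) n"
  proof (cases n)
    case (Suc k)
    have "(\<Sum>a\<le>k. f (k - a) * g a) = (\<Sum>a\<le>k. f a * g (k - a))"
      by (rule sum.reindex_bij_witness[where i = "\<lambda>a. k - a" and j = "\<lambda>a. k - a"]) auto
    moreover have "fps_nth (fps_X * (Abs_fps f * Abs_fps g)) n = fps_nth (Abs_fps f * Abs_fps g) k"
      unfolding fps_X_mult_nth by (simp add: Suc)
    ultimately show ?thesis
      by (simp add: Suc delayed_conv_def fps_mult_nth[of "Abs_fps f"] atLeast0AtMost lessThan_Suc_atMost)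
  qed (simp add: delayed_conv_def)
qed

text \<open>Both sides are the coefficients of \<open>fps_X\<close> squared times the product of the
  three series.\<close>

lemma delayed_conv_assoc: "delayed_conv f (delayed_conv g c) = delayed_conv (delayed_conv f g) c"
  by (simp add: delayed_conv_fps fps_nth_inverse mult_ac)

lemma delayed_conv_cong:
  "(\<And>a. a < n \<Longrightarrow> f a = f' a) \<Longrightarrow> (\<And>a. a < n \<Longrightarrow> g a = g' a) \<Longrightarrow> delayed_conv f g n = delayed_conv f' g' n"
  by (auto simp: delayed_conv_def intro!: sum.cong)

lemma delayed_conv_sum_right:
  "delayed_conv f (\<lambda>a. \<Sum>i\<in>I. g i a) n = (\<Sum>i\<in>I. delayed_conv f (g i) n)"
  unfolding delayed_conv_def sum_distrib_left by (rule sum.swap)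

lemma delayed_conv_sum_left:
  "delayed_conv (\<lambda>a. \<Sum>i\<in>I. g i a) f n = (\<Sum>i\<in>I. delayed_conv (g i) f n)"
  unfolding delayed_conv_def sum_distrib_right by (rule sum.swap)

lemma delayed_conv_mult_right:
  "delayed_conv f (\<lambda>a. x * g a) n = x * delayed_conv f g n"
  unfolding delayed_conv_def by (simp add: sum_distrib_left mult_ac)

lemma delayed_conv_add_left:
  "delayed_conv (\<lambda>a. g a + h a) f n = delayed_conv g f n + delayed_conv h f n"
  unfolding delayed_conv_def by (simp add: sum.distrib distrib_right)

lemma delayed_conv_mult_left:
  "delayed_conv (\<lambda>a. x * g a) f n = x * delayed_conv g f n"
  unfolding delayed_conv_def by (simp add: sum_distrib_left mult_ac)

lemma delayed_conv_Suc:
  "delayed_conv f g (Suc n) = delayed_conv (\<lambda>a. f (Suc a)) g n + f 0 * g n"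
  unfolding delayed_conv_def by (auto simp: Suc_diff_Suc intro!: sum.cong)

text \<open>No constant is subtracted from the squares, so the first cumulant of the form is the
  trace of \<open>M\<close>, in line with all the others.\<close>

definition quadratic_form ::
    "(nat \<Rightarrow> 'h::complex_hilbert_space operator) \<Rightarrow> nat \<Rightarrow> complex Matrix.mat \<Rightarrow> 'h operator" where
  "quadratic_form s N M = (\<Sum>i<N. \<Sum>j<N. M $$ (i, j) *\<^sub>C (s i * s j))"

lemma sum_delta_mult:
  fixes f :: "nat \<Rightarrow> 'a::comm_ring_1"
  shows "k < N \<Longrightarrow> (\<Sum>j<N. f j * (if j = k then x else 0)) = f k * x"
  by (subst sum.remove[of _ k]) auto

text \<open>Freeness and the semicircle laws enter only as the vanishing trace of nonempty Wick
  words; with \<open>mult_wick\<close> it determines every joint moment of the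
  \<open>s i\<close>.\<close>

locale semicircular_form = tracial_state A \<phi>
  for A :: "'h::complex_hilbert_space operator set" and \<phi> +
  fixes s :: "nat \<Rightarrow> 'h operator" and N :: nat and M :: "complex Matrix.mat"
  assumes s_in [simp, intro]: "i < N \<Longrightarrow> s i \<in> A"
    and trace_wick: "set w \<subseteq> {..<N} \<Longrightarrow> w \<noteq> [] \<Longrightarrow> \<phi> (wick s w) = 0"
    and M_carrier: "M \<in> carrier_mat N N"
begin

abbreviation "X \<equiv> quadratic_form s N M"

text \<open>On the Fock space this is the weight of the paths that lead from the word
  \<open>v\<close> to the vacuum in \<open>n\<close> steps of \<open>X\<close>.\<close>

definition E :: "nat \<Rightarrow> nat list \<Rightarrow> complex" where
  "E n v = \<phi> (X ^ n * wick s v)"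

text \<open>A step of \<open>X\<close> consists of two half steps, one for each factor of
  \<open>s i * s j\<close>. Here \<open>n\<close> full steps follow the half step
  \<open>s i\<close>.\<close>

definition G :: "nat \<Rightarrow> nat \<Rightarrow> nat list \<Rightarrow> complex" where
  "G n i v = \<phi> (X ^ n * (s i * wick s v))"

lemma wick_in [simp, intro]: "set w \<subseteq> {..<N} \<Longrightarrow> wick s w \<in> A"
  by (induction w rule: induct_list012) auto

lemma X_in [simp, intro]: "X \<in> A"
  unfolding quadratic_form_def by (intro sum_in scaleC_in mult_in s_in) simp_all

lemma trace_sum2:
  "(\<And>i j. i < K \<Longrightarrow> j < L \<Longrightarrow> f i j \<in> A) \<Longrightarrow>
    \<phi> (\<Sum>i<K. \<Sum>j<L. f i j) = (\<Sum>i<(K::nat). \<Sum>j<(L::nat). \<phi> (f i j))"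
  by (subst trace_sum) (auto intro!: sum_in sum.cong trace_sum)

lemma G_Cons:
  assumes "i < N" "j < N" "set v \<subseteq> {..<N}"
  shows "G n i (j # v) = E n (i # j # v) + (if i = j then 1 else 0) * E n v"
proof -
  have "X ^ n * (s i * wick s (j # v)) =
      X ^ n * wick s (i # j # v) + (if i = j then X ^ n * wick s v else 0)"
    by (simp only: mult_wick distrib_left) simp
  moreover have "wick s (i # j # v) \<in> A" "wick s v \<in> A" using assms by (auto intro!: wick_in simp del: wick.simps)
  ultimately show ?thesis by (simp add: G_def E_def del: wick.simps)
qed

lemma E_Suc:
  assumes "set v \<subseteq> {..<N}"
  shows "E (Suc n) v = (\<Sum>i<N. \<Sum>j<N. M $$ (i, j) * \<phi> (X ^ n * (s i * (s j * wick s v))))"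
proof -
  have "X ^ Suc n * wick s v = X ^ n * (X * wick s v)"
    by (simp add: power_Suc2 mult.assoc del: power_Suc)
  also have "X * wick s v = (\<Sum>i<N. \<Sum>j<N. M $$ (i, j) *\<^sub>C (s i * (s j * wick s v)))"
    unfolding quadratic_form_def by (simp add: sum_distrib_right mult.assoc)
  finally have "E (Suc n) v = \<phi> (\<Sum>i<N. \<Sum>j<N. M $$ (i, j) *\<^sub>C (X ^ n * (s i * (s j * wick s v))))"
    by (simp add: E_def sum_distrib_left)
  also have "\<dots> = (\<Sum>i<N. \<Sum>j<N. M $$ (i, j) * \<phi> (X ^ n * (s i * (s j * wick s v))))"
    using assms by (subst trace_sum2) auto
  finally show ?thesis .
qed

text \<open>The factor \<open>s j\<close> acts first: it either creates \<open>j\<close> in front of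
  \<open>k\<close> or, for \<open>j = k\<close>, annihilates \<open>k\<close>. These are the two
  sums.\<close>

lemma E_Suc_Cons:
  assumes k: "k < N" and u: "set u \<subseteq> {..<N}"
  shows "E (Suc n) (k # u) =
    (\<Sum>i<N. \<Sum>j<N. M $$ (i, j) * G n i (j # k # u)) + (\<Sum>i<N. M $$ (i, k) * G n i u)"
proof -
  have *: "\<phi> (X ^ n * (s i * (s j * wick s (k # u)))) = G n i (j # k # u) + G n i u * (if j = k then 1 else 0)"
    if "i < N" "j < N" for i j
  proof -
    have in': "wick s (j # k # u) \<in> A" "wick s u \<in> A"
      using that k u by (auto intro!: wick_in simp del: wick.simps)
    have "X ^ n * (s i * (s j * wick s (k # u))) =
      X ^ n * (s i * wick s (j # k # u)) + (if j = k then X ^ n * (s i * wick s u) else 0)"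
      by (simp only: mult_wick distrib_left) simp
    thus ?thesis using in' that by (simp add: G_def del: wick.simps)
  qed
  have "E (Suc n) (k # u) = (\<Sum>i<N. \<Sum>j<N. M $$ (i, j) *
      (G n i (j # k # u) + G n i u * (if j = k then 1 else 0)))"
    using k u by (subst E_Suc, simp) (intro sum.cong refl arg_cong2[where f = "(*)"] *, simp_all)
  also have "\<dots> = (\<Sum>i<N. (\<Sum>j<N. M $$ (i, j) * G n i (j # k # u)) +
      (\<Sum>j<N. M $$ (i, j) * G n i u * (if j = k then 1 else 0)))"
    by (simp only: distrib_left sum.distrib mult.assoc)
  also have "\<dots> = (\<Sum>i<N. (\<Sum>j<N. M $$ (i, j) * G n i (j # k # u)) + M $$ (i, k) * G n i u)"
    using k by (intro sum.cong refl arg_cong2[of _ _ _ _ "(+)"]) (subst sum_delta_mult, auto)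
  finally show ?thesis by (simp add: sum.distrib)
qed

lemma E_Suc_Nil: "E (Suc n) [] = (\<Sum>i<N. \<Sum>j<N. M $$ (i, j) * G n i [j])"
  by (subst E_Suc) (simp_all add: G_def)

text \<open>
  Reading \<open>X ^ n\<close> from the right as a path in the full Fock space: \<open>n - 1 - a\<close> counts the
  factors applied before the letter \<open>k\<close> is annihilated.
\<close>

lemma first_passage:
  assumes "k < N" "set u \<subseteq> {..<N}"
  shows "E n (k # u) = delayed_conv (\<lambda>a. E a []) (\<lambda>a. \<Sum>i<N. M $$ (i, k) * G a i u) n"
  using assms
proof (induction n arbitrary: k u rule: less_induct)
  case (less n)
  define c where "c = (\<lambda>a. \<Sum>i<N. M $$ (i, k) * G a i u)"
  define e where "e = (\<lambda>a. E a [])"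
  note IH = less.IH and ku = less.prems
  \<comment> \<open>Until \<open>k\<close> is annihilated the tail \<open>k # u\<close> is inert, so
    the part of the path before that moment has the weight of a path from the word
    \<open>[j]\<close>. The inner induction on \<open>q < n\<close> uses the outer hypothesis only
    below \<open>n\<close>.\<close>
  have two: "G q i (j # k # u) = delayed_conv (\<lambda>a. G a i [j]) c q" if "q < n" "i < N" "j < N" for q i j
    using that
  proof (induction q arbitrary: i rule: less_induct)
    case (less q)
    note ij = less.prems
    have "E q (i # j # k # u) = delayed_conv e (\<lambda>a. \<Sum>l<N. M $$ (l, i) * G a l (j # k # u)) q"
      unfolding e_def using ij ku by (intro IH) auto
    also have "\<dots> = delayed_conv e
        (\<lambda>a. \<Sum>l<N. M $$ (l, i) * delayed_conv (\<lambda>a. G a l [j]) c a) q"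
      using less.IH ij by (intro delayed_conv_cong refl sum.cong) auto
    also have "\<dots> = delayed_conv e (delayed_conv (\<lambda>a. \<Sum>l<N. M $$ (l, i) * G a l [j]) c) q"
      by (intro delayed_conv_cong refl) (simp only: delayed_conv_sum_left delayed_conv_mult_left)
    \<comment> \<open>Regrouping joins the removal of \<open>i\<close> to what happens before the
      removal of \<open>k\<close>; the outer hypothesis, read backwards for the word
      \<open>[i, j]\<close>, then absorbs it.\<close>
    also have "\<dots> = delayed_conv (delayed_conv e (\<lambda>a. \<Sum>l<N. M $$ (l, i) * G a l [j])) c q"
      by (simp add: delayed_conv_assoc)
    also have "\<dots> = delayed_conv (\<lambda>a. E a [i, j]) c q"
      unfolding e_def using ij by (intro delayed_conv_cong refl IH[symmetric]) auto
    finally have 1: "E q (i # j # k # u) = delayed_conv (\<lambda>a. E a [i, j]) c q" .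
    have 2: "E q (k # u) = delayed_conv e c q"
      unfolding e_def c_def using ij ku by (intro IH) auto
    have "G q i (j # k # u) = E q (i # j # k # u) + (if i = j then 1 else 0) * E q (k # u)"
      using ij ku by (intro G_Cons) auto
    also have "\<dots> = delayed_conv (\<lambda>a. E a [i, j] + (if i = j then 1 else 0) * e a) c q"
      unfolding 1 2 by (simp only: delayed_conv_add_left delayed_conv_mult_left)
    also have "\<dots> = delayed_conv (\<lambda>a. G a i [j]) c q"
      using ij by (intro delayed_conv_cong refl) (simp add: G_Cons e_def del: wick.simps)
    finally show ?case .
  qed
  show ?case
  proof (cases n)
    case 0
    have "\<phi> (wick s (k # u)) = 0" using less.prems by (intro trace_wick) auto
    thus ?thesis by (simp add: 0 E_def delayed_conv_def del: wick.simps)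
  next
    case (Suc n')
    \<comment> \<open>The summand \<open>c n'\<close> belongs to paths that annihilate
      \<open>k\<close> in their very first step. It matches the boundary term of
      \<open>delayed_conv_Suc\<close>, because \<open>e 0 = 1\<close>.\<close>
    have "E n (k # u) = (\<Sum>i<N. \<Sum>j<N. M $$ (i, j) * delayed_conv (\<lambda>a. G a i [j]) c n') + c n'"
      unfolding Suc using less.prems two Suc
      by (subst E_Suc_Cons) (auto simp: c_def intro!: sum.cong)
    also have "(\<Sum>i<N. \<Sum>j<N. M $$ (i, j) * delayed_conv (\<lambda>a. G a i [j]) c n') =
        delayed_conv (\<lambda>a. \<Sum>i<N. \<Sum>j<N. M $$ (i, j) * G a i [j]) c n'"
      by (simp only: delayed_conv_sum_left delayed_conv_mult_left)
    also have "\<dots> = delayed_conv (\<lambda>a. e (Suc a)) c n'"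
      by (intro delayed_conv_cong refl) (simp add: e_def E_Suc_Nil)
    also have "\<dots> + c n' = delayed_conv e c n"
      by (simp add: Suc delayed_conv_Suc) (simp add: e_def E_def)
    finally show ?thesis by (simp add: e_def c_def)
  qed
qed

text \<open>The weight \<open>C = M\<close> gives \<open>E (Suc n) []\<close>; higher powers of
  \<open>M\<close> are the path counterpart of the shift in \<open>nc_sum_shift\<close>.\<close>

definition R :: "complex Matrix.mat \<Rightarrow> nat \<Rightarrow> complex" where
  "R C n = (\<Sum>k<N. \<Sum>l<N. C $$ (k, l) * G n k [l])"

text \<open>An immediate contraction of \<open>k\<close> with \<open>l\<close> produces the trace of
  \<open>C\<close>. Otherwise \<open>first_passage\<close> removes \<open>k\<close> later and
  multiplies the weight matrix by \<open>M\<close> from the left.\<close>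

lemma R_rec:
  assumes C: "C \<in> carrier_mat N N"
  shows "R C n = mat_trace C * E n [] + delayed_conv (\<lambda>a. E a []) (R (M * C)) n"
proof -
  let ?e = "\<lambda>a. E a []"
  have "R C n = (\<Sum>k<N. \<Sum>l<N. C $$ (k, l) * E n [k, l]) +
      (\<Sum>k<N. \<Sum>l<N. C $$ (k, l) * E n [] * (if l = k then 1 else 0))"
    unfolding R_def sum.distrib[symmetric]
    by (intro sum.cong refl, subst G_Cons) (auto simp: algebra_simps)
  also have "(\<Sum>k<N. \<Sum>l<N. C $$ (k, l) * E n [] * (if l = k then 1 else 0)) = mat_trace C * E n []"
    using C unfolding mat_trace_def sum_distrib_right
    by (intro sum.cong) (auto simp: sum_delta_mult)
  also have "(\<Sum>k<N. \<Sum>l<N. C $$ (k, l) * E n [k, l]) =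
    (\<Sum>k<N. \<Sum>l<N. C $$ (k, l) * delayed_conv ?e (\<lambda>a. \<Sum>i<N. M $$ (i, k) * G a i [l]) n)"
    by (intro sum.cong refl, subst first_passage) auto
  also have "\<dots> = delayed_conv ?e
      (\<lambda>a. \<Sum>k<N. \<Sum>l<N. C $$ (k, l) * (\<Sum>i<N. M $$ (i, k) * G a i [l])) n"
    by (simp only: delayed_conv_sum_right delayed_conv_mult_right)
  also have "\<dots> = delayed_conv ?e (R (M * C)) n"
  proof (intro delayed_conv_cong refl)
    fix a
    have "R (M * C) a = (\<Sum>i<N. \<Sum>l<N. (\<Sum>k<N. M $$ (i, k) * C $$ (k, l)) * G a i [l])"
      using C M_carrier unfolding R_def
      by (intro sum.cong refl) (auto simp: scalar_prod_def atLeast0LessThan)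
    also have "\<dots> = (\<Sum>i<N. \<Sum>l<N. \<Sum>k<N. C $$ (k, l) * (M $$ (i, k) * G a i [l]))"
      by (simp add: sum_distrib_right sum_distrib_left mult_ac)
    also have "\<dots> = (\<Sum>l<N. \<Sum>i<N. \<Sum>k<N. C $$ (k, l) * (M $$ (i, k) * G a i [l]))"
      by (rule sum.swap)
    also have "\<dots> = (\<Sum>l<N. \<Sum>k<N. \<Sum>i<N. C $$ (k, l) * (M $$ (i, k) * G a i [l]))"
      by (intro sum.cong refl sum.swap)
    also have "\<dots> = (\<Sum>k<N. \<Sum>l<N. \<Sum>i<N. C $$ (k, l) * (M $$ (i, k) * G a i [l]))"
      by (rule sum.swap)
    finally show "(\<Sum>k<N. \<Sum>l<N. C $$ (k, l) * (\<Sum>i<N. M $$ (i, k) * G a i [l])) = R (M * C) a"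
      by (simp add: sum_distrib_left)
  qed
  finally show ?thesis by simp
qed

text \<open>For \<open>C = M ^\<^sub>m Suc a\<close> the recursion \<open>R_rec\<close> agrees term
  by term with \<open>nc_sum_shift_rec\<close>. Each recursion raises the shift, so \<open>a\<close>
  is arbitrary in the induction, and both claims are needed at smaller \<open>n\<close>.\<close>

lemma moments_nc_sum:
  defines "\<kappa> \<equiv> \<lambda>n. mat_trace (M ^\<^sub>m n)"
  shows "nc_sum \<kappa> n = E n [] \<and> (1 \<le> n \<longrightarrow> nc_sum_shift \<kappa> a n = R (M ^\<^sub>m Suc a) (n - 1))"
proof (induction n arbitrary: a rule: less_induct)
  case (less n)
  have car: "M ^\<^sub>m k \<in> carrier_mat N N" for k using M_carrier by (rule pow_carrier_mat)
  \<comment> \<open>Matrix powers unfold by multiplication on the right, whereas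
    \<open>R_rec\<close> multiplies on the left.\<close>
  have comm: "M * M ^\<^sub>m k = M ^\<^sub>m Suc k" for k
  proof (induction k)
    case (Suc k)
    have "M * M ^\<^sub>m Suc k = M * M ^\<^sub>m k * M"
      using M_carrier car[of k] by (simp add: assoc_mult_mat[of _ N N _ N _ N])
    thus ?case using Suc by simp
  qed (use M_carrier in simp)
  have shift: "nc_sum_shift \<kappa> a n = R (M ^\<^sub>m Suc a) (n - 1)" if n: "1 \<le> n" for a
  proof -
    obtain n' where n': "n = Suc n'" using n by (cases n) auto
    have "nc_sum_shift \<kappa> a n = \<kappa> (Suc a) * nc_sum \<kappa> (n - 1) +
      (\<Sum>p\<in>{1..<n}. nc_sum_shift \<kappa> (Suc a) p * nc_sum \<kappa> (n - 1 - p))"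
      by (rule nc_sum_shift_rec[OF n])
    also have "(\<Sum>p\<in>{1..<n}. nc_sum_shift \<kappa> (Suc a) p * nc_sum \<kappa> (n - 1 - p)) =
        (\<Sum>p\<in>{1..<n}. R (M ^\<^sub>m Suc (Suc a)) (p - 1) * E (n - 1 - p) [])"
      using less.IH by (intro sum.cong refl) (auto simp del: pow_mat.simps)
    also have "\<dots> = (\<Sum>p<n'. R (M ^\<^sub>m Suc (Suc a)) p * E (n' - 1 - p) [])"
      by (rule sum.reindex_bij_witness[where i = Suc and j = "\<lambda>p. p - 1"]) (auto simp: n' simp del: pow_mat.simps)
    also have "\<dots> = delayed_conv (\<lambda>a. E a []) (R (M * M ^\<^sub>m Suc a)) n'"
      unfolding comm delayed_conv_def by (simp add: mult.commute del: pow_mat.simps)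
    also have "\<kappa> (Suc a) * nc_sum \<kappa> (n - 1) = mat_trace (M ^\<^sub>m Suc a) * E n' []"
      using less.IH[of n'] n' unfolding \<kappa>_def by (simp del: pow_mat.simps)
    finally show ?thesis unfolding n' by (simp only: R_rec[OF car] diff_Suc_1)
  qed
  have "nc_sum \<kappa> n = E n []"
  proof (cases n)
    case 0
    then show ?thesis by (simp add: nc_sum_0 E_def)
  next
    case (Suc n')
    have "M ^\<^sub>m Suc 0 = M" using M_carrier by simp
    thus ?thesis using shift[of 0] Suc by (simp add: nc_sum_shift_0 E_Suc_Nil R_def del: pow_mat.simps)
  qed
  thus ?case using shift by blast
qed

theorem free_cumulant_quadratic_form:
  "free_cumulant \<phi> X = (\<lambda>n. if n = 0 then 0 else mat_trace (M ^\<^sub>m n))" (is "_ = ?\<kappa>")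
proof -
  have "\<phi> (X ^ n) = (\<Sum>P\<in>NC n. \<Prod>B\<in>P. ?\<kappa> (card B))" for n
  proof -
    have "\<phi> (X ^ n) = nc_sum (\<lambda>n. mat_trace (M ^\<^sub>m n)) n"
      using moments_nc_sum[of n] by (simp add: E_def)
    \<comment> \<open>Blocks are nonempty, so replacing the trace \<open>N\<close> of the zeroth
      power by the conventional cumulant \<open>0\<close> changes no product.\<close>
    also have "\<dots> = (\<Sum>P\<in>NC n. \<Prod>B\<in>P. ?\<kappa> (card B))"
      unfolding nc_sum_def
    proof (intro sum.cong prod.cong refl)
      fix P B assume "P \<in> NC n" "B \<in> P"
      hence "B \<subseteq> {1..n}" "B \<noteq> {}" by (auto simp: NC_def partition_on_def)
      hence "card B \<noteq> 0" using finite_subset by fastforce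
      thus "mat_trace (M ^\<^sub>m card B) = ?\<kappa> (card B)" by simp
    qed
    finally show ?thesis .
  qed
  thus ?thesis
    unfolding free_cumulant_def
    by (intro the1_equality ex1_free_cumulants[of "\<lambda>n. \<phi> (X ^ n)"]) simp
qed

end

context tracial_state
begin

lemma semicircular_formI:
  assumes "\<And>i. i < N \<Longrightarrow> T i \<in> A" "\<And>i. i < N \<Longrightarrow> has_law \<phi> (T i) (semicircle (v i))"
    "\<And>i. i < N \<Longrightarrow> 0 < v i" and "freely_independent \<phi> {..<N} T" and "M \<in> carrier_mat N N"
  shows "semicircular_form A \<phi> (\<lambda>i. complex_of_real (1 / sqrt (v i)) *\<^sub>C T i) N M"
proof unfold_locales
  show "M \<in> carrier_mat N N" by fact
  show "complex_of_real (1 / sqrt (v i)) *\<^sub>C T i \<in> A" if "i < N" for i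
    using assms(1)[OF that] by (rule scaleC_in)
  show "\<phi> (wick (\<lambda>i. complex_of_real (1 / sqrt (v i)) *\<^sub>C T i) w) = 0"
    if "set w \<subseteq> {..<N}" "w \<noteq> []" for w
    using assms that
    by (intro trace_wick_eq_0[OF freely_independent_scaleC[of \<phi> "{..<N}" T]] trace_chebyshev_U) auto
qed

text \<open>The tetilla element is the quadratic form of the diagonal matrix with entries
  \<open>c\<close> and \<open>- c\<close>, so its cumulants are the power sums of these two
  numbers.\<close>

lemma free_cumulant_tetilla:
  assumes S1: "S1 \<in> A" "has_law \<phi> S1 (semicircle 1)" and S2: "S2 \<in> A" "has_law \<phi> S2 (semicircle 1)"
    and free: "freely_independent \<phi> {1, 2 :: nat} (\<lambda>i. if i = 1 then S1 else S2)" and n: "1 \<le> n"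
  shows "free_cumulant \<phi> ((1 / sqrt 2) *\<^sub>R (S1 ^ 2 - S2 ^ 2)) n =
    complex_of_real ((1 / sqrt 2) ^ n + (- 1 / sqrt 2) ^ n)"
proof -
  define c where "c = complex_of_real (1 / sqrt 2)"
  define T where "T = (\<lambda>i. if i = 1 then S1 else S2) \<circ> Suc"
  define M where "M = Matrix.mat 2 2 (\<lambda>(i, j). if i = j then if i = 0 then c else - c else 0)"
  have M: "M \<in> carrier_mat 2 2" "upper_triangular M" by (auto simp: M_def)
  have "freely_independent \<phi> {..<2} T"
    unfolding T_def using free by (rule freely_independent_reindex) auto
  moreover have "T i \<in> A" "has_law \<phi> (T i) (semicircle 1)" if "i < 2" for i
    using S1 S2 by (auto simp: T_def)
  ultimately have "semicircular_form A \<phi> (\<lambda>i. complex_of_real (1 / sqrt 1) *\<^sub>C T i) 2 M"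
    using M(1) by (intro semicircular_formI) auto
  then interpret semicircular_form A \<phi> T 2 M by simp
  have T: "T 0 = S1" "T (Suc 0) = S2" by (auto simp: T_def)
  have "(1 / sqrt 2) *\<^sub>R (S1 ^ 2 - S2 ^ 2) = quadratic_form T 2 M"
    unfolding scaleR_conv_scaleC c_def[symmetric]
    by (rule operator_eqI) (simp add: quadratic_form_def numeral_2_eq_2 M_def T power2_eq_square
        scaleC_add_right uminus_conv_scaleC[of "c *\<^sub>C _"] scaleC_scaleC)
  moreover have "mat_trace (M ^\<^sub>m n) = c ^ n + (- c) ^ n"
    using M upper_triangular_power[OF M, of 0 0 n] upper_triangular_power[OF M, of 1 1 n]
      pow_carrier_mat[OF M(1), of n]
    by (simp add: mat_trace_def numeral_2_eq_2 M_def)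
  ultimately show ?thesis using n by (simp add: free_cumulant_quadratic_form c_def)
qed

end

section \<open>Approximation by step integrals\<close>

lemma ex_common_refinement:
  fixes E :: "real set"
  assumes "finite E" "E \<subseteq> {0..}"
  shows "\<exists>N t. 0 \<le> t 0 \<and> (\<forall>k<N. t k < t (Suc k)) \<and> E \<subseteq> t ` {..N::nat}"
proof -
  \<comment> \<open>Inserting \<open>0\<close> keeps the list nonempty, so that
    \<open>length xs - 1\<close> is not truncated.\<close>
  define xs where "xs = sorted_list_of_set (insert 0 E)"
  have set: "set xs = insert 0 E" unfolding xs_def using assms(1) by (subst set_sorted_list_of_set) auto
  hence len: "0 < length xs" by (cases xs) auto
  have "sorted_wrt (<) xs" unfolding xs_def by (rule strict_sorted_list_of_set)
  hence "xs ! k < xs ! Suc k" if "k < length xs - 1" for k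
    using that by (intro sorted_wrt_nth_less[of "(<)"]) auto
  moreover have "xs ! 0 \<in> insert 0 E" using len set nth_mem by blast
  hence "0 \<le> xs ! 0" using assms(2) by auto
  moreover have "E \<subseteq> (!) xs ` {..length xs - 1}"
  proof
    fix e assume "e \<in> E"
    then obtain k where "k < length xs" "xs ! k = e" using set by (metis in_set_conv_nth insertCI)
    thus "e \<in> (!) xs ` {..length xs - 1}" by (auto intro!: image_eqI[of _ _ k])
  qed
  ultimately show ?thesis by (intro exI[of _ "length xs - 1"] exI[of _ "(!) xs"]) auto
qed

lemma step_integral_quadratic:
  fixes S :: "real \<Rightarrow> 'h::complex_hilbert_space operator"
  assumes lin: "\<And>a b. a \<in> E \<Longrightarrow> b \<in> E \<Longrightarrow> \<exists>c. S b - S a = (\<Sum>k<N. c k *\<^sub>R s k)"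
    and L: "\<forall>(c, (a, b), (u, v))\<in>set L. {a, b, u, v} \<subseteq> E"
  shows "\<exists>f. step_integral S L = (\<Sum>i<N. \<Sum>j<N. f i j *\<^sub>R (s i * s j))"
  using L
proof (induction L)
  case Nil
  show ?case by (intro exI[of _ "\<lambda>_ _. 0"]) (simp add: step_integral_def)
next
  case (Cons z L)
  obtain c a b u v where z: "z = (c, (a, b), (u, v))" by (metis prod.exhaust)
  obtain f where f: "step_integral S L = (\<Sum>i<N. \<Sum>j<N. f i j *\<^sub>R (s i * s j))"
    using Cons by auto
  obtain \<alpha> where \<alpha>: "S b - S a = (\<Sum>k<N. \<alpha> k *\<^sub>R s k)" using lin[of a b] Cons.prems z by auto
  obtain \<beta> where \<beta>: "S v - S u = (\<Sum>k<N. \<beta> k *\<^sub>R s k)" using lin[of u v] Cons.prems z by auto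
  have "step_integral S (z # L) = c *\<^sub>R ((S b - S a) * (S v - S u)) + step_integral S L"
    by (simp add: step_integral_def z)
  also have "\<dots> = (\<Sum>i<N. \<Sum>j<N. (c * \<alpha> i * \<beta> j + f i j) *\<^sub>R (s i * s j))"
    unfolding f \<alpha> \<beta>
    by (simp add: sum_product scaleR_sum_right scaleR_add_left sum.distrib mult_ac)
  finally show ?case by (rule exI[of _ "\<lambda>i j. c * \<alpha> i * \<beta> j + f i j"])
qed

context tracial_state
begin

text \<open>Taking the real part is an orthogonal projection that fixes \<open>F\<close>. In terms
  of \<open>D = X - F\<close>, the claim is positivity of the trace at \<open>D - D'\<close>
  combined with traciality.\<close>

lemma symmetrization_dist_le:
  assumes X: "X \<in> A" "is_adjoint X X'" and F: "F \<in> A" "selfadjoint F"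
  defines "Y \<equiv> (1 / 2 :: real) *\<^sub>R (X + X')"
  shows "Re (\<phi> ((Y - F) * (Y - F))) \<le> Re (\<phi> (adj (X - F) * (X - F)))"
proof -
  define D D' where "D = X - F" and "D' = X' - F"
  have D: "D \<in> A" "D' \<in> A" using X F adjoint_in by (auto simp: D_def D'_def)
  have adj: "is_adjoint D D'"
    using X F unfolding D_def D'_def selfadjoint_def by (intro is_adjoint_diff)
  have Y: "Y - F = (1 / 2 :: real) *\<^sub>R (D + D')"
    unfolding Y_def D_def D'_def by (simp add: algebra_simps flip: scaleR_add_left)
  have "0 \<le> Re (\<phi> ((D' - D) * (D - D')))"
    using trace_adjoint_nonneg[OF _ is_adjoint_diff[OF adj is_adjoint_sym[OF adj]]] D by auto
  hence "Re (\<phi> (D * D)) + Re (\<phi> (D' * D')) \<le> 2 * Re (\<phi> (D' * D))"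
    using D trace_commute[of D D'] by (simp add: algebra_simps)
  hence "Re (\<phi> ((Y - F) * (Y - F))) \<le> Re (\<phi> (D' * D))"
    unfolding Y using D trace_commute[of D D'] by (simp add: algebra_simps)
  thus ?thesis using adj_eq[OF adj] by (simp add: D_def)
qed

text \<open>In normalized increments over a common refinement of the endpoints, the step integral is
  a quadratic form with real coefficients. \<open>Y\<close> is its real part, whose coefficient
  matrix is real symmetric, and the \<open>x i\<close> are the eigenvalues of that matrix.\<close>

lemma step_integral_approx:
  assumes bm: "free_brownian_motion A \<phi> S" and L: "off_diagonal L"
  shows "\<exists>Y (N :: nat) (x :: nat \<Rightarrow> real). Y \<in> A \<and> selfadjoint Y \<and>
    (\<forall>k\<ge>1. free_cumulant \<phi> Y k = complex_of_real (\<Sum>i<N. x i ^ k)) \<and>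
    (\<forall>F\<in>A. selfadjoint F \<longrightarrow>
      Re (\<phi> ((Y - F) * (Y - F))) \<le> Re (\<phi> (adj (step_integral S L - F) * (step_integral S L - F))))"
proof -
  define E where "E = (\<Union>(c, (a, b), (u, v))\<in>set L. {a, b, u, v})"
  have E: "finite E" "E \<subseteq> {0..}" using L by (fastforce simp: E_def off_diagonal_def)+
  then obtain N t where t: "0 \<le> t 0" "\<And>k. k < N \<Longrightarrow> t k < t (Suc k)" "E \<subseteq> t ` {..N}"
    using ex_common_refinement[of E] by metis
  define T where "T = (\<lambda>k. S (t (Suc k)) - S (t k))"
  define v where "v = (\<lambda>k. t (Suc k) - t k)"
  define s where "s = (\<lambda>k. complex_of_real (1 / sqrt (v k)) *\<^sub>C T k)"
  have tpos: "0 \<le> t k" if "k \<le> N" for k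
    using that
  proof (induction k)
    case (Suc k)
    thus ?case using t(2)[of k] by simp
  qed (rule t(1))
  have S: "S u \<in> A" "selfadjoint (S u)" if "0 \<le> u" for u
    using bm that unfolding free_brownian_motion_def by blast+
  have v: "0 < v k" if "k < N" for k using t(2)[OF that] by (simp add: v_def)
  have T: "T k \<in> A" "is_adjoint (T k) (T k)" if "k < N" for k
    using S tpos[of k] tpos[of "Suc k"] that
    by (auto simp: T_def selfadjoint_def intro!: is_adjoint_diff)
  have law: "has_law \<phi> (T k) (semicircle (v k))" if "k < N" for k
    using bm t(2)[OF that] tpos[of k] that unfolding free_brownian_motion_def T_def v_def by simp
  have free: "freely_independent \<phi> {..<N} T"
    using bm t(1,2) unfolding free_brownian_motion_def T_def by blast
  have s_adj: "is_adjoint (s k) (s k)" if "k < N" for k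
    using is_adjoint_scaleC[OF T(2)[OF that], of "complex_of_real (1 / sqrt (v k))"] by (simp add: s_def)
  have s_in: "s k \<in> A" if "k < N" for k using T(1)[OF that] by (simp add: s_def)
  have T_s: "T k = sqrt (v k) *\<^sub>R s k" if "k < N" for k
    using v[OF that] by (simp add: s_def scaleR_conv_scaleC scaleC_scaleC flip: of_real_mult)
  have lin0: "\<exists>c. S (t q) - S (t 0) = (\<Sum>k<N. c k *\<^sub>R s k)" if "q \<le> N" for q
  proof -
    have "S (t q) - S (t 0) = (\<Sum>k<q. T k)"
      unfolding T_def by (rule sum_lessThan_telescope[symmetric])
    also have "\<dots> = (\<Sum>k<q. sqrt (v k) *\<^sub>R s k)"
      using that T_s by (intro sum.cong) auto
    also have "\<dots> = (\<Sum>k<N. (if k < q then sqrt (v k) else 0) *\<^sub>R s k)"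
      using that by (intro sum.mono_neutral_cong_left) auto
    finally show ?thesis by (rule exI[of _ "\<lambda>k. if k < q then sqrt (v k) else 0"])
  qed
  have lin: "\<exists>c. S b - S a = (\<Sum>k<N. c k *\<^sub>R s k)" if ab: "a \<in> E" "b \<in> E" for a b
  proof -
    have "a \<in> t ` {..N}" "b \<in> t ` {..N}" using ab t(3) by blast+
    then obtain p q where pq: "p \<le> N" "q \<le> N" "a = t p" "b = t q" by (elim imageE) auto
    obtain c d where "S a - S (t 0) = (\<Sum>k<N. c k *\<^sub>R s k)" "S b - S (t 0) = (\<Sum>k<N. d k *\<^sub>R s k)"
      using lin0 pq by metis
    hence "S b - S a = (\<Sum>k<N. d k *\<^sub>R s k) - (\<Sum>k<N. c k *\<^sub>R s k)" by (metis diff_diff_eq2 diff_add_cancel)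
    also have "\<dots> = (\<Sum>k<N. (d k - c k) *\<^sub>R s k)" by (simp add: sum_subtractf scaleR_diff_left)
    finally show ?thesis by (rule exI[of _ "\<lambda>k. d k - c k"])
  qed
  obtain f where f: "step_integral S L = (\<Sum>i<N. \<Sum>j<N. f i j *\<^sub>R (s i * s j))"
    using step_integral_quadratic[where E = E and S = S and N = N and s = s and L = L, OF lin] unfolding E_def by fastforce
  \<comment> \<open>Symmetrizing the coefficients corresponds to averaging \<open>Z\<close> with its
    adjoint \<open>Z'\<close>.\<close>
  define M where "M = Matrix.mat N N (\<lambda>(i, j). complex_of_real ((f i j + f j i) / 2))"
  define Z Z' where "Z = step_integral S L" and "Z' = (\<Sum>i<N. \<Sum>j<N. f i j *\<^sub>R (s j * s i))"
  have Z_in: "Z \<in> A"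
    unfolding Z_def f by (intro sum_in scaleR_in mult_in s_in) auto
  have Z_adj: "is_adjoint Z Z'"
    unfolding Z_def Z'_def f scaleR_conv_scaleC
  proof (intro is_adjoint_sum)
    fix i j assume "i \<in> {..<N}" "j \<in> {..<N}"
    thus "is_adjoint (complex_of_real (f i j) *\<^sub>C (s i * s j)) (complex_of_real (f i j) *\<^sub>C (s j * s i))"
      using is_adjoint_scaleC[OF is_adjoint_mult[OF s_adj s_adj], of i j "complex_of_real (f i j)"] by simp
  qed
  have M: "M \<in> carrier_mat N N" by (simp add: M_def)
  interpret semicircular_form A \<phi> s N M
    unfolding s_def using T(1) law v free M by (rule semicircular_formI)
  have Z'_swap: "Z' = (\<Sum>i<N. \<Sum>j<N. f j i *\<^sub>R (s i * s j))" unfolding Z'_def by (rule sum.swap)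
  have Y: "quadratic_form s N M = (1 / 2 :: real) *\<^sub>R (Z + Z')"
    unfolding Z_def f Z'_swap quadratic_form_def sum.distrib[symmetric] scaleR_sum_right
    by (intro sum.cong refl)
      (simp add: M_def scaleR_conv_scaleC scaleC_scaleC add_divide_distrib
        flip: scaleC_add_left)
  have "selfadjoint (quadratic_form s N M)"
    unfolding Y selfadjoint_def scaleR_conv_scaleC
    using is_adjoint_scaleC[OF is_adjoint_add[OF Z_adj is_adjoint_sym[OF Z_adj]], of "complex_of_real (1 / 2)"]
    by (simp add: add.commute)
  moreover obtain x where "\<And>k. mat_trace (M ^\<^sub>m k) = complex_of_real (\<Sum>i<N. x i ^ k)"
    using hermitian_trace_powers[OF M] by (fastforce simp: M_def add.commute)
  moreover have "Re (\<phi> ((quadratic_form s N M - F) * (quadratic_form s N M - F))) \<le>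
      Re (\<phi> (adj (step_integral S L - F) * (step_integral S L - F)))"
    if "F \<in> A" "selfadjoint F" for F
    using symmetrization_dist_le[OF Z_in Z_adj that] unfolding Y Z_def .
  ultimately show ?thesis
    by (intro exI[of _ "quadratic_form s N M"] exI[of _ N] exI[of _ x])
      (simp add: free_cumulant_quadratic_form)
qed

end

section \<open>Convergence of moments and cumulants\<close>

lemma free_cumulant_tendsto:
  assumes "\<And>j. 1 \<le> j \<Longrightarrow> j \<le> k \<Longrightarrow> (\<lambda>n. \<phi> (Y n ^ j)) \<longlonglongrightarrow> \<phi> (F ^ j)" and "j \<le> k"
  shows "(\<lambda>n. free_cumulant \<phi> (Y n) j) \<longlonglongrightarrow> free_cumulant \<phi> F j"
  using \<open>j \<le> k\<close>
proof (induction j rule: less_induct)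
  case (less j)
  show ?case
  proof (cases "j = 0")
    case True
    thus ?thesis by (simp add: free_cumulant_0)
  next
    case False
    let ?R = "\<lambda>T. \<Sum>P\<in>NC j - {{{1..j}}}. \<Prod>B\<in>P. free_cumulant \<phi> T (card B)"
    \<comment> \<open>Solved for the one-block term, the moment-cumulant relation is a polynomial in
      one moment and cumulants of smaller index, so limits pass by induction.\<close>
    have split: "free_cumulant \<phi> T j = \<phi> (T ^ j) - ?R T" for T
      using moment_cumulant[of j \<phi> T] moment_cumulant_split[of j "free_cumulant \<phi> T"] False by simp
    have "(\<lambda>n. ?R (Y n)) \<longlonglongrightarrow> ?R F"
      using less NC_card_less[of _ j] by (intro tendsto_sum tendsto_prod) (metis less_imp_le order_trans)
    thus ?thesis
      unfolding split using assms(1)[of j] less.prems False by (intro tendsto_diff) auto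
  qed
qed

text \<open>All powers beyond the second are pulled out by \<open>\<bar>x i\<bar> \<le> r\<close>.
  This bounds every higher cumulant of the approximants by the second one.\<close>

lemma abs_power_sum_le:
  fixes x :: "nat \<Rightarrow> real"
  assumes k: "2 \<le> k"
  shows "\<bar>\<Sum>i<N. x i ^ k\<bar> \<le> sqrt (\<Sum>i<N. (x i)\<^sup>2) ^ k"
proof -
  define r where "r = sqrt (\<Sum>i<N. (x i)\<^sup>2)"
  have r: "r\<^sup>2 = (\<Sum>i<N. (x i)\<^sup>2)" by (simp add: r_def sum_nonneg)
  obtain m where m: "k = m + 2" using k by (metis add.commute le_Suc_ex)
  have "\<bar>\<Sum>i<N. x i ^ k\<bar> \<le> (\<Sum>i<N. \<bar>x i ^ k\<bar>)" by (rule sum_abs)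
  also have "\<dots> \<le> (\<Sum>i<N. r ^ m * (x i)\<^sup>2)"
  proof (rule sum_mono)
    fix i assume "i \<in> {..<N}"
    hence "(x i)\<^sup>2 \<le> (\<Sum>i<N. (x i)\<^sup>2)" by (intro member_le_sum) auto
    hence "\<bar>x i\<bar> \<le> r" unfolding r_def by (rule real_le_rsqrt[of "\<bar>x i\<bar>", simplified])
    hence "\<bar>x i\<bar> ^ m * (x i)\<^sup>2 \<le> r ^ m * (x i)\<^sup>2" by (intro mult_right_mono power_mono) auto
    thus "\<bar>x i ^ k\<bar> \<le> r ^ m * (x i)\<^sup>2" by (simp only: m power_add abs_mult power_abs power2_abs)
  qed
  also have "\<dots> = r ^ k" by (simp only: sum_distrib_left[symmetric] r[symmetric] m power_add)
  finally show ?thesis by (simp add: r_def)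
qed

context tracial_state
begin

lemma selfadjoint_power: "selfadjoint T \<Longrightarrow> is_adjoint (T ^ n) (T ^ n)"
  by (simp add: selfadjoint_def is_adjoint_power)

text \<open>A first use of Cauchy-Schwarz separates \<open>Y - F\<close>; traciality collects the
  powers of \<open>F\<close> and of \<open>Y\<close>, and a second use splits them. Only moments
  enter the bound, no operator norms.\<close>

lemma trace_mult_bound:
  assumes Y: "Y \<in> A" "selfadjoint Y" and F: "F \<in> A" "selfadjoint F"
  shows "(cmod (\<phi> (Y ^ j * (Y - F) * F ^ i)))\<^sup>2 \<le>
    Re (\<phi> ((Y - F) * (Y - F))) * sqrt (cmod (\<phi> (F ^ (4 * i))) * cmod (\<phi> (Y ^ (4 * j))))"
proof -
  let ?D = "Y - F" and ?Q = "F ^ i * Y ^ j" and ?Q' = "Y ^ j * F ^ i"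
  have D: "?D \<in> A" "is_adjoint ?D ?D"
    using Y F by (auto simp: selfadjoint_def intro!: is_adjoint_diff)
  have Q: "?Q \<in> A" "?Q' \<in> A" "is_adjoint ?Q ?Q'"
    using Y F by (auto intro!: is_adjoint_mult selfadjoint_power)
  have "\<phi> (Y ^ j * ?D * F ^ i) = \<phi> (?D * ?Q)"
    using trace_commute[of "Y ^ j" "?D * F ^ i"] Y F D by (auto simp: mult.assoc)
  hence 1: "(cmod (\<phi> (Y ^ j * ?D * F ^ i)))\<^sup>2 \<le> Re (\<phi> (?D * ?D)) * Re (\<phi> (?Q' * ?Q))"
    using Cauchy_Schwarz[OF D Q(1,3)] by simp
  have "\<phi> (?Q' * ?Q) = \<phi> (F ^ (2 * i) * Y ^ (2 * j))"
    using trace_commute[of "Y ^ j" "F ^ i * (F ^ i * Y ^ j)"] Y F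
    by (simp add: mult.assoc power_add mult_2)
  moreover have "(cmod (\<phi> (F ^ (2 * i) * Y ^ (2 * j))))\<^sup>2 \<le>
      Re (\<phi> (F ^ (2 * i) * F ^ (2 * i))) * Re (\<phi> (Y ^ (2 * j) * Y ^ (2 * j)))"
    using Y F by (intro Cauchy_Schwarz selfadjoint_power) auto
  moreover have "\<dots> \<le> cmod (\<phi> (F ^ (2 * i) * F ^ (2 * i))) * cmod (\<phi> (Y ^ (2 * j) * Y ^ (2 * j)))"
    using trace_adjoint_nonneg[OF _ selfadjoint_power, of Y "2 * j"] Y F
    by (intro mult_mono complex_Re_le_cmod) auto
  ultimately have "(cmod (\<phi> (?Q' * ?Q)))\<^sup>2 \<le> cmod (\<phi> (F ^ (4 * i))) * cmod (\<phi> (Y ^ (4 * j)))"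
    by (simp flip: power_add)
  hence "cmod (\<phi> (?Q' * ?Q)) \<le> sqrt (cmod (\<phi> (F ^ (4 * i))) * cmod (\<phi> (Y ^ (4 * j))))"
    by (rule real_le_rsqrt)
  hence "Re (\<phi> (?Q' * ?Q)) \<le> sqrt (cmod (\<phi> (F ^ (4 * i))) * cmod (\<phi> (Y ^ (4 * j))))"
    using complex_Re_le_cmod order_trans by blast
  hence "Re (\<phi> (?D * ?D)) * Re (\<phi> (?Q' * ?Q)) \<le>
      Re (\<phi> (?D * ?D)) * sqrt (cmod (\<phi> (F ^ (4 * i))) * cmod (\<phi> (Y ^ (4 * j))))"
    using trace_adjoint_nonneg[OF D] by (intro mult_left_mono) auto
  with 1 show ?thesis by linarith
qed

text \<open>The factors \<open>Y n\<close> are exchanged for \<open>F\<close> one at a time. Each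
  exchange costs a trace controlled by \<open>trace_mult_bound\<close>, which tends to zero while
  the moments of order \<open>4 * j\<close> stay bounded.\<close>

lemma trace_power_tendsto:
  assumes Y: "\<And>n. Y n \<in> A" "\<And>n. selfadjoint (Y n)" and F: "F \<in> A" "selfadjoint F"
    and d: "(\<lambda>n. Re (\<phi> ((Y n - F) * (Y n - F)))) \<longlonglongrightarrow> 0"
    and bound: "\<And>j. j < k \<Longrightarrow> \<exists>C. \<forall>n. cmod (\<phi> (Y n ^ (4 * j))) \<le> C"
  shows "(\<lambda>n. \<phi> (Y n ^ k)) \<longlonglongrightarrow> \<phi> (F ^ k)"
proof -
  have "(\<lambda>n. \<phi> (Y n ^ j * F ^ i)) \<longlonglongrightarrow> \<phi> (F ^ (j + i))" if "j \<le> k" for i j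
    using that
  proof (induction j arbitrary: i)
    case 0
    show ?case by simp
  next
    case (Suc j)
    obtain C where C: "\<And>n. cmod (\<phi> (Y n ^ (4 * j))) \<le> C" using bound[of j] Suc.prems by auto
    define K where "K = sqrt (cmod (\<phi> (F ^ (4 * i))) * C)"
    have "(\<lambda>n. sqrt (Re (\<phi> ((Y n - F) * (Y n - F))) * K)) \<longlonglongrightarrow> sqrt (0 * K)"
      using d by (intro tendsto_intros)
    hence lim: "(\<lambda>n. sqrt (Re (\<phi> ((Y n - F) * (Y n - F))) * K)) \<longlonglongrightarrow> 0" by simp
    have le: "norm (\<phi> (Y n ^ j * (Y n - F) * F ^ i)) \<le> sqrt (Re (\<phi> ((Y n - F) * (Y n - F))) * K)" for n
    proof (rule real_le_rsqrt, rule order_trans[OF trace_mult_bound[OF Y F]], rule mult_left_mono)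
      show "sqrt (cmod (\<phi> (F ^ (4 * i))) * cmod (\<phi> (Y n ^ (4 * j)))) \<le> K"
        unfolding K_def using C by (intro real_sqrt_le_mono mult_left_mono) auto
      show "0 \<le> Re (\<phi> ((Y n - F) * (Y n - F)))"
        using trace_adjoint_nonneg[of "Y n - F" "Y n - F"] Y F
        by (auto simp: selfadjoint_def is_adjoint_diff)
    qed
    have "(\<lambda>n. \<phi> (Y n ^ j * (Y n - F) * F ^ i)) \<longlonglongrightarrow> 0"
      by (rule Lim_null_comparison[OF always_eventually[OF allI[OF le]] lim])
    moreover have "\<phi> (Y n ^ Suc j * F ^ i) = \<phi> (Y n ^ j * (Y n - F) * F ^ i) + \<phi> (Y n ^ j * F ^ Suc i)" for n
    proof -
      have "Y n ^ Suc j * F ^ i = Y n ^ j * (Y n - F) * F ^ i + Y n ^ j * F ^ Suc i"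
        by (simp only: power_Suc2[of "Y n"] power_Suc[of F] right_diff_distrib left_diff_distrib mult.assoc
            diff_add_cancel)
      thus ?thesis using Y F by (simp del: power_Suc)
    qed
    ultimately show ?case using tendsto_add[OF _ Suc.IH[of "Suc i"]] Suc.prems by fastforce
  qed
  from this[of k 0] show ?thesis by simp
qed

text \<open>A bootstrap: the first two moments converge, so the second cumulants are bounded; as
  sums of squares they bound all other power sums, hence all moments. This is the boundedness that
  \<open>trace_power_tendsto\<close> asks for.\<close>

lemma cumulants_limit:
  fixes x :: "nat \<Rightarrow> nat \<Rightarrow> real" and N :: "nat \<Rightarrow> nat"
  assumes Y: "\<And>n. Y n \<in> A" "\<And>n. selfadjoint (Y n)" and F: "F \<in> A" "selfadjoint F"
    and d: "(\<lambda>n. Re (\<phi> ((Y n - F) * (Y n - F)))) \<longlonglongrightarrow> 0"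
    and cum: "\<And>n k. 1 \<le> k \<Longrightarrow> free_cumulant \<phi> (Y n) k = complex_of_real (\<Sum>i<N n. x n i ^ k)"
  shows "(\<lambda>n. free_cumulant \<phi> (Y n) k) \<longlonglongrightarrow> free_cumulant \<phi> F k"
proof -
  have m1: "(\<lambda>n. \<phi> (Y n ^ 1)) \<longlonglongrightarrow> \<phi> (F ^ 1)"
    by (rule trace_power_tendsto[OF Y F d]) (auto intro!: exI[of _ 1])
  \<comment> \<open>Treated by hand, since \<open>trace_power_tendsto\<close> would already ask for
    bounded fourth moments here.\<close>
  have m2: "(\<lambda>n. \<phi> (Y n ^ 2)) \<longlonglongrightarrow> \<phi> (F ^ 2)"
  proof -
    let ?D = "\<lambda>n. Y n - F"
    have D: "?D n \<in> A" "is_adjoint (?D n) (?D n)" for n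
      using Y F by (auto simp: selfadjoint_def intro!: is_adjoint_diff)
    have DD: "\<phi> (?D n * ?D n) = complex_of_real (Re (\<phi> (?D n * ?D n)))" for n
      using trace_adjoint_nonneg[OF D] by (simp add: complex_eq_iff)
    have "(\<lambda>n. complex_of_real (Re (\<phi> (?D n * ?D n)))) \<longlonglongrightarrow> complex_of_real 0"
      using d by (rule tendsto_of_real)
    hence "(\<lambda>n. \<phi> (?D n * ?D n)) \<longlonglongrightarrow> 0" unfolding DD[symmetric] by simp
    moreover have "(\<lambda>n. \<phi> (F * ?D n)) \<longlonglongrightarrow> 0"
    proof (rule Lim_null_comparison[OF always_eventually[OF allI]])
      show "norm (\<phi> (F * ?D n)) \<le> sqrt (Re (\<phi> (F * F)) * Re (\<phi> (?D n * ?D n)))" for n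
        using F by (intro real_le_rsqrt Cauchy_Schwarz D) (auto simp: selfadjoint_def)
      have "(\<lambda>n. sqrt (Re (\<phi> (F * F)) * Re (\<phi> (?D n * ?D n)))) \<longlonglongrightarrow> sqrt (Re (\<phi> (F * F)) * 0)"
        using d by (intro tendsto_intros)
      thus "(\<lambda>n. sqrt (Re (\<phi> (F * F)) * Re (\<phi> (?D n * ?D n)))) \<longlonglongrightarrow> 0" by simp
    qed
    ultimately have "(\<lambda>n. \<phi> (?D n * ?D n) + 2 * \<phi> (F * ?D n) + \<phi> (F * F)) \<longlonglongrightarrow> 0 + 2 * 0 + \<phi> (F * F)"
      by (intro tendsto_intros)
    moreover have "\<phi> (Y n ^ 2) = \<phi> (?D n * ?D n) + 2 * \<phi> (F * ?D n) + \<phi> (F * F)" for n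
      using Y[of n] F trace_commute[of "Y n" F] by (simp add: power2_eq_square algebra_simps)
    ultimately show ?thesis by (simp add: power2_eq_square)
  qed
  have m12: "(\<lambda>n. \<phi> (Y n ^ j)) \<longlonglongrightarrow> \<phi> (F ^ j)" if "1 \<le> j" "j \<le> 2" for j
  proof -
    have "j = 1 \<or> j = 2" using that by auto
    thus ?thesis using m1 m2 by blast
  qed
  have "\<exists>K. \<forall>n. cmod (free_cumulant \<phi> (Y n) j) \<le> K" for j
  proof -
    have conv: "\<exists>K. \<forall>n. cmod (free_cumulant \<phi> (Y n) i) \<le> K" if "i \<le> 2" for i
    proof -
      have "(\<lambda>n. free_cumulant \<phi> (Y n) i) \<longlonglongrightarrow> free_cumulant \<phi> F i"
        using m12 that by (rule free_cumulant_tendsto)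
      from convergent_imp_bounded[OF this] show ?thesis by (auto simp: bounded_iff)
    qed
    show ?thesis
    proof (cases "j \<le> 2")
      case False
      obtain K where K: "\<And>n. cmod (free_cumulant \<phi> (Y n) 2) \<le> K" using conv[of 2] by auto
      have "cmod (free_cumulant \<phi> (Y n) j) \<le> sqrt K ^ j" for n
      proof -
        have "(\<Sum>i<N n. (x n i)\<^sup>2) \<le> K" using K[of n] cum[of 2 n] by (simp add: sum_nonneg flip: of_real_power of_real_sum)
        hence "sqrt (\<Sum>i<N n. (x n i)\<^sup>2) ^ j \<le> sqrt K ^ j" by (intro power_mono) (auto intro: sum_nonneg)
        moreover have "cmod (free_cumulant \<phi> (Y n) j) = \<bar>\<Sum>i<N n. x n i ^ j\<bar>"
          using cum[of j n] False by (simp only: norm_of_real)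
        ultimately show ?thesis using abs_power_sum_le[of j "x n" "N n"] False by simp
      qed
      thus ?thesis by blast
    qed (rule conv)
  qed
  then obtain K where K: "\<And>j n. cmod (free_cumulant \<phi> (Y n) j) \<le> K j" by metis
  have "cmod (\<phi> (Y n ^ m)) \<le> 1 + (\<Sum>P\<in>NC m. \<Prod>B\<in>P. K (card B))" for m n
  proof (cases "m = 0")
    case True
    have "0 \<le> K j" for j using K[of undefined j] norm_ge_zero order_trans by blast
    thus ?thesis using True by (auto intro!: sum_nonneg prod_nonneg)
  next
    case False
    hence "cmod (\<phi> (Y n ^ m)) \<le> (\<Sum>P\<in>NC m. cmod (\<Prod>B\<in>P. free_cumulant \<phi> (Y n) (card B)))"
      by (subst moment_cumulant) (auto intro: norm_sum)
    also have "\<dots> \<le> (\<Sum>P\<in>NC m. \<Prod>B\<in>P. K (card B))"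
      by (intro sum_mono) (auto simp: prod_norm[symmetric] intro!: prod_mono K)
    finally show ?thesis by simp
  qed
  hence "(\<lambda>n. \<phi> (Y n ^ j)) \<longlonglongrightarrow> \<phi> (F ^ j)" for j
    by (intro trace_power_tendsto[OF Y F d]) blast
  thus ?thesis by (intro free_cumulant_tendsto[of k]) auto
qed

end

section \<open>Symmetric laws and comparison of moments\<close>

lemma free_cumulant_odd_eq_0:
  assumes odd_moment: "\<And>n. odd n \<Longrightarrow> \<phi> (F ^ n) = 0" and k: "odd k"
  shows "free_cumulant \<phi> F k = 0"
proof -
  let ?\<kappa> = "free_cumulant \<phi> F"
  \<comment> \<open>Block sizes add up to \<open>n\<close>, so the signs multiply to the sign of
    \<open>- F\<close> in the \<open>n\<close>-th moment. As odd moments vanish, the signed sequence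
    satisfies the same relations, and uniqueness identifies it with the cumulants.\<close>
  have "\<phi> (F ^ n) = (\<Sum>P\<in>NC n. \<Prod>B\<in>P. (- 1) ^ card B * ?\<kappa> (card B))" if n: "1 \<le> n" for n
  proof -
    have "(\<Prod>B\<in>P. (- 1) ^ card B) = (- 1 :: complex) ^ n" if "P \<in> NC n" for P
    proof -
      have P: "partition_on {1..n} P" using that by (simp add: NC_def)
      hence "finite P" by (intro finite_elements) auto
      moreover have "finite B" if "B \<in> P" for B
        using P that unfolding partition_on_def by (metis Sup_upper finite_atLeastAtMost finite_subset)
      hence "n = (\<Sum>B\<in>P. card B)"
        using product_partition[OF P] by simp
      ultimately show ?thesis by (simp add: power_sum)
    qed
    hence "(\<Sum>P\<in>NC n. \<Prod>B\<in>P. (- 1) ^ card B * ?\<kappa> (card B)) = (- 1) ^ n * \<phi> (F ^ n)"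
      using moment_cumulant[OF n, of \<phi> F] by (simp add: prod.distrib sum_distrib_left)
    also have "\<dots> = \<phi> (F ^ n)" using odd_moment[of n] by (cases "even n") auto
    finally show ?thesis by simp
  qed
  hence sign: "\<forall>n\<ge>1. \<phi> (F ^ n) = (\<Sum>P\<in>NC n. \<Prod>B\<in>P. (- 1) ^ card B * ?\<kappa> (card B))" by blast
  obtain \<kappa>' where unique: "\<kappa> = \<kappa>'"
    if "\<kappa> 0 = 0 \<and> (\<forall>n\<ge>1. \<phi> (F ^ n) = (\<Sum>P\<in>NC n. \<Prod>B\<in>P. \<kappa> (card B)))" for \<kappa>
    using ex1_free_cumulants[of "\<lambda>n. \<phi> (F ^ n)"] by (elim ex1E) blast
  have "(\<lambda>n. (- 1) ^ n * ?\<kappa> n) = \<kappa>'"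
    using sign free_cumulant_0[of \<phi> F] by (intro unique) simp
  moreover have "?\<kappa> = \<kappa>'"
    using free_cumulant_0[of \<phi> F] moment_cumulant[of _ \<phi> F] by (intro unique) blast
  ultimately have "(\<lambda>n. (- 1) ^ n * ?\<kappa> n) = ?\<kappa>" by simp
  hence "(- 1) ^ k * ?\<kappa> k = ?\<kappa> k" by metis
  thus ?thesis using k by simp
qed

lemma free_cumulant_2:
  assumes "free_cumulant \<phi> F 1 = 0"
  shows "free_cumulant \<phi> F 2 = \<phi> (F ^ 2)"
proof -
  have "(\<Prod>B\<in>P. free_cumulant \<phi> F (card B)) = 0" if P: "P \<in> NC 2 - {{{1..2}}}" for P
  proof -
    have pa: "partition_on {1..2} P" using P by (simp add: NC_def)
    hence "1 \<in> \<Union>P" by (simp add: partition_on_def)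
    then obtain B where B: "B \<in> P" by blast
    have "card B < 2" using NC_card_less[OF P B] .
    hence "free_cumulant \<phi> F (card B) = 0"
      using assms free_cumulant_0[of \<phi> F] by (cases "card B") auto
    moreover have "finite P" using pa by (intro finite_elements) auto
    ultimately show ?thesis using B by (intro prod_zero bexI[of _ B])
  qed
  hence "(\<Sum>P\<in>NC 2 - {{{1..2}}}. \<Prod>B\<in>P. free_cumulant \<phi> F (card B)) = 0"
    by (intro sum.neutral ballI)
  moreover have "\<phi> (F ^ 2) = free_cumulant \<phi> F 2 +
      (\<Sum>P\<in>NC 2 - {{{1..2}}}. \<Prod>B\<in>P. free_cumulant \<phi> F (card B))"
    by (subst moment_cumulant, simp, rule moment_cumulant_split) simp
  ultimately show ?thesis by simp
qed

text \<open>The one-block partition contributes the weight of \<open>n\<close> itself, and the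
  remaining terms are monotone. Equal moments therefore force equal cumulants, which reduces the
  equality case for moments to that for cumulants.\<close>

lemma nc_sum_mono:
  fixes a b :: "nat \<Rightarrow> real"
  assumes ab: "\<And>k. 0 \<le> a k" "\<And>k. a k \<le> b k"
  shows "nc_sum a n \<le> nc_sum b n"
    and "1 \<le> n \<Longrightarrow> nc_sum a n = nc_sum b n \<Longrightarrow> a n = b n"
proof -
  have le: "(\<Sum>P\<in>Q. \<Prod>B\<in>P. a (card B)) \<le> (\<Sum>P\<in>Q. \<Prod>B\<in>P. b (card B))" for Q :: "nat set set set"
    using ab by (intro sum_mono prod_mono) auto
  show "nc_sum a n \<le> nc_sum b n" unfolding nc_sum_def by (rule le)
  assume n: "1 \<le> n" and eq: "nc_sum a n = nc_sum b n"
  have "nc_sum c n = c n + (\<Sum>P\<in>NC n - {{{1..n}}}. \<Prod>B\<in>P. c (card B))" for c :: "nat \<Rightarrow> real"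
    unfolding nc_sum_def using sum.remove[OF finite_NC whole_in_NC[OF n], of "\<lambda>P. \<Prod>B\<in>P. c (card B)"] by simp
  thus "a n = b n" using eq le[of "NC n - {{{1..n}}}"] ab(2)[of n] by simp
qed

theorem proposition4p2:
  fixes A :: "'h::complex_hilbert_space operator set"
    and \<phi> :: "'h operator \<Rightarrow> complex"
    and S :: "real \<Rightarrow> 'h operator"
    and F F_infty S1 S2 :: "'h operator"
  assumes "free_probability_space A \<phi>"
    and "free_brownian_motion A \<phi> S"
    and "F \<in> second_wigner_chaos A \<phi> S"
    and "symmetric_distribution \<phi> F"
    and "Re (\<phi> (F ^ 2)) \<le> 1"
    and "S1 \<in> A" "has_law \<phi> S1 (semicircle 1)"
    and "S2 \<in> A" "has_law \<phi> S2 (semicircle 1)"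
    and "freely_independent \<phi> {1, 2 :: nat} (\<lambda>i. if i = 1 then S1 else S2)"
    and "F_infty = (1 / sqrt 2) *\<^sub>R (S1 ^ 2 - S2 ^ 2)"
  shows "(\<forall>r\<ge>1. Re (free_cumulant \<phi> F (2 * r)) \<le> Re (free_cumulant \<phi> F_infty (2 * r))) \<and>
         (\<forall>r\<ge>1. Re (\<phi> (F ^ (2 * r))) \<le> Re (\<phi> (F_infty ^ (2 * r)))) \<and>
         (\<forall>r\<ge>2. free_cumulant \<phi> F (2 * r) = free_cumulant \<phi> F_infty (2 * r) \<or>
                  \<phi> (F ^ (2 * r)) = \<phi> (F_infty ^ (2 * r)) \<longrightarrow> same_law \<phi> F F_infty)"
proof -
  interpret tracial_state A \<phi> by unfold_locales (rule assms(1))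
  obtain Q where Q: "has_law \<phi> F Q" "has_law \<phi> (- F) Q"
    using assms(4) unfolding symmetric_distribution_def same_law_def by blast
  have F_sa: "selfadjoint F" using Q(1) by (simp add: has_law_def)
  obtain f L where F: "F \<in> A" and L: "\<And>n. off_diagonal (L n)"
    and conv: "(\<lambda>n. \<phi> (adj (step_integral S (L n) - F) * (step_integral S (L n) - F))) \<longlonglongrightarrow> 0"
    using assms(3) unfolding second_wigner_chaos_def is_wigner_double_integral_def by blast
  obtain Y and N :: "nat \<Rightarrow> nat" and x :: "nat \<Rightarrow> nat \<Rightarrow> real" where Y: "\<And>n. Y n \<in> A" "\<And>n. selfadjoint (Y n)"
    and cum: "\<And>n k. 1 \<le> k \<Longrightarrow> free_cumulant \<phi> (Y n) k = complex_of_real (\<Sum>i<N n. x n i ^ k)"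
    and dist: "\<And>n. Re (\<phi> ((Y n - F) * (Y n - F))) \<le>
      Re (\<phi> (adj (step_integral S (L n) - F) * (step_integral S (L n) - F)))"
  proof -
    have "\<forall>n. \<exists>Y (N :: nat) (x :: nat \<Rightarrow> real). Y \<in> A \<and> selfadjoint Y \<and>
      (\<forall>k\<ge>1. free_cumulant \<phi> Y k = complex_of_real (\<Sum>i<N. x i ^ k)) \<and>
      Re (\<phi> ((Y - F) * (Y - F))) \<le> Re (\<phi> (adj (step_integral S (L n) - F) * (step_integral S (L n) - F)))"
      using step_integral_approx[OF assms(2) L] F F_sa by blast
    thus thesis using that by metis
  qed
  have "(\<lambda>n. Re (\<phi> ((Y n - F) * (Y n - F)))) \<longlonglongrightarrow> 0"
  proof (rule real_tendsto_sandwich[OF _ _ tendsto_const])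
    show "(\<lambda>n. Re (\<phi> (adj (step_integral S (L n) - F) * (step_integral S (L n) - F)))) \<longlonglongrightarrow> 0"
      using tendsto_Re[OF conv] by simp
    show "\<forall>\<^sub>F n in sequentially. 0 \<le> Re (\<phi> ((Y n - F) * (Y n - F)))"
      using trace_adjoint_nonneg[OF _ is_adjoint_diff] Y F F_sa
      by (intro always_eventually allI) (auto simp: selfadjoint_def)
  qed (use dist in auto)
  note cumulant_lim = cumulants_limit[OF Y F F_sa this cum]
  define t where "t = (\<lambda>k. Re (free_cumulant \<phi> F k))"
  have t_lim: "(\<lambda>n. \<Sum>i<N n. x n i ^ k) \<longlonglongrightarrow> t k" if "1 \<le> k" for k
    using tendsto_Re[OF cumulant_lim[of k]] cum[OF that] by (simp add: t_def)
  have t: "free_cumulant \<phi> F k = complex_of_real (t k)" for k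
  proof (cases "k = 0")
    case False
    hence "(\<lambda>n. Im (free_cumulant \<phi> (Y n) k)) = (\<lambda>_. 0)" using cum[of k] by simp
    hence "Im (free_cumulant \<phi> F k) = 0"
      using tendsto_Im[OF cumulant_lim[of k]] by (simp add: LIMSEQ_const_iff)
    thus ?thesis by (simp add: t_def complex_eq_iff)
  qed (simp add: t_def free_cumulant_0)
  interpret power_sum_limits x N t
    using t_lim by unfold_locales auto
  have "\<phi> (F ^ n) = 0" if "odd n" for n
  proof -
    have "\<phi> (F ^ n) = \<phi> ((- F) ^ n)" using Q by (simp add: has_law_def)
    also have "\<dots> = - \<phi> (F ^ n)"
      unfolding uminus_conv_scaleC[of F] scaleC_power using that F by simp
    finally show ?thesis by simp
  qed
  hence odd: "free_cumulant \<phi> F k = 0" if "odd k" for k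
    using free_cumulant_odd_eq_0 that by blast
  have t3: "t 3 = 0" and t1: "t 1 = 0" using odd[of 3] odd[of 1] by (simp_all add: t_def)
  have "free_cumulant \<phi> F 2 = \<phi> (F ^ 2)" using odd by (intro free_cumulant_2) simp
  hence t2: "t 2 \<le> 1" using assms(5) by (simp add: t_def)

  \<comment> \<open>The tetilla cumulants as real numbers, with the conventional \<open>0\<close> at
    index zero.\<close>
  define b :: "nat \<Rightarrow> real" where
    "b = (\<lambda>n. if n = 0 then 0 else (1 / sqrt 2) ^ n + (- 1 / sqrt 2) ^ n)"
  have b: "free_cumulant \<phi> F_infty n = complex_of_real (b n)" for n
    using free_cumulant_tetilla[OF assms(6-10), of n] free_cumulant_0[of \<phi> F_infty]
    unfolding assms(11) by (simp add: b_def)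
  have b_even: "b (2 * r) = 2 * (1 / 2) ^ r" if "1 \<le> r" for r
    using that by (simp add: b_def power_mult power_divide)
  have b_odd: "b n = 0" if "odd n" for n
    using that by (simp add: b_def power_divide)
  have t0: "t 0 = 0" by (simp add: t_def free_cumulant_0)
  \<comment> \<open>Nonnegativity accompanies the bound, because comparing moments means comparing
    products of cumulants.\<close>
  have tb: "0 \<le> t k \<and> t k \<le> b k" for k
  proof (cases "odd k")
    case True
    thus ?thesis using odd b_odd by (simp add: t_def)
  next
    case False
    then obtain r where r: "k = 2 * r" by auto
    show ?thesis
    proof (cases "r = 0")
      case True
      thus ?thesis using r t0 by (simp add: b_def)
    next
      case False
      thus ?thesis using r even_nonneg[of r] even_le[OF t3 t2, of r] b_even[of r] by simp
    qed
  qed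
  have moment: "\<phi> (F ^ n) = complex_of_real (nc_sum t n)" "\<phi> (F_infty ^ n) = complex_of_real (nc_sum b n)"
    if "1 \<le> n" for n
    using moment_cumulant[OF that, of \<phi> F] moment_cumulant[OF that, of \<phi> F_infty]
    by (simp_all add: nc_sum_def t b)
  \<comment> \<open>Equal cumulants give equal moments, so \<open>Q\<close>, a law of
    \<open>F\<close>, is a law of \<open>F_infty\<close> as well.\<close>
  have law: "same_law \<phi> F F_infty" if r: "2 \<le> r" and eq: "t (2 * r) = b (2 * r)" for r
  proof -
    have "t k = b k" for k
    proof (cases "odd k")
      case True
      thus ?thesis using odd b_odd by (simp add: t_def)
    next
      case False
      then obtain m where m: "k = 2 * m" by auto
      show ?thesis
      proof (cases "m = 0")
        case True
        thus ?thesis using m t0 by (simp add: b_def)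
      next
        case False
        thus ?thesis using m even_eq[OF t3 t2 r, of m] eq b_even[of m] b_even[of r] r by simp
      qed
    qed
    hence "t = b" by blast
    hence "\<phi> (F_infty ^ n) = \<phi> (F ^ n)" for n
      using moment[of n] by (cases "n = 0") auto
    moreover have "selfadjoint F_infty"
    proof -
      have "selfadjoint S1" "selfadjoint S2" using assms(7,9) by (auto simp: has_law_def)
      hence "is_adjoint (S1 ^ 2 - S2 ^ 2) (S1 ^ 2 - S2 ^ 2)"
        by (intro is_adjoint_diff selfadjoint_power)
      thus ?thesis
        using is_adjoint_scaleC[of _ _ "complex_of_real (1 / sqrt 2)"]
        by (simp add: assms(11) selfadjoint_def scaleR_conv_scaleC)
    qed
    ultimately have "has_law \<phi> F_infty Q" using Q(1) by (simp add: has_law_def)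
    thus ?thesis using Q(1) unfolding same_law_def by blast
  qed
  have "t (2 * r) = b (2 * r)" if "2 \<le> r" "free_cumulant \<phi> F (2 * r) = free_cumulant \<phi> F_infty (2 * r) \<or>
      \<phi> (F ^ (2 * r)) = \<phi> (F_infty ^ (2 * r))" for r
    using that(2)
  proof
    assume "\<phi> (F ^ (2 * r)) = \<phi> (F_infty ^ (2 * r))"
    thus ?thesis using nc_sum_mono(2)[of t b "2 * r"] tb moment[of "2 * r"] that(1) by simp
  qed (simp add: t b)
  thus ?thesis using law tb moment nc_sum_mono(1)[of t b] by (simp add: t b)
qed

end
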